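(* Under the standing assumptions of the context, let $0\le i\le T-1$. Assume $C_G(P_i)\le P_i$ and that every automorphism of $G$ induced by a derivation in $\mathrm{Der}(G/P_i,\Omega_1(Z(P_i)))$ is inner. If $C_G(P_{i+1})\not\le P_{i+1}$, then $G$ has a non-inner automorphism of order $p$.
   Context: Standing assumptions: $p$ is an odd prime; $G$ is a finite non-abelian $p$-group with cyclic center; $\Omega_1(Z(G))\le\gamma_3(G)G^p$ and $|\Phi(G)/\gamma_3(G)G^p|=p^T\ge p$. Fix normal subgroups $\gamma_3(G)G^p=P_T\le P_{T-1}\le\cdots\le P_1\le P_0=\Phi(G)$ with $|P_i/P_{i+1}|=p$. Here $\Omega_1(X)=\langle x:x^p=1\rangle$, $G^p=\langle g^p\rangle$. $\mathrm{Der}(G/P_i,\Omega_1(Z(P_i)))$ is the set of maps $\delta:G\to\Omega_1(Z(P_i))$ with $\delta(xy)=\delta(x)^y\delta(y)$ (conjugation action) and $\delta(P_i)=1$; the automorphism induced by $\delta$ is $g\mapsto g\delta(g)$. *)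

theory Defs
  imports "HOL-Algebra.Algebra"
begin

definition commutator :: "('a, 'b) monoid_scheme \<Rightarrow> 'a \<Rightarrow> 'a \<Rightarrow> 'a" where
  "commutator G x y = inv\<^bsub>G\<^esub> x \<otimes>\<^bsub>G\<^esub> inv\<^bsub>G\<^esub> y \<otimes>\<^bsub>G\<^esub> x \<otimes>\<^bsub>G\<^esub> y"

definition comm_subgroup :: "('a, 'b) monoid_scheme \<Rightarrow> 'a set \<Rightarrow> 'a set \<Rightarrow> 'a set" where
  "comm_subgroup G H K = generate G {commutator G h k | h k. h \<in> H \<and> k \<in> K}"

fun lower_central :: "('a, 'b) monoid_scheme \<Rightarrow> nat \<Rightarrow> 'a set" where
  "lower_central G 0 = carrier G"
| "lower_central G (Suc 0) = carrier G"
| "lower_central G (Suc (Suc n)) = comm_subgroup G (lower_central G (Suc n)) (carrier G)"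

definition power_subgroup :: "('a, 'b) monoid_scheme \<Rightarrow> nat \<Rightarrow> 'a set" where
  "power_subgroup G p = generate G {g [^]\<^bsub>G\<^esub> p | g. g \<in> carrier G}"

definition maximal_subgroup :: "('a, 'b) monoid_scheme \<Rightarrow> 'a set \<Rightarrow> bool" where
  "maximal_subgroup G M \<longleftrightarrow> subgroup M G \<and> M \<noteq> carrier G \<and>
     (\<forall>H. subgroup H G \<and> M \<subseteq> H \<longrightarrow> H = M \<or> H = carrier G)"

(* Frattini subgroup: intersection of all maximal subgroups (= G if there are none) *)
definition frattini :: "('a, 'b) monoid_scheme \<Rightarrow> 'a set" where
  "frattini G = carrier G \<inter> \<Inter> {M. maximal_subgroup G M}"

definition center_of :: "('a, 'b) monoid_scheme \<Rightarrow> 'a set \<Rightarrow> 'a set" where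
  "center_of G H = {z \<in> H. \<forall>x \<in> H. z \<otimes>\<^bsub>G\<^esub> x = x \<otimes>\<^bsub>G\<^esub> z}"

definition centralizer_of :: "('a, 'b) monoid_scheme \<Rightarrow> 'a set \<Rightarrow> 'a set" where
  "centralizer_of G S = {c \<in> carrier G. \<forall>s \<in> S. c \<otimes>\<^bsub>G\<^esub> s = s \<otimes>\<^bsub>G\<^esub> c}"

definition Omega1 :: "('a, 'b) monoid_scheme \<Rightarrow> nat \<Rightarrow> 'a set \<Rightarrow> 'a set" where
  "Omega1 G p S = generate G {x \<in> S. x [^]\<^bsub>G\<^esub> p = \<one>\<^bsub>G\<^esub>}"

(* Der(G/N, A): maps delta : G -> A with delta(xy) = delta(x)^y delta(y), delta(N) = 1 *)
definition derivations :: "('a, 'b) monoid_scheme \<Rightarrow> 'a set \<Rightarrow> 'a set \<Rightarrow> ('a \<Rightarrow> 'a) set" where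
  "derivations G N A = {\<delta>. (\<forall>x \<in> carrier G. \<delta> x \<in> A)
      \<and> (\<forall>x \<in> carrier G. \<forall>y \<in> carrier G.
           \<delta> (x \<otimes>\<^bsub>G\<^esub> y) = (inv\<^bsub>G\<^esub> y \<otimes>\<^bsub>G\<^esub> \<delta> x \<otimes>\<^bsub>G\<^esub> y) \<otimes>\<^bsub>G\<^esub> \<delta> y)
      \<and> (\<forall>x \<in> N. \<delta> x = \<one>\<^bsub>G\<^esub>)}"

definition is_inner :: "('a, 'b) monoid_scheme \<Rightarrow> ('a \<Rightarrow> 'a) \<Rightarrow> bool" where
  "is_inner G \<phi> \<longleftrightarrow> (\<exists>h \<in> carrier G. \<forall>g \<in> carrier G. \<phi> g = inv\<^bsub>G\<^esub> h \<otimes>\<^bsub>G\<^esub> g \<otimes>\<^bsub>G\<^esub> h)"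

end

theory Submission
  imports Defs
begin

text \<open>Write \<open>N = P_i\<close>, \<open>M = P_(i+1)\<close>, \<open>R = P_T\<close> and \<open>U = [G,G] R\<close>, let \<open>z\<close> generate \<open>\<Omega>_1(Z(G))\<close>,
  and suppose that every derivation whose automorphism has order \<open>p\<close> is inner. Homomorphisms
  \<open>G \<rightarrow> \<langle>z\<rangle>\<close> are then commutators with elements of the subgroup \<open>D\<close> of all \<open>d\<close> with
  \<open>[d,G] \<le> \<langle>z\<rangle>\<close>; it lies in \<open>Z(N)\<close> and is dual to \<open>G/U\<close> modulo \<open>Z(G)\<close>. Regard the elements of \<open>Z(N)\<close>
  as functions on \<open>G\<close>; then those of \<open>D\<close> are the affine functions. Quadratic extensions to \<open>G\<close> of
  characters of \<open>U/M\<close> and \<open>U/N\<close> give derivations with values in \<open>E = \<Omega>_1(D)\<close>. These are induced by an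
  \<open>h\<close> centralizing \<open>M\<close> but not \<open>N\<close>, and by a \<open>y\<close> in \<open>Z(N)\<close> outside of \<open>M\<close> with
  \<open>[y, C_G(M)] \<le> \<langle>z\<rangle>\<close> (if \<open>D\<close> is not contained in \<open>M\<close>, take \<open>y\<close> in \<open>D\<close>). For a suitable noncentral
  \<open>w \<in> E\<close> and a suitable \<open>c\<close> of order \<open>p\<close> in \<open>\<langle>y, h, D\<rangle>\<close>, the product of the functions \<open>w\<close> and \<open>c\<close>
  defines one more derivation. If it is induced by \<open>x\<close>, then the commutator of \<open>x\<close> with \<open>y\<close> or \<open>h\<close>
  is a power of \<open>w\<close> outside of \<open>\<langle>z\<rangle>\<close>, which contradicts \<open>[Z(N), C_G(M)] \<le> \<langle>z\<rangle>\<close>.\<close>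

section \<open>Conjugation and characters modulo p\<close>

text \<open>The obstacle is the order \<open>p\<close>. A derivation gives an automorphism of order
  \<open>p\<close> if its values have order \<open>p\<close> and it vanishes on them, but the
  product of two elements of \<open>E\<close> is only known to have its \<open>p\<close>-th power in
  Z(G). Since Z(G) is cyclic, Z(G)/Z(G)^p has order \<open>p\<close>, so this obstruction costs one
  character: the factors whose product with \<open>w\<close> can be given order \<open>p\<close>
  form a subgroup \<open>E1 w\<close> of index at most \<open>p\<close> in \<open>E\<close>. The
  last derivation therefore needs [c,G] inside \<open>E1 w\<close>, and so \<open>h\<close>, and
  sometimes \<open>y\<close>, must be built with commutators in \<open>E1 w\<close> instead of
  \<open>E\<close>. The quadratic construction with values in a subgroup V of \<open>E\<close> works
  when the form \<eta>([a,b]) vanishes on C_G(V). For V = \<open>E\<close> this holds because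
  C_G(E)/U is cyclic; for V = \<open>E1 w\<close> it dictates the choice of \<open>w\<close>
  relative to \<open>u0\<close>, the value of a preliminary derivation at a generator of C_G(E)/U.
  The oddness of \<open>p\<close> enters twice: 2 is invertible, which puts \<open>E\<close> inside
  \<open>M\<close>, and \<open>p\<close> divides the binomial coefficient (p choose 2).\<close>

context group
begin

text \<open>A right action. Centralizing is expressed throughout by fixed-point equations
  \<open>cj g x = x\<close>, which combine through \<open>cj_mult\<close> and
  \<open>cj_cj\<close>.\<close>

definition cj :: "'a \<Rightarrow> 'a \<Rightarrow> 'a" where
  "cj b x = inv b \<otimes> x \<otimes> b"

lemma cj_closed [simp, intro]: "b \<in> carrier G \<Longrightarrow> x \<in> carrier G \<Longrightarrow> cj b x \<in> carrier G"
  by (simp add: cj_def)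

lemma mult_inv_cancel [simp]:
  "x \<in> carrier G \<Longrightarrow> y \<in> carrier G \<Longrightarrow> x \<otimes> (inv x \<otimes> y) = y"
  "x \<in> carrier G \<Longrightarrow> y \<in> carrier G \<Longrightarrow> inv x \<otimes> (x \<otimes> y) = y"
  by (simp_all add: m_assoc[symmetric])

lemma cj_mult: "b \<in> carrier G \<Longrightarrow> x \<in> carrier G \<Longrightarrow> y \<in> carrier G \<Longrightarrow>
    cj b (x \<otimes> y) = cj b x \<otimes> cj b y"
  by (simp add: cj_def m_assoc)

lemma cj_cj: "a \<in> carrier G \<Longrightarrow> b \<in> carrier G \<Longrightarrow> x \<in> carrier G \<Longrightarrow>
    cj b (cj a x) = cj (a \<otimes> b) x"
  by (simp add: cj_def m_assoc inv_mult_group)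

lemma cj_one [simp]: "b \<in> carrier G \<Longrightarrow> cj b \<one> = \<one>" "x \<in> carrier G \<Longrightarrow> cj \<one> x = x"
  by (simp_all add: cj_def)

lemma cj_inv: "b \<in> carrier G \<Longrightarrow> x \<in> carrier G \<Longrightarrow> cj b (inv x) = inv (cj b x)"
  by (simp add: cj_def m_assoc inv_mult_group)

lemma cj_hom: "b \<in> carrier G \<Longrightarrow> cj b \<in> hom G G"
  by (auto simp: hom_def cj_mult)

lemma cj_int_pow: "b \<in> carrier G \<Longrightarrow> x \<in> carrier G \<Longrightarrow> cj b (x [^] (k::int)) = cj b x [^] k"
  by (metis cj_hom hom_int_pow group_axioms)

lemma cj_fix_iff: "b \<in> carrier G \<Longrightarrow> x \<in> carrier G \<Longrightarrow> cj b x = x \<longleftrightarrow> x \<otimes> b = b \<otimes> x"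
  by (metis cj_def inv_closed inv_solve_left m_assoc m_closed)

lemma cj_commute: "b \<in> carrier G \<Longrightarrow> x \<in> carrier G \<Longrightarrow> x \<otimes> b = b \<otimes> cj b x"
  by (simp add: cj_def m_assoc)

lemma cj_eq_commutator: "b \<in> carrier G \<Longrightarrow> x \<in> carrier G \<Longrightarrow> cj b x = x \<otimes> commutator G x b"
  by (simp add: cj_def commutator_def m_assoc)

lemma commutator_eq_cj: "b \<in> carrier G \<Longrightarrow> x \<in> carrier G \<Longrightarrow> commutator G x b = inv x \<otimes> cj b x"
  by (simp add: cj_def commutator_def m_assoc)

lemma commutator_closed [simp, intro]:
  "b \<in> carrier G \<Longrightarrow> x \<in> carrier G \<Longrightarrow> commutator G x b \<in> carrier G"
  by (simp add: commutator_def)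

lemma int_pow_commute:
  assumes "x \<otimes> y = y \<otimes> x" "x \<in> carrier G" "y \<in> carrier G"
  shows "x [^] (k::int) \<otimes> y = y \<otimes> x [^] k"
  by (metis assms cj_fix_iff cj_int_pow int_pow_closed)

lemma subgroup_int_pow: "subgroup H G \<Longrightarrow> h \<in> H \<Longrightarrow> h [^] (k::int) \<in> H"
  by (rule subgroup_int_pow_closed)

lemma commutator_mult_left:
  assumes "a \<in> carrier G" "b \<in> carrier G" "g \<in> carrier G"
  shows "commutator G (a \<otimes> b) g = cj b (commutator G a g) \<otimes> commutator G b g"
  using assms by (simp add: commutator_def cj_def m_assoc inv_mult_group)

lemma commutator_mult_right:
  assumes "a \<in> carrier G" "b \<in> carrier G" "g \<in> carrier G"
  shows "commutator G g (a \<otimes> b) = commutator G g b \<otimes> cj b (commutator G g a)"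
  using assms by (simp add: commutator_def cj_def m_assoc inv_mult_group)

end

text \<open>The prime is an integer here, so that all exponents are integers.\<close>

locale fin_p_group = group G for G (structure) + fixes p :: int
  assumes fin: "finite (carrier G)" and prime_p: "Factorial_Ring.prime p" and odd_p: "odd p"
begin

abbreviation cong_p :: "int \<Rightarrow> int \<Rightarrow> bool" (infix \<open>\<doteq>\<close> 50) where
  "i \<doteq> j \<equiv> p dvd (i - j)"

lemma int_pow_cong:
  assumes "x \<in> carrier G" "x [^] p = \<one>" "i \<doteq> j"
  shows "x [^] i = x [^] j"
proof -
  from assms(3) obtain k where "i = j + p * k" by (auto simp: dvd_def algebra_simps)
  then show ?thesis using assms(1,2)
    by (simp add: int_pow_mult int_pow_pow[symmetric])
qed

lemma int_pow_one_dvd: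
  assumes "x \<in> carrier G" "x [^] p = \<one>" "x \<noteq> \<one>" "x [^] i = \<one>"
  shows "p dvd i"
proof (rule ccontr)
  assume "\<not> p dvd i"
  then have "coprime (p) i" using prime_p by (simp add: prime_imp_coprime)
  then obtain u v where uv: "u * p + v * i = 1" by (metis bezout_int coprime_imp_gcd_eq_1)
  have "x = x [^] (p * u + i * v)" using uv assms(1) by (simp add: mult.commute)
  also have "\<dots> = \<one>" using assms by (simp add: int_pow_mult int_pow_pow[symmetric])
  finally show False using assms(3) by simp
qed

lemma int_pow_eq_cong:
  assumes "x \<in> carrier G" "x [^] p = \<one>" "x \<noteq> \<one>" "x [^] i = x [^] j"
  shows "i \<doteq> j"
proof (rule int_pow_one_dvd[OF assms(1-3)])
  show "x [^] (i - j) = \<one>" using assms(1,4) by (simp add: int_pow_diff)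
qed

text \<open>Characters are written additively, as integer valued functions that are additive modulo p.\<close>

definition pchar :: "'a set \<Rightarrow> ('a \<Rightarrow> int) \<Rightarrow> bool" where
  "pchar Y f \<longleftrightarrow> (\<forall>a\<in>Y. \<forall>b\<in>Y. f (a \<otimes> b) \<doteq> f a + f b)"

lemma pcharD: "pchar Y f \<Longrightarrow> a \<in> Y \<Longrightarrow> b \<in> Y \<Longrightarrow> f (a \<otimes> b) \<doteq> f a + f b"
  by (simp add: pchar_def)

lemma cong_sym: "i \<doteq> j \<Longrightarrow> j \<doteq> i"
  by Groebner_Basis.algebra

lemma pchar_mono: "pchar Y f \<Longrightarrow> V \<subseteq> Y \<Longrightarrow> pchar V f"
  by (auto simp: pchar_def)

lemma pchar_one: assumes "subgroup Y G" "pchar Y f" shows "f \<one> \<doteq> 0"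
proof -
  note o = subgroup.one_closed[OF assms(1)]
  show ?thesis using pcharD[OF assms(2) o o] by simp
qed

lemma pchar_inv: assumes "subgroup Y G" "pchar Y f" "a \<in> Y" shows "f (inv a) \<doteq> - f a"
proof -
  have "f (a \<otimes> inv a) \<doteq> f a + f (inv a)"
    by (rule pcharD[OF assms(2,3) subgroup.m_inv_closed[OF assms(1,3)]])
  moreover have "a \<otimes> inv a = \<one>" by (rule r_inv[OF subgroup.mem_carrier[OF assms(1,3)]])
  ultimately have "f \<one> \<doteq> f a + f (inv a)" by simp
  then show ?thesis using pchar_one[OF assms(1,2)] by Groebner_Basis.algebra
qed

lemma pchar_nat_pow: assumes "subgroup Y G" "pchar Y f" "a \<in> Y" 
  shows "f (a [^] (n::nat)) \<doteq> int n * f a"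
proof (induction n)
  case 0 then show ?case using pchar_one[OF assms(1,2)] by simp
next
  case (Suc n)
  have "a [^] n \<in> Y" using assms by (metis int_pow_int subgroup_int_pow)
  then have "f (a [^] n \<otimes> a) \<doteq> f (a [^] n) + f a" using assms pcharD by blast
  with Suc have "f (a [^] n \<otimes> a) \<doteq> int n * f a + f a" by Groebner_Basis.algebra
  then show ?case by (simp add: algebra_simps)
qed

lemma pchar_int_pow: assumes "subgroup Y G" "pchar Y f" "a \<in> Y" 
  shows "f (a [^] (k::int)) \<doteq> k * f a"
proof (cases k)
  case (nonneg n)
  then show ?thesis using pchar_nat_pow[OF assms, of n] by (simp only: int_pow_int)
next
  case (neg n)
  have i: "a [^] Suc n \<in> Y" using subgroup_int_pow[OF assms(1,3), of "int (Suc n)"] by (simp only: int_pow_int)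
  have "a [^] k = inv (a [^] Suc n)"
    unfolding neg by (rule int_pow_neg_int[OF subgroup.mem_carrier[OF assms(1,3)]])
  then have "f (a [^] k) \<doteq> - f (a [^] Suc n)" using pchar_inv[OF assms(1,2) i] by (simp only:)
  moreover have "f (a [^] Suc n) \<doteq> - k * f a" 
    using pchar_nat_pow[OF assms, of "Suc n"] unfolding neg by (simp only: minus_minus)
  ultimately show ?thesis by Groebner_Basis.algebra
qed

lemma pchar_commutator: assumes "subgroup Y G" "pchar Y f" "a \<in> Y" "b \<in> Y"
  shows "f (commutator G a b) \<doteq> 0"
proof -
  note m = subgroup.m_closed[OF assms(1)] and D = pcharD[OF assms(2)]
  note a = assms(3) subgroup.m_inv_closed[OF assms(1,3)]
  note b = assms(4) subgroup.m_inv_closed[OF assms(1,4)]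
  note i = m[OF a(2) b(2)] m[OF m[OF a(2) b(2)] a(1)]
  have "f (inv a \<otimes> inv b \<otimes> a \<otimes> b) \<doteq> 0"
    using D[OF a(2) b(2)] D[OF i(1) a(1)] D[OF i(2) b(1)] pchar_inv[OF assms(1-3)] 
      pchar_inv[OF assms(1,2,4)] by Groebner_Basis.algebra
  then show ?thesis unfolding commutator_def .
qed

lemma pchar_kernel: assumes "subgroup Y G" "pchar Y f"
  shows "subgroup {y \<in> Y. f y \<doteq> 0} G"
proof (rule subgroupI)
  show "{y \<in> Y. f y \<doteq> 0} \<subseteq> carrier G" using assms subgroup.subset by blast
  show "{y \<in> Y. f y \<doteq> 0} \<noteq> {}" using pchar_one[OF assms] subgroup.one_closed[OF assms(1)] by auto
  fix a b assume a: "a \<in> {y \<in> Y. f y \<doteq> 0}" and b: "b \<in> {y \<in> Y. f y \<doteq> 0}"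
  have "f (inv a) \<doteq> - f a" "f a \<doteq> 0" using a pchar_inv[OF assms] by blast+
  then have "f (inv a) \<doteq> 0" by Groebner_Basis.algebra
  then show "inv a \<in> {y \<in> Y. f y \<doteq> 0}" using a subgroup.m_inv_closed[OF assms(1)] by blast
  have "f (a \<otimes> b) \<doteq> f a + f b" "f a \<doteq> 0" "f b \<doteq> 0" using a b pcharD[OF assms(2)] by blast+
  then have "f (a \<otimes> b) \<doteq> 0" by Groebner_Basis.algebra
  then show "a \<otimes> b \<in> {y \<in> Y. f y \<doteq> 0}" using a b subgroup.m_closed[OF assms(1)] by blast
qed

lemma prime_inverse:
  assumes "\<not> p dvd i" obtains j where "i * j \<doteq> 1"
proof -
  have "coprime (p) i" using prime_p assms by (simp add: prime_imp_coprime)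
  then obtain u v where "u * p + v * i = 1" by (metis bezout_int coprime_imp_gcd_eq_1)
  then have "i * v \<doteq> 1" by Groebner_Basis.algebra
  then show ?thesis using that by blast
qed

section \<open>Adjoining one element to a subgroup, and characters that separate points\<close>

lemma power_outside:
  assumes "subgroup L G" "t \<in> carrier G" "t \<notin> L" "t [^] p \<in> L" "t [^] k \<in> L"
  shows "p dvd k"
proof (rule ccontr)
  assume "\<not> p dvd k"
  then obtain j where "k * j \<doteq> 1" using prime_inverse by blast
  then obtain m where "1 = k * j + p * m" by (metis dvd_def add.commute diff_add_cancel mult_minus_right minus_diff_eq) 
  then have "t = (t [^] k) [^] j \<otimes> (t [^] p) [^] m"
    using assms(2) int_pow_1[of t] by (simp add: int_pow_pow int_pow_mult[symmetric])
  then show False using assms subgroup_int_pow subgroup.m_closed by metis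
qed

text \<open>When the powers of \<open>t\<close> normalize \<open>L\<close>, this is the subgroup
  generated by \<open>L\<close> and \<open>t\<close>.\<close>

definition adj :: "'a set \<Rightarrow> 'a \<Rightarrow> 'a set" where
  "adj L t = {t [^] (k::int) \<otimes> x | k x. x \<in> L}"

lemma adjI: "x \<in> L \<Longrightarrow> t [^] (k::int) \<otimes> x \<in> adj L t"
  by (auto simp: adj_def)

lemma adj_subgroup:
  assumes L: "subgroup L G" and t: "t \<in> carrier G"
    and n: "\<And>x k. x \<in> L \<Longrightarrow> cj (t [^] (k::int)) x \<in> L"
  shows "subgroup (adj L t) G" "L \<subseteq> adj L t" "t \<in> adj L t"
proof -
  note s = subgroup.mem_carrier[OF L]
  have mult: "(t [^] k \<otimes> x) \<otimes> (t [^] l \<otimes> y) = t [^] (k + l) \<otimes> (cj (t [^] l) x \<otimes> y)"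
    if "x \<in> L" "y \<in> L" for k l :: int and x y
    using t s that by (simp add: cj_def m_assoc int_pow_mult)
  show "subgroup (adj L t) G"
  proof (rule subgroupI)
    show "adj L t \<subseteq> carrier G" using t s by (auto simp: adj_def)
    show "adj L t \<noteq> {}" using adjI subgroup.one_closed[OF L] by blast
    fix a b assume a: "a \<in> adj L t" and b: "b \<in> adj L t"
    then obtain k l x y where ab: "a = t [^] (k::int) \<otimes> x" "b = t [^] (l::int) \<otimes> y" "x \<in> L" "y \<in> L"
      by (auto simp: adj_def)
    show "a \<otimes> b \<in> adj L t" unfolding ab(1,2) mult[OF ab(3,4)]
      by (intro adjI subgroup.m_closed[OF L] n ab)
    have "inv a = t [^] (-k) \<otimes> cj (t [^] (-k)) (inv x)"
      unfolding ab(1) using t s ab(3) by (simp add: inv_mult_group int_pow_neg cj_def m_assoc)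
    then show "inv a \<in> adj L t" using adjI n subgroup.m_inv_closed[OF L ab(3)] by metis
  qed
  show "L \<subseteq> adj L t" using adjI[of _ L t 0] s by fastforce
  show "t \<in> adj L t" using adjI[of \<one> L t 1] t subgroup.one_closed[OF L] by simp
qed

lemma adj_least:
  assumes "subgroup H G" "L \<subseteq> H" "t \<in> H" shows "adj L t \<subseteq> H"
  using assms subgroup_int_pow subgroup.m_closed by (fastforce simp: adj_def)

text \<open>Replaces induction over subgroups: a maximal subgroup with a given property must be
  everything as soon as the property survives the adjunction of one element.\<close>

lemma maximal_set:
  assumes "P V" "\<And>Y. P Y \<Longrightarrow> Y \<subseteq> carrier G"
  obtains Y where "P Y" "V \<subseteq> Y" "\<And>W. P W \<Longrightarrow> Y \<subseteq> W \<Longrightarrow> W = Y"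
proof -
  have "finite {Y. P Y}" using fin assms(2) by (metis (no_types, lifting) Collect_mono Pow_def finite_Pow_iff finite_subset mem_Collect_eq)
  from finite_has_maximal2[OF this, of V] assms(1) show ?thesis using that by auto
qed

lemma cj_in:
  assumes "subgroup L G" "x \<in> L" "b \<in> carrier G" "commutator G x b \<in> L"
  shows "cj b x \<in> L"
  using assms by (metis cj_eq_commutator subgroup.m_closed subgroup.mem_carrier)

lemma adj_add:
  assumes L: "subgroup L G" and t: "t \<in> carrier G"
    and n: "\<And>x k. x \<in> L \<Longrightarrow> cj (t [^] (k::int)) x \<in> L"
    and ab: "inv (t [^] (i::int)) \<otimes> a \<in> L" "inv (t [^] (j::int)) \<otimes> b \<in> L" "a \<in> carrier G" "b \<in> carrier G"
  shows "inv (t [^] (i + j)) \<otimes> (a \<otimes> b) \<in> L"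
proof -
  have "inv (t [^] (i + j)) \<otimes> (a \<otimes> b) = cj (t [^] j) (inv (t [^] i) \<otimes> a) \<otimes> (inv (t [^] j) \<otimes> b)"
    using t ab(3,4) by (simp add: cj_def m_assoc int_pow_mult inv_mult_group)
  also have "\<dots> \<in> L" using L n ab subgroup.m_closed by metis
  finally show ?thesis .
qed

text \<open>Together with \<open>adj_add\<close>: the exponent of \<open>t\<close> is a character
  modulo \<open>p\<close> of \<open>adj L t\<close> that vanishes on \<open>L\<close>.\<close>

lemma adj_unique:
  assumes L: "subgroup L G" and t: "t \<in> carrier G" "t \<notin> L" "t [^] p \<in> L"
    and a: "inv (t [^] (i::int)) \<otimes> a \<in> L" "inv (t [^] (j::int)) \<otimes> a \<in> L" "a \<in> carrier G"
  shows "i \<doteq> j"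
proof (rule power_outside[OF L t])
  have "t [^] (i - j) = t [^] (- j) \<otimes> t [^] i"
    using t(1) int_pow_mult[of t "-j" i] by simp
  also have "\<dots> = (inv (t [^] j) \<otimes> a) \<otimes> inv (inv (t [^] i) \<otimes> a)"
    using t a(3) by (simp add: int_pow_neg inv_mult_group m_assoc)
  finally show "t [^] (i - j) \<in> L"
    using subgroup.m_closed[OF L a(2) subgroup.m_inv_closed[OF L a(1)]] by simp
qed

text \<open>Y/V is elementary abelian. A subgroup \<open>L\<close> that contains \<open>V\<close>
  and is maximal without \<open>c\<close> is a hyperplane of \<open>Y\<close> complementing
  \<open>c\<close>, and \<open>f\<close> reads off the exponent of \<open>c\<close> modulo
  \<open>L\<close>.\<close>

lemma separation:
  assumes Y: "subgroup Y G" and V: "subgroup V G" "V \<subseteq> Y"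
    and comm: "\<And>a b. a \<in> Y \<Longrightarrow> b \<in> Y \<Longrightarrow> commutator G a b \<in> V"
    and pow: "\<And>y. y \<in> Y \<Longrightarrow> y [^] p \<in> V"
    and c: "c \<in> Y" "c \<notin> V"
  obtains f where "pchar Y f" "\<And>x. x \<in> V \<Longrightarrow> f x \<doteq> 0" "f c \<doteq> 1"
proof -
  note Yc = subgroup.mem_carrier[OF Y]
  obtain L where L: "subgroup L G \<and> V \<subseteq> L \<and> L \<subseteq> Y \<and> c \<notin> L"
    and max: "\<And>W. subgroup W G \<and> V \<subseteq> W \<and> W \<subseteq> Y \<and> c \<notin> W \<Longrightarrow> L \<subseteq> W \<Longrightarrow> W = L"
    by (rule maximal_set[of "\<lambda>L. subgroup L G \<and> V \<subseteq> L \<and> L \<subseteq> Y \<and> c \<notin> L" V])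
       (use V c Yc in auto)
  then have Ls: "subgroup L G" and VL: "V \<subseteq> L" and LY: "L \<subseteq> Y" and cL: "c \<notin> L" by auto
  have norm: "cj (b [^] (k::int)) x \<in> L" if "x \<in> L" "b \<in> Y" for b x k
  proof -
    have "b [^] k \<in> Y" using that Y subgroup_int_pow by blast
    then show ?thesis using that VL LY comm Yc by (intro cj_in[OF Ls]) auto
  qed
  have ex: "\<exists>k::int. inv (c [^] k) \<otimes> y \<in> L" if y: "y \<in> Y" for y
  proof (cases "y \<in> L")
    case True then show ?thesis by (intro exI[of _ 0]) (use Yc y in simp)
  next
    case False
    note a = adj_subgroup[OF Ls Yc[OF y] norm[OF _ y]]
    have "adj L y \<subseteq> Y" by (rule adj_least[OF Y LY y])
    with a False max[of "adj L y"] VL have "c \<in> adj L y" by (metis subset_trans)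
    then obtain k x where kx: "c = y [^] (k::int) \<otimes> x" "x \<in> L" by (auto simp: adj_def)
    have nk: "\<not> p dvd k"
    proof
      assume "p dvd k"
      then obtain m where "k = p * m" by blast
      then have "y [^] k = (y [^] p) [^] m" using Yc y by (simp add: int_pow_pow)
      then have "y [^] k \<in> L" using pow[OF y] VL subgroup_int_pow[OF Ls] by auto
      then show False using kx cL subgroup.m_closed[OF Ls] by metis
    qed
    then obtain j where j: "k * j \<doteq> 1" using prime_inverse by blast
    have cy: "inv (y [^] k) \<otimes> c \<in> L" using kx Yc y LY by (simp add: subset_iff)
    \<comment> \<open>Modulo \<open>L\<close> the element \<open>c\<close> equals
      \<open>y [^] k\<close>. Raising this to a power inverse to \<open>k\<close> modulo
      \<open>p\<close> expresses \<open>y\<close> by \<open>c\<close>.\<close>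
    have *: "inv (y [^] (k * int n)) \<otimes> c [^] int n \<in> L" for n
    proof (induction n)
      case 0 then show ?case using subgroup.one_closed[OF Ls] by simp
    next
      case (Suc n)
      have "inv (y [^] (k * int n + k)) \<otimes> (c [^] int n \<otimes> c) \<in> L"
        by (rule adj_add[OF Ls Yc[OF y] norm[OF _ y] Suc cy]) (use c Yc in auto)
      moreover have "c [^] int (Suc n) = c [^] int n \<otimes> c"
        using int_pow_mult[of c "int n" 1] c Yc by (simp add: add.commute)
      moreover have "k * int (Suc n) = k * int n + k" by (simp add: distrib_left)
      ultimately show ?case by simp
    qed
    \<comment> \<open>The inverse of \<open>k\<close> is needed as a natural number, because the
      power rule above was proved by induction.\<close>
    define n where "n = nat (j mod p)"
    have "int n = j mod p" using prime_gt_0_int[OF prime_p] by (simp add: n_def)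
    then have "j \<doteq> int n" by (simp add: minus_mod_eq_mult_div)
    with j have "k * int n \<doteq> 1" by Groebner_Basis.algebra
    then obtain m where m: "k * int n = 1 + p * m" by (metis dvd_def add.commute diff_add_cancel)
    define w where "w = inv (y [^] (k * int n)) \<otimes> c [^] int n"
    have wL: "w \<in> L" using * by (simp add: w_def)
    have "y [^] (k * int n) = y \<otimes> (y [^] p) [^] m"
      unfolding m using Yc y by (simp add: int_pow_mult int_pow_pow)
    moreover have "c [^] int n = y [^] (k * int n) \<otimes> w" using Yc y c by (simp add: w_def)
    ultimately have "inv (c [^] int n) \<otimes> y = inv ((y [^] p) [^] m \<otimes> w)"
      using Yc y wL LY by (simp add: inv_mult_group m_assoc subset_iff)
    moreover have "(y [^] p) [^] m \<in> L" using pow[OF y] VL subgroup_int_pow[OF Ls] by auto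
    ultimately show ?thesis using wL subgroup.m_closed[OF Ls] subgroup.m_inv_closed[OF Ls] by metis
  qed
  define f where "f y = (SOME k::int. inv (c [^] k) \<otimes> y \<in> L)" for y
  have f: "inv (c [^] f y) \<otimes> y \<in> L" if "y \<in> Y" for y
    unfolding f_def by (rule someI_ex[OF ex[OF that]])
  have cp: "c [^] p \<in> L" using pow c VL by auto
  note uniq = adj_unique[OF Ls Yc[OF c(1)] cL cp]
  show ?thesis
  proof
    show "pchar Y f" unfolding pchar_def
    proof (intro ballI)
      fix a b assume ab: "a \<in> Y" "b \<in> Y"
      show "f (a \<otimes> b) \<doteq> f a + f b"
        by (rule uniq[OF f adj_add[OF Ls _ norm f f]])
           (use ab Y Yc c subgroup.m_closed[OF Y] in auto)
    qed
    show "f x \<doteq> 0" if "x \<in> V" for x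
      by (rule uniq[OF f]) (use that subsetD[OF VL that] Yc subsetD[OF V(2) that] in simp_all)
    show "f c \<doteq> 1"
      by (rule uniq[OF f]) (use c Yc subgroup.one_closed[OF Ls] in auto)
  qed
qed

text \<open>The kernel of \<eta> in \<open>S\<close> still contains all commutators and
  \<open>p\<close>-th powers of \<open>Y\<close>, and it has index at most \<open>p\<close> in
  \<open>S\<close>. Hence a character of \<open>Y\<close> that separates one \<open>s\<close> from
  this kernel extends \<eta> after rescaling by \<eta>(s).\<close>

lemma pchar_extend:
  assumes Y: "subgroup Y G" and S: "subgroup S G" "S \<subseteq> Y" and \<eta>: "pchar S \<eta>"
    and comm: "\<And>a b. a \<in> Y \<Longrightarrow> b \<in> Y \<Longrightarrow> commutator G a b \<in> S \<and> \<eta> (commutator G a b) \<doteq> 0"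
    and pow: "\<And>y. y \<in> Y \<Longrightarrow> y [^] p \<in> S \<and> \<eta> (y [^] p) \<doteq> 0"
  obtains f where "pchar Y f" "\<And>x. x \<in> S \<Longrightarrow> f x \<doteq> \<eta> x"
proof (cases "\<forall>s\<in>S. \<eta> s \<doteq> 0")
  case True
  have "pchar Y (\<lambda>_. 0)" by (simp add: pchar_def)
  then show ?thesis by (rule that) (use True in \<open>simp add: dvd_minus_iff\<close>)
next
  case False
  then obtain s where s: "s \<in> S" "\<not> \<eta> s \<doteq> 0" by blast
  then obtain j where j: "\<eta> s * j \<doteq> 1" using prime_inverse by auto
  note K = pchar_kernel[OF S(1) \<eta>]
  obtain f where f: "pchar Y f" "\<And>x. x \<in> {y \<in> S. \<eta> y \<doteq> 0} \<Longrightarrow> f x \<doteq> 0" "f s \<doteq> 1"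
    by (rule separation[OF Y K, of s]) (use S comm pow s in auto)
  show ?thesis
  proof
    show "pchar Y (\<lambda>y. \<eta> s * f y)" unfolding pchar_def
    proof (intro ballI)
      fix a b assume "a \<in> Y" "b \<in> Y"
      then have "f (a \<otimes> b) \<doteq> f a + f b" by (rule pcharD[OF f(1)])
      then show "\<eta> s * f (a \<otimes> b) \<doteq> \<eta> s * f a + \<eta> s * f b" by Groebner_Basis.algebra
    qed
    fix x assume x: "x \<in> S"
    \<comment> \<open>This exponent moves \<open>x\<close> into the kernel of \<eta>.\<close>
    define k where "k = - j * \<eta> x"
    have sk: "s [^] k \<in> S" using subgroup_int_pow S s by blast
    have "\<eta> (x \<otimes> s [^] k) \<doteq> \<eta> x + \<eta> (s [^] k)" "\<eta> (s [^] k) \<doteq> k * \<eta> s"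
      using pcharD[OF \<eta> x sk] pchar_int_pow[OF S(1) \<eta> s(1)] by blast+
    with j have 1: "\<eta> (x \<otimes> s [^] k) \<doteq> 0" unfolding k_def by Groebner_Basis.algebra
    have "f (x \<otimes> s [^] k) \<doteq> f x + f (s [^] k)" "f (s [^] k) \<doteq> k * f s"
      using pcharD[OF f(1) subsetD[OF S(2) x] subsetD[OF S(2) sk]]
        pchar_int_pow[OF Y f(1) subsetD[OF S(2) s(1)]] by blast+
    moreover have "f (x \<otimes> s [^] k) \<doteq> 0" using f(2) 1 x sk S subgroup.m_closed by fastforce
    ultimately show "\<eta> s * f x \<doteq> \<eta> x" using f(3) j unfolding k_def by Groebner_Basis.algebra
  qed
qed

end

section \<open>Affine elements\<close>

text \<open>In the notation of the theorem \<open>R\<close>, \<open>M\<close> and \<open>N\<close> are \<open>P_T\<close>, \<open>P_(i+1)\<close> and \<open>P_i\<close>, and \<open>U\<close> is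
  generated by \<open>R\<close> and all commutators. The last assumption says that all automorphisms of order \<open>p\<close>
  that are of the form \<open>g \<mapsto> g \<delta>(g)\<close> are inner (\<open>x\<close> is the inverse of the conjugating element).\<close>

locale p_stage = fin_p_group G p for G (structure) and p +
  fixes z :: 'a and R U M N :: "'a set"
  assumes z_closed [simp]: "z \<in> carrier G" and z_neq: "z \<noteq> \<one>" and z_pow: "z [^] p = \<one>"
    and z_central: "\<And>g. g \<in> carrier G \<Longrightarrow> cj g z = z"
    and z_gen: "\<And>x. x \<in> carrier G \<Longrightarrow> (\<And>g. g \<in> carrier G \<Longrightarrow> cj g x = x) \<Longrightarrow> x [^] p = \<one> \<Longrightarrow>
        \<exists>k::int. x = z [^] k"
    and central_power: "\<And>u v. u \<in> carrier G \<Longrightarrow> v \<in> carrier G \<Longrightarrow>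
        (\<And>g. g \<in> carrier G \<Longrightarrow> cj g u = u) \<Longrightarrow> (\<And>g. g \<in> carrier G \<Longrightarrow> cj g v = v) \<Longrightarrow>
        \<not> (\<exists>r\<in>carrier G. (\<forall>g\<in>carrier G. cj g r = r) \<and> r [^] p = u) \<Longrightarrow>
        \<exists>i::int. \<exists>r\<in>carrier G. (\<forall>g\<in>carrier G. cj g r = r) \<and> r [^] p = v \<otimes> u [^] i"
    and R_sub: "subgroup R G" and M_sub: "subgroup M G" and N_sub: "subgroup N G" and U_sub: "subgroup U G"
    and R_M: "R \<subseteq> M" and M_N: "M \<subseteq> N" and N_U: "N \<subseteq> U" and z_R: "z \<in> R"
    and U_comm: "\<And>a b. a \<in> carrier G \<Longrightarrow> b \<in> carrier G \<Longrightarrow> commutator G a b \<in> U"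
    and U_central: "\<And>u g. u \<in> U \<Longrightarrow> g \<in> carrier G \<Longrightarrow> commutator G u g \<in> R"
    and R_pow: "\<And>g. g \<in> carrier G \<Longrightarrow> g [^] p \<in> R"
    and U_char: "\<And>f u. pchar (carrier G) f \<Longrightarrow> u \<in> U \<Longrightarrow> f u \<doteq> 0"
    and U_gen: "\<And>f u. pchar U f \<Longrightarrow> (\<And>r. r \<in> R \<Longrightarrow> f r \<doteq> 0) \<Longrightarrow>
        (\<And>a b. a \<in> carrier G \<Longrightarrow> b \<in> carrier G \<Longrightarrow> f (commutator G a b) \<doteq> 0) \<Longrightarrow> u \<in> U \<Longrightarrow> f u \<doteq> 0"
    and N_M: "\<And>y n. y \<in> N \<Longrightarrow> y \<notin> M \<Longrightarrow> n \<in> N \<Longrightarrow> \<exists>k::int. \<exists>m\<in>M. n = y [^] k \<otimes> m"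
    and M_proper: "\<exists>y\<in>N. y \<notin> M"
    and N_self: "\<And>c. c \<in> carrier G \<Longrightarrow> (\<And>n. n \<in> N \<Longrightarrow> cj n c = c) \<Longrightarrow> c \<in> N"
    and derivation_inner: "\<And>\<delta>. (\<And>a. a \<in> carrier G \<Longrightarrow> \<delta> a \<in> carrier G) \<Longrightarrow>
        (\<And>a b. a \<in> carrier G \<Longrightarrow> b \<in> carrier G \<Longrightarrow> \<delta> (a \<otimes> b) = cj b (\<delta> a) \<otimes> \<delta> b) \<Longrightarrow>
        (\<And>a. a \<in> carrier G \<Longrightarrow> \<delta> a [^] p = \<one>) \<Longrightarrow> (\<And>a. a \<in> carrier G \<Longrightarrow> \<delta> (\<delta> a) = \<one>) \<Longrightarrow>
        \<exists>x\<in>carrier G. \<forall>b\<in>carrier G. cj b x = \<delta> b \<otimes> x"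
begin

lemma U_carrier: "u \<in> U \<Longrightarrow> u \<in> carrier G" by (rule subgroup.mem_carrier[OF U_sub])
lemma M_U: "m \<in> M \<Longrightarrow> m \<in> U" using M_N N_U by blast
lemma R_U: "r \<in> R \<Longrightarrow> r \<in> U" using R_M M_U by blast
lemma N_carrier: "n \<in> N \<Longrightarrow> n \<in> carrier G" by (rule subgroup.mem_carrier[OF N_sub])
lemma M_carrier: "m \<in> M \<Longrightarrow> m \<in> carrier G" by (rule subgroup.mem_carrier[OF M_sub])

lemma carrier_sub: "subgroup (carrier G) G" by (rule subgroup_self)

lemma z_pow_central [simp]: "g \<in> carrier G \<Longrightarrow> cj g (z [^] (k::int)) = z [^] k"
  by (simp add: cj_int_pow z_central)

lemma z_comm: "g \<in> carrier G \<Longrightarrow> z [^] (k::int) \<otimes> g = g \<otimes> z [^] k"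
  using cj_fix_iff[of g "z [^] k"] by simp

lemma z_cong: "z [^] i = z [^] j \<longleftrightarrow> i \<doteq> j"
  using int_pow_cong[OF z_closed z_pow] int_pow_eq_cong[OF z_closed z_pow z_neq] by blast

lemma cj_eq_one_iff: "b \<in> carrier G \<Longrightarrow> x \<in> carrier G \<Longrightarrow> cj b x = x \<longleftrightarrow> cj x b = b"
  using cj_fix_iff by metis

text \<open>For \<open>d \<in> D\<close> the exponent \<open>ch d b\<close> is only meaningful modulo \<open>p\<close>.\<close>

definition D :: "'a set" where
  "D = {d \<in> carrier G. \<forall>b\<in>carrier G. \<exists>k::int. cj b d = d \<otimes> z [^] k}"

definition ch :: "'a \<Rightarrow> 'a \<Rightarrow> int" where
  "ch d b = (SOME k. cj b d = d \<otimes> z [^] k)"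

lemma D_carrier: "d \<in> D \<Longrightarrow> d \<in> carrier G" by (simp add: D_def)

lemma ch: assumes "d \<in> D" "b \<in> carrier G" shows "cj b d = d \<otimes> z [^] ch d b"
  unfolding ch_def by (rule someI_ex) (use assms in \<open>auto simp: D_def\<close>)

lemma ch_unique:
  assumes "d \<in> D" "b \<in> carrier G" "cj b d = d \<otimes> z [^] (k::int)" shows "ch d b \<doteq> k"
proof -
  have "d \<otimes> z [^] ch d b = d \<otimes> z [^] k" using ch[OF assms(1,2)] assms(3) by simp
  then have "z [^] ch d b = z [^] k" using D_carrier[OF assms(1)] by simp
  then show ?thesis by (simp add: z_cong)
qed

lemma ch_zero_iff: assumes "d \<in> D" "b \<in> carrier G" shows "cj b d = d \<longleftrightarrow> ch d b \<doteq> 0"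
proof -
  have "cj b d = d \<longleftrightarrow> z [^] ch d b = z [^] (0::int)" 
    using D_carrier[OF assms(1)] ch[OF assms] l_cancel_one[of d "z [^] ch d b"] by simp
  then show ?thesis by (simp only: z_cong)
qed

lemma DI: "d \<in> carrier G \<Longrightarrow> (\<And>b. b \<in> carrier G \<Longrightarrow> cj b d = d \<otimes> z [^] (f b::int)) \<Longrightarrow> d \<in> D"
  by (auto simp: D_def)

lemma ch_mult:
  assumes "d \<in> D" "e \<in> D" "b \<in> carrier G"
  shows "cj b (d \<otimes> e) = d \<otimes> e \<otimes> z [^] (ch d b + ch e b)"
proof -
  note c = D_carrier[OF assms(1)] D_carrier[OF assms(2)]
  have "cj b (d \<otimes> e) = d \<otimes> (z [^] ch d b \<otimes> e) \<otimes> z [^] ch e b"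
    using c assms(3) by (simp add: cj_mult ch assms m_assoc)
  also have "\<dots> = d \<otimes> e \<otimes> z [^] (ch d b + ch e b)"
    using c by (simp add: z_comm[OF c(2)] m_assoc int_pow_mult)
  finally show ?thesis .
qed

lemma ch_inv:
  assumes "d \<in> D" "b \<in> carrier G" shows "cj b (inv d) = inv d \<otimes> z [^] (- ch d b)"
proof -
  note c = D_carrier[OF assms(1)]
  have "cj b (inv d) = inv (d \<otimes> z [^] ch d b)" using c assms(2) by (simp add: cj_inv ch assms)
  also have "\<dots> = inv (z [^] ch d b \<otimes> d)" using z_comm[OF c] by simp
  also have "\<dots> = inv d \<otimes> z [^] (- ch d b)" using c by (simp add: inv_mult_group int_pow_neg)
  finally show ?thesis .
qed

lemma D_sub: "subgroup D G"
proof (rule subgroupI)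
  show "D \<subseteq> carrier G" by (auto simp: D_def)
  have "\<one> \<in> D" by (rule DI[of _ "\<lambda>_. 0"]) auto
  then show "D \<noteq> {}" by blast
  show "inv d \<in> D" if "d \<in> D" for d
    by (rule DI[of _ "\<lambda>b. - ch d b"]) (use that D_carrier ch_inv in auto)
  show "d \<otimes> e \<in> D" if "d \<in> D" "e \<in> D" for d e
    by (rule DI[of _ "\<lambda>b. ch d b + ch e b"]) (use that D_carrier ch_mult in auto)
qed

lemmas D_mult = subgroup.m_closed[OF D_sub]
lemmas D_pow = subgroup_int_pow[OF D_sub]

lemma ch_mult_cong: "d \<in> D \<Longrightarrow> e \<in> D \<Longrightarrow> b \<in> carrier G \<Longrightarrow> ch (d \<otimes> e) b \<doteq> ch d b + ch e b"
  by (rule ch_unique[OF D_mult _ ch_mult])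

lemma ch_pchar: assumes "d \<in> D" shows "pchar (carrier G) (ch d)"
  unfolding pchar_def
proof (intro ballI ch_unique[OF assms])
  note c = D_carrier[OF assms]
  fix a b assume ab: "a \<in> carrier G" "b \<in> carrier G"
  have "cj (a \<otimes> b) d = cj b (d \<otimes> z [^] ch d a)" using ab c ch[OF assms ab(1)] cj_cj[of a b d] by simp
  also have "\<dots> = d \<otimes> z [^] ch d b \<otimes> z [^] ch d a" using ab c by (simp add: cj_mult ch assms)
  finally have "cj (a \<otimes> b) d = d \<otimes> z [^] (ch d b + ch d a)"
    using c by (simp add: m_assoc int_pow_mult)
  then show "cj (a \<otimes> b) d = d \<otimes> z [^] (ch d a + ch d b)" by (simp only: add.commute)
qed simp

lemma ch_point: assumes "b \<in> carrier G" shows "pchar D (\<lambda>d. ch d b)"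
  using ch_mult_cong assms by (auto simp: pchar_def)

lemma central_D: "x \<in> carrier G \<Longrightarrow> (\<And>g. g \<in> carrier G \<Longrightarrow> cj g x = x) \<Longrightarrow> x \<in> D"
  by (rule DI[of _ "\<lambda>_. 0"]) auto

lemma z_D: "z [^] (k::int) \<in> D"
  by (rule central_D) auto

lemma ch_U: "d \<in> D \<Longrightarrow> u \<in> U \<Longrightarrow> ch d u \<doteq> 0"
  by (rule U_char[OF ch_pchar])

lemma D_U: "d \<in> D \<Longrightarrow> u \<in> U \<Longrightarrow> cj u d = d"
  using ch_U ch_zero_iff U_carrier by blast

text \<open>Every character \<open>ch d\<close> vanishes on \<open>U\<close>, so \<open>U\<close>
  and with it \<open>N\<close> centralize \<open>D\<close>; as \<open>N\<close> contains its own
  centralizer, \<open>D\<close> lies in Z(N) and is abelian.\<close>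

lemma D_N: "d \<in> D \<Longrightarrow> d \<in> N"
  by (rule N_self) (use D_carrier D_U N_U in auto)

lemma D_comm: "d \<in> D \<Longrightarrow> e \<in> D \<Longrightarrow> d \<otimes> e = e \<otimes> d"
  using D_U[of d e] D_N N_U D_carrier cj_fix_iff by blast

text \<open>A homomorphism to \<open>\<langle>z\<rangle>\<close> is a derivation, hence inner.\<close>

lemma D_realize:
  assumes "pchar (carrier G) f"
  obtains d where "d \<in> D" "\<And>b. b \<in> carrier G \<Longrightarrow> ch d b \<doteq> f b"
proof -
  \<comment> \<open>This is the vanishing of the derivation on its own values: they are powers of
    \<open>z\<close>, and \<open>z\<close> lies in \<open>U\<close>, where \<open>f\<close> is
    zero.\<close>
  have zf: "z [^] f (z [^] k) = \<one>" for k :: int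
  proof -
    have "z [^] k \<in> U" using subgroup_int_pow[OF R_sub z_R] R_U by blast
    then have "f (z [^] k) \<doteq> 0" by (rule U_char[OF assms])
    then have "z [^] f (z [^] k) = z [^] (0::int)" by (simp only: z_cong)
    then show ?thesis by simp
  qed
  have "\<exists>x\<in>carrier G. \<forall>b\<in>carrier G. cj b x = z [^] f b \<otimes> x"
  proof (rule derivation_inner)
    fix a b assume "a \<in> carrier G" "b \<in> carrier G"
    then have "z [^] f (a \<otimes> b) = z [^] (f a + f b)" using pcharD[OF assms] by (simp only: z_cong)
    then show "z [^] f (a \<otimes> b) = cj b (z [^] f a) \<otimes> z [^] f b"
      using \<open>b \<in> carrier G\<close> by (simp add: int_pow_mult)
  next
    fix a
    have "(z [^] f a) [^] p = (z [^] p) [^] f a" by (simp add: int_pow_pow mult.commute)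
    then show "(z [^] f a) [^] p = \<one>" by (simp add: z_pow)
  qed (simp_all add: zf)
  then obtain x where x: "x \<in> carrier G" "\<And>b. b \<in> carrier G \<Longrightarrow> cj b x = x \<otimes> z [^] f b"
    using z_comm by force
  have xD: "x \<in> D" by (rule DI[of _ f]) (use x in auto)
  show ?thesis by (rule that[OF xD ch_unique[OF xD _ x(2)]])
qed

text \<open>A character of G/U that is nonzero at \<open>c\<close> would be realized by an element
  of \<open>D\<close> that \<open>c\<close> moves.\<close>

lemma C_D: assumes c: "c \<in> carrier G" "\<And>d. d \<in> D \<Longrightarrow> cj c d = d" shows "c \<in> U"
proof (rule ccontr)
  assume "c \<notin> U"
  have pow: "y [^] p \<in> U" if "y \<in> carrier G" for y using R_pow R_U that by blast
  obtain f where f: "pchar (carrier G) f" "f c \<doteq> 1"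
    using separation[OF carrier_sub U_sub subgroup.subset[OF U_sub] U_comm pow c(1) \<open>c \<notin> U\<close>] by blast
  obtain d where d: "d \<in> D" "\<And>b. b \<in> carrier G \<Longrightarrow> ch d b \<doteq> f b"
    using D_realize[OF f(1)] by blast
  have "ch d c \<doteq> 0" using c d ch_zero_iff by blast
  with d(2)[OF c(1)] f(2) have "p dvd 1" by Groebner_Basis.algebra
  then show False using prime_p by auto
qed

lemma D_cj: "d \<in> D \<Longrightarrow> e \<in> D \<Longrightarrow> cj e d = d"
  using D_comm cj_fix_iff D_carrier by blast

text \<open>Duality of the pairing between \<open>D / Z(G)\<close> and \<open>G / U\<close>, by adjoining one element at a time.\<close>

lemma D_dc_step:
  assumes D0: "subgroup D0 G" "D0 \<subseteq> D"
    and Z: "\<And>x. x \<in> carrier G \<Longrightarrow> (\<And>g. g \<in> carrier G \<Longrightarrow> cj g x = x) \<Longrightarrow> x \<in> D0"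
    and dc: "\<And>d. d \<in> D \<Longrightarrow> (\<And>g. g \<in> carrier G \<Longrightarrow> (\<And>e. e \<in> D0 \<Longrightarrow> cj g e = e) \<Longrightarrow> cj g d = d) \<Longrightarrow> d \<in> D0"
    and e: "e \<in> D"
    and d: "d \<in> D" "\<And>g. g \<in> carrier G \<Longrightarrow> (\<And>e'. e' \<in> adj D0 e \<Longrightarrow> cj g e' = e') \<Longrightarrow> cj g d = d"
  shows "d \<in> adj D0 e"
proof -
  note eG = D_carrier[OF e] and dG = D_carrier[OF d(1)]
  have fixadj: "cj g e' = e'" if g: "g \<in> carrier G" and "\<And>x. x \<in> D0 \<Longrightarrow> cj g x = x" "cj g e = e" and "e' \<in> adj D0 e" for g e'
    using that eG D_carrier D0 by (auto simp: adj_def cj_mult cj_int_pow subset_iff)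
  show ?thesis
  proof (cases "\<exists>g\<in>carrier G. (\<forall>x\<in>D0. cj g x = x) \<and> cj g e \<noteq> e")
    case False
    have "d \<in> D0"
    proof (rule dc[OF d(1)])
      fix g assume g: "g \<in> carrier G" "\<And>x. x \<in> D0 \<Longrightarrow> cj g x = x"
      then have ge: "cj g e = e" using False by blast
      show "cj g d = d" by (rule d(2)[OF g(1) fixadj[OF g ge]])
    qed
    then show ?thesis using adjI[of d D0 e 0] dG by simp
  next
    case True
    then obtain g where g: "g \<in> carrier G" "\<And>x. x \<in> D0 \<Longrightarrow> cj g x = x" "cj g e \<noteq> e" by blast
    then have "\<not> p dvd ch e g" using ch_zero_iff[OF e g(1)] by simp
    then obtain j where j: "ch e g * j \<doteq> 1" by (rule prime_inverse)
    \<comment> \<open>The element \<open>g\<close> centralizes \<open>D0\<close> and moves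
      \<open>e\<close>. With this exponent \<open>g\<close> fixes \<open>d'\<close>, so only the
      elements centralizing \<open>D0\<close> and \<open>e\<close> can still matter for
      \<open>d'\<close>.\<close>
    define k where "k = - j * ch d g"
    define d' where "d' = d \<otimes> e [^] k"
    have d'D: "d' \<in> D" unfolding d'_def by (intro D_mult D_pow d e)
    have chd': "ch d' b \<doteq> ch d b + k * ch e b" if b: "b \<in> carrier G" for b
    proof -
      have "ch (e [^] k) b \<doteq> k * ch e b" by (rule pchar_int_pow[OF D_sub ch_point[OF b] e])
      with ch_mult_cong[OF d(1) D_pow[OF e, of k] b] show ?thesis unfolding d'_def by Groebner_Basis.algebra
    qed
    have "d' \<in> D0"
    proof (rule dc[OF d'D])
      fix h assume h: "h \<in> carrier G" "\<And>x. x \<in> D0 \<Longrightarrow> cj h x = x"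
      \<comment> \<open>Correcting \<open>h\<close> by a power of \<open>g\<close> makes it fix
        \<open>e\<close> as well, hence \<open>d\<close>. The two corrections match:
        \<open>ch d' h\<close> agrees with \<open>ch d h'\<close> modulo \<open>p\<close>.\<close>
      define l where "l = - j * ch e h"
      define h' where "h' = h \<otimes> g [^] l"
      have gl: "g [^] l \<in> carrier G" using g by simp
      have h'G: "h' \<in> carrier G" using h g by (simp add: h'_def)
      have cl: "ch x h' \<doteq> ch x h + l * ch x g" if x: "x \<in> D" for x
        using pcharD[OF ch_pchar[OF x] h(1) gl] pchar_int_pow[OF carrier_sub ch_pchar[OF x] g(1), of l]
        unfolding h'_def by Groebner_Basis.algebra
      have "ch e h' \<doteq> 0" using cl[OF e] j unfolding l_def by Groebner_Basis.algebra
      then have 1: "cj h' e = e" using ch_zero_iff[OF e h'G] by simp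
      have 2: "cj h' x = x" if "x \<in> D0" for x
      proof -
        have xD: "x \<in> D" using that D0 by blast
        have "ch x h \<doteq> 0" "ch x g \<doteq> 0" using g h that ch_zero_iff[OF xD] by blast+
        then have "ch x h' \<doteq> 0" using cl[OF xD] by Groebner_Basis.algebra
        then show ?thesis using ch_zero_iff[OF xD h'G] by simp
      qed
      have "cj h' d = d" by (rule d(2)[OF h'G fixadj[OF h'G 2 1]])
      then have "ch d h' \<doteq> 0" using ch_zero_iff[OF d(1) h'G] by simp
      then have "ch d' h \<doteq> 0" using cl[OF d(1)] chd'[OF h(1)] unfolding k_def l_def by Groebner_Basis.algebra
      then show "cj h d' = d'" using ch_zero_iff[OF d'D h(1)] by simp
    qed
    moreover have "d = e [^] (-k) \<otimes> d'"
      unfolding d'_def using D_comm[OF d(1) D_pow[OF e]] dG eG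
      by (simp add: int_pow_neg)
    ultimately show ?thesis using adjI by metis
  qed
qed

text \<open>The induction starts at Z(G): its centralizer is all of \<open>G\<close>, so the
  property holds there trivially.\<close>

lemma D_double_centralizer:
  assumes D0: "subgroup D0 G" "D0 \<subseteq> D"
    and Z: "\<And>x. x \<in> carrier G \<Longrightarrow> (\<And>g. g \<in> carrier G \<Longrightarrow> cj g x = x) \<Longrightarrow> x \<in> D0"
    and d: "d \<in> D" "\<And>g. g \<in> carrier G \<Longrightarrow> (\<And>e. e \<in> D0 \<Longrightarrow> cj g e = e) \<Longrightarrow> cj g d = d"
  shows "d \<in> D0"
proof -
  let ?Z = "{x \<in> carrier G. \<forall>g\<in>carrier G. cj g x = x}"
  let ?P = "\<lambda>L. subgroup L G \<and> L \<subseteq> D0 \<and> ?Z \<subseteq> L \<and>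
    (\<forall>d\<in>D. (\<forall>g\<in>carrier G. (\<forall>e\<in>L. cj g e = e) \<longrightarrow> cj g d = d) \<longrightarrow> d \<in> L)"
  have "subgroup ?Z G"
    by (rule subgroupI) (auto simp: cj_inv cj_mult intro!: exI[of _ \<one>])
  moreover have "?Z \<subseteq> D0" using Z by blast
  ultimately have PZ: "?P ?Z" using D_carrier by auto
  have Pc: "\<And>Y. ?P Y \<Longrightarrow> Y \<subseteq> carrier G" using subgroup.subset by blast
  obtain L where PL: "?P L" and "?Z \<subseteq> L" and max: "\<And>W. ?P W \<Longrightarrow> L \<subseteq> W \<Longrightarrow> W = L"
    using maximal_set[of ?P ?Z, OF PZ Pc] by blast
  have Ls: "subgroup L G" and LD0: "L \<subseteq> D0" and ZL: "?Z \<subseteq> L" using PL by auto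
  have LD: "L \<subseteq> D" using LD0 D0 by blast
  have "D0 \<subseteq> L"
  proof
    fix e assume e: "e \<in> D0"
    then have eD: "e \<in> D" using D0 by blast
    have n: "cj (e [^] k) x \<in> L" if "x \<in> L" for x and k :: int
      using D_cj[OF _ D_pow[OF eD]] that LD by auto
    note a = adj_subgroup[OF Ls D_carrier[OF eD] n]
    have "?P (adj L e)"
    proof (intro conjI ballI impI)
      show "adj L e \<subseteq> D0" by (rule adj_least[OF D0(1) LD0 e])
      show "?Z \<subseteq> adj L e" using ZL a(2) by blast
      fix d' assume d': "d' \<in> D" "\<forall>g\<in>carrier G. (\<forall>e'\<in>adj L e. cj g e' = e') \<longrightarrow> cj g d' = d'"
      show "d' \<in> adj L e"
      proof (rule D_dc_step[OF Ls LD _ _ eD d'(1)])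
        show "x \<in> L" if "x \<in> carrier G" "\<And>g. g \<in> carrier G \<Longrightarrow> cj g x = x" for x
          using ZL that by blast
        show "d'' \<in> L" if "d'' \<in> D" "\<And>g. g \<in> carrier G \<Longrightarrow> (\<And>e. e \<in> L \<Longrightarrow> cj g e = e) \<Longrightarrow> cj g d'' = d''" for d''
          using PL that by blast
        show "cj g d' = d'" if "g \<in> carrier G" "\<And>e'. e' \<in> adj L e \<Longrightarrow> cj g e' = e'" for g
          using d'(2) that by blast
      qed
    qed (rule a(1))
    then have "adj L e = L" using max a(2) by blast
    then show "e \<in> L" using a(3) by simp
  qed
  with LD0 have eq: "L = D0" by blast
  have "\<forall>d\<in>D. (\<forall>g\<in>carrier G. (\<forall>e\<in>D0. cj g e = e) \<longrightarrow> cj g d = d) \<longrightarrow> d \<in> D0"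
    using PL unfolding eq by (elim conjE)
  from mp[OF bspec[OF this d(1)]] d(2) show ?thesis by simp
qed


section \<open>Quadratic extensions of characters\<close>

text \<open>Characters of U/R. Since U/R is central in G/R, each of them turns the commutator into
  an alternating bilinear form \<eta>([a,b]) modulo \<open>p\<close> on G/U; the \<open>om\<close>
  lemmas below express this.\<close>

definition rchar :: "('a \<Rightarrow> int) \<Rightarrow> bool" where
  "rchar \<eta> \<longleftrightarrow> pchar U \<eta> \<and> (\<forall>r\<in>R. \<eta> r \<doteq> 0)"

lemma U_cj: "u \<in> U \<Longrightarrow> g \<in> carrier G \<Longrightarrow> cj g u \<in> U"
  using cj_in[OF U_sub] U_central R_U by blast

lemma rchar_cj: assumes "rchar \<eta>" "u \<in> U" "g \<in> carrier G" shows "\<eta> (cj g u) \<doteq> \<eta> u"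
proof -
  have r: "commutator G u g \<in> R" by (rule U_central[OF assms(2,3)])
  have "\<eta> (cj g u) \<doteq> \<eta> u + \<eta> (commutator G u g)"
    unfolding cj_eq_commutator[OF assms(3) U_carrier[OF assms(2)]]
    by (rule pcharD[OF _ assms(2) R_U[OF r]]) (use assms in \<open>simp add: rchar_def\<close>)
  moreover have "\<eta> (commutator G u g) \<doteq> 0" using assms(1) r by (simp only: rchar_def)
  ultimately show ?thesis by Groebner_Basis.algebra
qed

lemma om_left: assumes "rchar \<eta>" "g \<in> carrier G" shows "pchar (carrier G) (\<lambda>a. \<eta> (commutator G a g))"
  unfolding pchar_def
proof (intro ballI)
  fix a b assume ab: "a \<in> carrier G" "b \<in> carrier G"
  note c = U_comm[OF ab(1) assms(2)] U_comm[OF ab(2) assms(2)]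
  have "\<eta> (commutator G (a \<otimes> b) g) \<doteq> \<eta> (cj b (commutator G a g)) + \<eta> (commutator G b g)"
    unfolding commutator_mult_left[OF ab assms(2)]
    by (rule pcharD[OF _ U_cj[OF c(1) ab(2)] c(2)]) (use assms in \<open>simp add: rchar_def\<close>)
  with rchar_cj[OF assms(1) c(1) ab(2)]
  show "\<eta> (commutator G (a \<otimes> b) g) \<doteq> \<eta> (commutator G a g) + \<eta> (commutator G b g)"
    by Groebner_Basis.algebra
qed

lemma om_right: assumes "rchar \<eta>" "g \<in> carrier G" shows "pchar (carrier G) (\<lambda>a. \<eta> (commutator G g a))"
  unfolding pchar_def
proof (intro ballI)
  fix a b assume ab: "a \<in> carrier G" "b \<in> carrier G"
  note c = U_comm[OF assms(2) ab(1)] U_comm[OF assms(2) ab(2)]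
  have "\<eta> (commutator G g (a \<otimes> b)) \<doteq> \<eta> (commutator G g b) + \<eta> (cj b (commutator G g a))"
    unfolding commutator_mult_right[OF ab assms(2)]
    by (rule pcharD[OF _ c(2) U_cj[OF c(1) ab(2)]]) (use assms in \<open>simp add: rchar_def\<close>)
  with rchar_cj[OF assms(1) c(1) ab(2)]
  show "\<eta> (commutator G g (a \<otimes> b)) \<doteq> \<eta> (commutator G g a) + \<eta> (commutator G g b)"
    by Groebner_Basis.algebra
qed

lemma om_U: assumes "rchar \<eta>" "g \<in> carrier G" "u \<in> U"
  shows "\<eta> (commutator G u g) \<doteq> 0" "\<eta> (commutator G g u) \<doteq> 0"
  using U_char[OF om_left[OF assms(1,2)] assms(3)] U_char[OF om_right[OF assms(1,2)] assms(3)] .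

text \<open>A quadratic extension of \<open>\<eta>\<close> to a subgroup \<open>L\<close>, with polar form \<open>\<beta>\<close>.\<close>

definition quad :: "('a \<Rightarrow> int) \<Rightarrow> 'a set \<Rightarrow> 'a set \<Rightarrow> ('a \<Rightarrow> int) \<Rightarrow> ('a \<Rightarrow> 'a \<Rightarrow> int) \<Rightarrow> bool" where
  "quad \<eta> J L \<kappa> \<beta> \<longleftrightarrow> (\<forall>u\<in>U. \<kappa> u \<doteq> \<eta> u)
    \<and> (\<forall>a\<in>L. \<forall>b\<in>L. \<kappa> (a \<otimes> b) \<doteq> \<kappa> a + \<kappa> b + \<beta> a b)
    \<and> (\<forall>a\<in>L. pchar L (\<beta> a)) \<and> (\<forall>b\<in>L. pchar L (\<lambda>a. \<beta> a b))
    \<and> (\<forall>a\<in>L. \<forall>j\<in>J. \<beta> a j \<doteq> 0) \<and> (\<forall>u\<in>U. \<forall>b\<in>L. \<beta> u b \<doteq> 0)"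

text \<open>The extension is \<open>\<kappa>' (t^k x) = \<kappa> x\<close> and \<open>\<beta>' (t^k x) (t^l x') = \<beta> x x' + l \<eta> [x, t]\<close>.\<close>

lemma quad_step:
  assumes \<eta>: "rchar \<eta>" and J: "U \<subseteq> J" "J \<subseteq> L" and L: "subgroup L G" and q: "quad \<eta> J L \<kappa> \<beta>"
    and t: "t \<in> carrier G" "t \<notin> L"
  obtains \<kappa>' \<beta>' where "quad \<eta> J (adj L t) \<kappa>' \<beta>'"
proof -
  have UL: "U \<subseteq> L" using J by blast
  note LG = subgroup.mem_carrier[OF L]
  have q1: "\<kappa> u \<doteq> \<eta> u" if "u \<in> U" for u using q that unfolding quad_def by blast
  have q2: "\<kappa> (a \<otimes> b) \<doteq> \<kappa> a + \<kappa> b + \<beta> a b" if "a \<in> L" "b \<in> L" for a b using q that unfolding quad_def by blast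
  have q3: "pchar L (\<beta> a)" if "a \<in> L" for a using q that unfolding quad_def by blast
  have q4: "pchar L (\<lambda>a. \<beta> a b)" if "b \<in> L" for b using q that unfolding quad_def by blast
  have q5: "\<beta> a j \<doteq> 0" if "a \<in> L" "j \<in> J" for a j using q that unfolding quad_def by blast
  have q6: "\<beta> u b \<doteq> 0" if "u \<in> U" "b \<in> L" for u b using q that unfolding quad_def by blast
  have norm: "cj (t [^] (k::int)) x \<in> L" if "x \<in> L" for x k
    by (rule cj_in[OF L that]) (use that UL U_comm LG t in auto)
  have tp: "t [^] p \<in> L" using R_pow[OF t(1)] R_U UL by blast
  \<comment> \<open>Coordinates g = t^(k g) \<xi>(g) on \<open>adj L t\<close>. The exponent is an
    arbitrary choice, determined only modulo \<open>p\<close>, so all identities for \<xi> hold up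
    to factors that are \<open>p\<close>-th powers and lie in \<open>R\<close>, where \<eta>
    vanishes.\<close>
  define k where "k g = (SOME k::int. inv (t [^] k) \<otimes> g \<in> L)" for g
  define \<xi> where "\<xi> g = inv (t [^] k g) \<otimes> g" for g
  have A: "g \<in> carrier G" if "g \<in> adj L t" for g using that LG t by (auto simp: adj_def)
  have \<xi>L: "\<xi> g \<in> L" if g: "g \<in> adj L t" for g
  proof -
    obtain i x where ix: "g = t [^] (i::int) \<otimes> x" "x \<in> L" using g by (auto simp: adj_def)
    then have "inv (t [^] i) \<otimes> g \<in> L" using t LG by simp
    then show ?thesis unfolding \<xi>_def k_def by (rule someI)
  qed
  have kadd: "k (g \<otimes> h) \<doteq> k g + k h" if gh: "g \<in> adj L t" "h \<in> adj L t" for g h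
  proof -
    have gha: "g \<otimes> h \<in> adj L t" by (rule subgroup.m_closed[OF adj_subgroup(1)[OF L t(1) norm] gh])
    have 1: "inv (t [^] k (g \<otimes> h)) \<otimes> (g \<otimes> h) \<in> L" using \<xi>L[OF gha] by (simp only: \<xi>_def)
    have 2: "inv (t [^] k g) \<otimes> g \<in> L" "inv (t [^] k h) \<otimes> h \<in> L"
      using \<xi>L[OF gh(1)] \<xi>L[OF gh(2)] by (simp_all only: \<xi>_def)
    show ?thesis
      by (rule adj_unique[OF L t tp 1 adj_add[OF L t(1) norm 2 A[OF gh(1)] A[OF gh(2)]] A[OF gha]])
  qed
  \<comment> \<open>On \<open>L\<close> itself the chosen exponent need not be 0, only divisible by
    \<open>p\<close>.\<close>
  have kL: "\<exists>r\<in>R. \<xi> x = r \<otimes> x \<and> k x \<doteq> 0" if x: "x \<in> L" for x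
  proof -
    have xa: "x \<in> adj L t" using adj_subgroup(2)[OF L t(1) norm] x by blast
    have 1: "inv (t [^] (0::int)) \<otimes> x \<in> L" using x LG[OF x] by simp
    have 2: "inv (t [^] k x) \<otimes> x \<in> L" using \<xi>L[OF xa] by (simp only: \<xi>_def)
    have k0: "k x \<doteq> 0" by (rule adj_unique[OF L t tp 2 1 LG[OF x]])
    then obtain m where m: "k x = p * m" by auto
    have "inv (t [^] k x) = (t [^] (-m)) [^] p"
      unfolding m using t by (simp add: int_pow_pow int_pow_neg[symmetric] mult.commute)
    then show ?thesis using R_pow[of "t [^] (-m)"] t k0 unfolding \<xi>_def by auto
  qed
  \<comment> \<open>Moving a power of \<open>t\<close> past \<xi>(g) creates a commutator; it is the
    source of the extra term in the new polar form.\<close>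
  have dec: "\<exists>r\<in>R. \<xi> (g \<otimes> h) = r \<otimes> (\<xi> g \<otimes> (commutator G (\<xi> g) (t [^] k h) \<otimes> \<xi> h))"
    if gh: "g \<in> adj L t" "h \<in> adj L t" for g h
  proof -
    note gG = A[OF gh(1)] A[OF gh(2)]
    obtain m where m: "k (g \<otimes> h) - (k g + k h) = p * m" using kadd[OF gh] by auto
    then have k: "k (g \<otimes> h) = (k g + k h) + p * m" by simp
    have "inv (t [^] k (g \<otimes> h)) = inv (t [^] (p * m)) \<otimes> inv (t [^] (k g + k h))"
      unfolding k using t int_pow_mult[of t "k g + k h" "p * m"] by (simp add: inv_mult_group)
    moreover have "inv (t [^] (p * m)) = (t [^] (-m)) [^] p"
      using t by (simp add: int_pow_pow int_pow_neg[symmetric] mult.commute)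
    ultimately have "\<xi> (g \<otimes> h) = (t [^] (-m)) [^] p \<otimes> (inv (t [^] (k g + k h)) \<otimes> (g \<otimes> h))"
      unfolding \<xi>_def using t gG by (simp add: m_assoc)
    also have "inv (t [^] (k g + k h)) \<otimes> (g \<otimes> h) = cj (t [^] k h) (\<xi> g) \<otimes> \<xi> h"
      unfolding \<xi>_def using t gG by (simp add: cj_def m_assoc int_pow_mult inv_mult_group)
    also have "\<dots> = \<xi> g \<otimes> (commutator G (\<xi> g) (t [^] k h) \<otimes> \<xi> h)"
      using cj_eq_commutator t LG \<xi>L gh by (simp add: m_assoc)
    finally show ?thesis using R_pow[of "t [^] (-m)"] t by auto
  qed
  have lin: "f (\<xi> (g \<otimes> h)) \<doteq> f (\<xi> g) + f (\<xi> h)"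
    if f: "pchar L f" "\<And>u. u \<in> U \<Longrightarrow> f u \<doteq> 0" and gh: "g \<in> adj L t" "h \<in> adj L t" for f g h
  proof -
    let ?c = "commutator G (\<xi> g) (t [^] k h)"
    note x = \<xi>L[OF gh(1)] \<xi>L[OF gh(2)]
    obtain r where r: "r \<in> R" "\<xi> (g \<otimes> h) = r \<otimes> (\<xi> g \<otimes> (?c \<otimes> \<xi> h))" using dec[OF gh] by blast
    have cU: "?c \<in> U" using x LG t by (intro U_comm) auto
    have c: "?c \<in> L" "r \<in> L" using cU UL r R_U by auto
    note m = subgroup.m_closed[OF L]
    note m1 = m[OF c(1) x(2)] m[OF x(1) m[OF c(1) x(2)]]
    show ?thesis unfolding r(2)
      using pcharD[OF f(1) c(2) m1(2)] pcharD[OF f(1) x(1) m1(1)] pcharD[OF f(1) c(1) x(2)]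
        f(2)[OF cU] f(2)[OF R_U[OF r(1)]] by Groebner_Basis.algebra
  qed
  define \<beta>' where "\<beta>' g h = \<beta> (\<xi> g) (\<xi> h) + k h * \<eta> (commutator G (\<xi> g) t)" for g h
  have omt: "pchar L (\<lambda>x. \<eta> (commutator G x t))" 
    by (rule pchar_mono[OF om_left[OF \<eta> t(1)]]) (use LG in blast)
  have "quad \<eta> J (adj L t) (\<lambda>g. \<kappa> (\<xi> g)) \<beta>'" unfolding quad_def
  proof (intro conjI ballI)
    fix u assume u: "u \<in> U"
    obtain r where r: "r \<in> R" "\<xi> u = r \<otimes> u" using kL u UL by blast
    have ru: "r \<otimes> u \<in> U" by (rule subgroup.m_closed[OF U_sub R_U[OF r(1)] u])
    have "\<eta> (r \<otimes> u) \<doteq> \<eta> r + \<eta> u"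
      by (rule pcharD[OF _ R_U[OF r(1)] u]) (use \<eta> in \<open>simp add: rchar_def\<close>)
    moreover have "\<eta> r \<doteq> 0" using \<eta> r(1) by (simp only: rchar_def)
    ultimately show "\<kappa> (\<xi> u) \<doteq> \<eta> u" using q1[OF ru] unfolding r(2) by Groebner_Basis.algebra
  next
    fix g h assume gh: "g \<in> adj L t" "h \<in> adj L t"
    let ?c = "commutator G (\<xi> g) (t [^] k h)"
    note x = \<xi>L[OF gh(1)] \<xi>L[OF gh(2)]
    obtain r where r: "r \<in> R" "\<xi> (g \<otimes> h) = r \<otimes> (\<xi> g \<otimes> (?c \<otimes> \<xi> h))" using dec[OF gh] by blast
    have cU: "?c \<in> U" using x LG t by (intro U_comm) auto
    have c: "?c \<in> L" "r \<in> L" using cU UL r R_U by auto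
    note m = subgroup.m_closed[OF L]
    note m1 = m[OF c(1) x(2)] m[OF x(1) m[OF c(1) x(2)]]
    have cJ: "?c \<in> J" using cU J by blast
    have "\<eta> r \<doteq> 0" using \<eta> r(1) by (simp only: rchar_def)
    moreover have "\<eta> ?c \<doteq> k h * \<eta> (commutator G (\<xi> g) t)"
      by (rule pchar_int_pow[OF carrier_sub om_right[OF \<eta> LG[OF x(1)]] t(1)])
    ultimately show "\<kappa> (\<xi> (g \<otimes> h)) \<doteq> \<kappa> (\<xi> g) + \<kappa> (\<xi> h) + \<beta>' g h" unfolding r(2) \<beta>'_def
      using q2[OF c(2) m1(2)] q6[OF R_U[OF r(1)] m1(2)] q1[OF R_U[OF r(1)]]
        q2[OF x(1) m1(1)] pcharD[OF q3[OF x(1)] c(1) x(2)] q5[OF x(1) cJ] 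
        q2[OF c(1) x(2)] q6[OF cU x(2)] q1[OF cU]
      by Groebner_Basis.algebra
  next
    fix a assume a: "a \<in> adj L t"
    show "pchar (adj L t) (\<beta>' a)" unfolding pchar_def
    proof (intro ballI)
      fix g h assume gh: "g \<in> adj L t" "h \<in> adj L t"
      have "\<beta> (\<xi> a) (\<xi> (g \<otimes> h)) \<doteq> \<beta> (\<xi> a) (\<xi> g) + \<beta> (\<xi> a) (\<xi> h)"
        by (rule lin[OF q3[OF \<xi>L[OF a]] _ gh]) (use q5[OF \<xi>L[OF a]] J in blast)
      with kadd[OF gh] show "\<beta>' a (g \<otimes> h) \<doteq> \<beta>' a g + \<beta>' a h" unfolding \<beta>'_def by Groebner_Basis.algebra
    qed
  next
    fix b assume b: "b \<in> adj L t"
    show "pchar (adj L t) (\<lambda>a. \<beta>' a b)" unfolding pchar_def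
    proof (intro ballI)
      fix g h assume gh: "g \<in> adj L t" "h \<in> adj L t"
      have "\<beta> (\<xi> (g \<otimes> h)) (\<xi> b) \<doteq> \<beta> (\<xi> g) (\<xi> b) + \<beta> (\<xi> h) (\<xi> b)"
        by (rule lin[OF q4[OF \<xi>L[OF b]] _ gh]) (rule q6[OF _ \<xi>L[OF b]])
      moreover have "\<eta> (commutator G (\<xi> (g \<otimes> h)) t) \<doteq> \<eta> (commutator G (\<xi> g) t) + \<eta> (commutator G (\<xi> h) t)"
        by (rule lin[OF omt _ gh]) (rule om_U(1)[OF \<eta> t(1)])
      ultimately show "\<beta>' (g \<otimes> h) b \<doteq> \<beta>' g b + \<beta>' h b" unfolding \<beta>'_def by Groebner_Basis.algebra
    qed
  next
    fix a j assume a: "a \<in> adj L t" and j: "j \<in> J"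
    obtain r where r: "r \<in> R" "\<xi> j = r \<otimes> j" "k j \<doteq> 0" using kL j J by blast
    have rj: "r \<in> L" "j \<in> L" "r \<in> J" using r R_U UL j J by auto
    show "\<beta>' a j \<doteq> 0" unfolding \<beta>'_def r(2)
      using pcharD[OF q3[OF \<xi>L[OF a]] rj(1,2)] q5[OF \<xi>L[OF a] j] q5[OF \<xi>L[OF a] rj(3)] r(3)
      by Groebner_Basis.algebra
  next
    fix u b assume u: "u \<in> U" and b: "b \<in> adj L t"
    obtain r where r: "r \<in> R" "\<xi> u = r \<otimes> u" using kL u UL by blast
    have ru: "r \<otimes> u \<in> U" by (rule subgroup.m_closed[OF U_sub R_U[OF r(1)] u])
    show "\<beta>' u b \<doteq> 0" unfolding \<beta>'_def r(2)
      using q6[OF ru \<xi>L[OF b]] om_U(1)[OF \<eta> t(1) ru] by Groebner_Basis.algebra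
  qed
  then show ?thesis by (rule that)
qed

text \<open>The form vanishes on \<open>J\<close>, so \<eta> first extends to \<open>J\<close> as a
  character, with zero polar form. The remaining elements of \<open>G\<close> are then adjoined one
  by one. That \<beta>(a,j) stays zero for j in \<open>J\<close> makes each \<beta>(a,-) a character
  of G/J.\<close>

lemma quad_exists:
  assumes \<eta>: "rchar \<eta>" and J: "subgroup J G" "U \<subseteq> J"
    and JJ: "\<And>a b. a \<in> J \<Longrightarrow> b \<in> J \<Longrightarrow> \<eta> (commutator G a b) \<doteq> 0"
  obtains \<kappa> \<beta> where "quad \<eta> J (carrier G) \<kappa> \<beta>"
proof -
  note JG = subgroup.mem_carrier[OF J(1)]
  have "pchar U \<eta>" using \<eta> by (simp add: rchar_def)
  then obtain \<kappa>0 where \<kappa>0: "pchar J \<kappa>0" "\<And>u. u \<in> U \<Longrightarrow> \<kappa>0 u \<doteq> \<eta> u"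
  proof (rule pchar_extend[OF J(1) U_sub J(2)])
    show "commutator G a b \<in> U \<and> \<eta> (commutator G a b) \<doteq> 0" if "a \<in> J" "b \<in> J" for a b
      using JJ[OF that] U_comm JG that by blast
    show "y [^] p \<in> U \<and> \<eta> (y [^] p) \<doteq> 0" if "y \<in> J" for y
      using R_pow[OF JG[OF that]] R_U \<eta> by (simp add: rchar_def)
  qed blast
  let ?P = "\<lambda>L. subgroup L G \<and> J \<subseteq> L \<and> (\<exists>\<kappa> \<beta>. quad \<eta> J L \<kappa> \<beta>)"
  have "quad \<eta> J J \<kappa>0 (\<lambda>_ _. 0)"
    using \<kappa>0 by (auto simp: quad_def pchar_def)
  then have P: "?P J" using J by blast
  have Pc: "\<And>Y. ?P Y \<Longrightarrow> Y \<subseteq> carrier G" using subgroup.subset by blast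
  show ?thesis
  proof (rule maximal_set[of ?P J, OF P Pc])
    fix L assume PL: "?P L" and "J \<subseteq> L" and max: "\<And>W. ?P W \<Longrightarrow> L \<subseteq> W \<Longrightarrow> W = L"
    from PL obtain \<kappa> \<beta> where L: "subgroup L G" "J \<subseteq> L" "quad \<eta> J L \<kappa> \<beta>" by blast
    have "carrier G \<subseteq> L"
    proof
      fix t assume t: "t \<in> carrier G"
      show "t \<in> L"
      proof (rule ccontr)
        assume tL: "t \<notin> L"
        have UL: "U \<subseteq> L" using J(2) L(2) by blast
        obtain \<kappa>' \<beta>' where q: "quad \<eta> J (adj L t) \<kappa>' \<beta>'" by (rule quad_step[OF \<eta> J(2) L(2,1,3) t tL])
        have norm: "cj (t [^] (k::int)) x \<in> L" if "x \<in> L" for x k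
          by (rule cj_in[OF L(1) that]) (use that UL U_comm subgroup.mem_carrier[OF L(1)] t in auto)
        note a = adj_subgroup[OF L(1) t norm]
        have "J \<subseteq> adj L t" using a(2) L(2) by blast
        then have "adj L t = L" using q a(1) by (intro max[OF _ a(2)]) blast
        then show False using a(3) tL by blast
      qed
    qed
    then have "L = carrier G" using subgroup.subset[OF L(1)] by blast
    then show thesis using L(3) by (intro that) simp
  qed
qed

section \<open>Derivations with values in the elements of order \<open>p\<close> of
  \<open>D\<close>\<close>

definition E :: "'a set" where "E = {d \<in> D. d [^] p = \<one>}"

lemma E_D: "e \<in> E \<Longrightarrow> e \<in> D" by (simp add: E_def)
lemma E_pow: "e \<in> E \<Longrightarrow> e [^] p = \<one>" by (simp add: E_def)
lemma E_carrier: "e \<in> E \<Longrightarrow> e \<in> carrier G" by (simp add: E_D D_carrier)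

lemma E_sub: "subgroup E G"
proof (rule subgroupI)
  show "E \<subseteq> carrier G" using E_carrier by blast
  show "E \<noteq> {}" using subgroup.one_closed[OF D_sub] by (auto simp: E_def)
  show "inv e \<in> E" if "e \<in> E" for e
    using that subgroup.m_inv_closed[OF D_sub] D_carrier by (auto simp: E_def int_pow_inv)
  show "d \<otimes> e \<in> E" if "d \<in> E" "e \<in> E" for d e
    using that D_mult D_comm D_carrier by (auto simp: E_def int_pow_mult_distrib)
qed

lemma z_E: "z [^] (k::int) \<in> E"
proof -
  have "(z [^] k) [^] p = (z [^] p) [^] k" by (simp add: int_pow_pow mult.commute)
  then show ?thesis using z_D by (simp add: E_def z_pow)
qed

lemma z_E': "z \<in> E" using z_E[of 1] by simp

text \<open>The quotient of the two elements is central with \<open>p\<close>-th power 1, hence a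
  power of \<open>z\<close>, and \<epsilon> detects its exponent. So \<epsilon> rigidifies elements
  that their commutators determine only up to <z>; this is what makes the choices below
  multiplicative.\<close>

lemma E_eq:
  assumes V: "subgroup V G" "pchar V \<epsilon>" "\<epsilon> z \<doteq> 1" "z \<in> V"
    and e: "e \<in> V" "e' \<in> V" "e \<otimes> e' = e' \<otimes> e" "e [^] p = \<one>" "e' [^] p = \<one>"
    and c: "\<And>b. b \<in> carrier G \<Longrightarrow> \<exists>y\<in>carrier G. cj b e = e \<otimes> y \<and> cj b e' = e' \<otimes> y"
    and eps: "\<epsilon> e \<doteq> \<epsilon> e'"
  shows "e = e'"
proof -
  note G = subgroup.mem_carrier[OF V(1) e(1)] subgroup.mem_carrier[OF V(1) e(2)]
  let ?x = "e' \<otimes> inv e"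
  have iV: "inv e \<in> V" by (rule subgroup.m_inv_closed[OF V(1) e(1)])
  have com: "e' \<otimes> inv e = inv e \<otimes> e'" using e(3) G by (metis inv_closed inv_solve_left inv_solve_right m_assoc m_closed)
  have "?x [^] p = \<one>" using int_pow_mult_distrib[OF com, of p] G e by (simp add: int_pow_inv)
  moreover have "cj b ?x = ?x" if b: "b \<in> carrier G" for b
  proof -
    obtain y where y: "y \<in> carrier G" "cj b e = e \<otimes> y" "cj b e' = e' \<otimes> y" using c[OF b] by blast
    then show ?thesis using b G by (simp add: cj_mult cj_inv inv_mult_group m_assoc)
  qed
  ultimately obtain k where k: "?x = z [^] (k::int)" using z_gen[of ?x] G by auto
  have "\<epsilon> ?x \<doteq> \<epsilon> e' + \<epsilon> (inv e)" by (rule pcharD[OF V(2) e(2) iV])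
  moreover have "\<epsilon> (inv e) \<doteq> - \<epsilon> e" by (rule pchar_inv[OF V(1,2) e(1)])
  moreover have "\<epsilon> ?x \<doteq> k * \<epsilon> z" unfolding k by (rule pchar_int_pow[OF V(1,2,4)])
  ultimately have "k \<doteq> 0" using eps V(3) by Groebner_Basis.algebra
  then have "z [^] k = z [^] (0::int)" by (simp only: z_cong)
  then have "e' \<otimes> inv e = \<one>" using k by simp
  then show ?thesis using G by (metis inv_closed inv_equality inv_inv)
qed

text \<open>Let \<phi>(g) be the element of \<open>E0\<close> with character \<beta>(g,-),
  normalized by \<epsilon> = 0. Linearity of \<beta> in the first argument makes \<phi> a
  homomorphism, and the derivation law for \<phi>(g) z^(\<kappa> g) is then the polar identity of
  \<kappa>.\<close>

lemma quad_derivation: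
  assumes \<eta>: "rchar \<eta>" and J: "subgroup J G" "U \<subseteq> J"
    and JJ: "\<And>a b. a \<in> J \<Longrightarrow> b \<in> J \<Longrightarrow> \<eta> (commutator G a b) \<doteq> 0"
    and E0: "subgroup E0 G" "E0 \<subseteq> E" "z \<in> E0"
    and real: "\<And>f. pchar (carrier G) f \<Longrightarrow> (\<And>j. j \<in> J \<Longrightarrow> f j \<doteq> 0) \<Longrightarrow>
      \<exists>e\<in>E0. \<forall>b\<in>carrier G. ch e b \<doteq> f b"
  obtains \<delta> where "\<And>a. a \<in> carrier G \<Longrightarrow> \<delta> a \<in> E0"
    "\<And>a b. a \<in> carrier G \<Longrightarrow> b \<in> carrier G \<Longrightarrow> \<delta> (a \<otimes> b) = cj b (\<delta> a) \<otimes> \<delta> b"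
    "\<And>u. u \<in> U \<Longrightarrow> \<delta> u = z [^] \<eta> u"
proof -
  obtain \<kappa> \<beta> where q: "quad \<eta> J (carrier G) \<kappa> \<beta>" by (rule quad_exists[OF \<eta> J JJ])
  have q1: "\<kappa> u \<doteq> \<eta> u" if "u \<in> U" for u using q that unfolding quad_def by blast
  have q2: "\<kappa> (a \<otimes> b) \<doteq> \<kappa> a + \<kappa> b + \<beta> a b" if "a \<in> carrier G" "b \<in> carrier G" for a b using q that unfolding quad_def by blast
  have q3: "pchar (carrier G) (\<beta> a)" if "a \<in> carrier G" for a using q that unfolding quad_def by blast
  have q4: "pchar (carrier G) (\<lambda>a. \<beta> a b)" if "b \<in> carrier G" for b using q that unfolding quad_def by blast
  have q5: "\<beta> a j \<doteq> 0" if "a \<in> carrier G" "j \<in> J" for a j using q that unfolding quad_def by blast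
  have E0D: "e \<in> D" and E0G: "e \<in> carrier G" and E0p: "e [^] p = \<one>" if "e \<in> E0" for e
    using that E0 E_D D_carrier E_pow by auto
  have zk: "z [^] (k::int) \<in> E0" for k by (rule subgroup_int_pow[OF E0(1,3)])
  note E0m = subgroup.m_closed[OF E0(1)]
  have one: "subgroup {\<one>} G" by (rule triv_subgroup)
  obtain \<epsilon> where \<epsilon>: "pchar E0 \<epsilon>" "\<epsilon> z \<doteq> 1"
  proof (rule separation[OF E0(1) one])
    show "{\<one>} \<subseteq> E0" using subgroup.one_closed[OF E0(1)] by simp
    show "commutator G a b \<in> {\<one>}" if "a \<in> E0" "b \<in> E0" for a b
      using that E0G E0D D_cj by (simp add: commutator_eq_cj)
  qed (use E0p E0(3) z_neq in auto)
  have ex: "\<exists>e\<in>E0. (\<forall>b\<in>carrier G. ch e b \<doteq> \<beta> g b) \<and> \<epsilon> e \<doteq> 0" if g: "g \<in> carrier G" for g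
  proof -
    obtain e where e: "e \<in> E0" "\<And>b. b \<in> carrier G \<Longrightarrow> ch e b \<doteq> \<beta> g b" using real[OF q3[OF g] q5[OF g]] by blast
    \<comment> \<open>Multiplication by a power of \<open>z\<close> leaves the character unchanged
      and adjusts \<epsilon>, because \<epsilon>(z) = 1.\<close>
    define e' where "e' = e \<otimes> z [^] (- \<epsilon> e)"
    have "\<epsilon> e' \<doteq> \<epsilon> e + \<epsilon> (z [^] (- \<epsilon> e))" unfolding e'_def by (rule pcharD[OF \<epsilon>(1) e(1) zk])
    moreover have "\<epsilon> (z [^] (- \<epsilon> e)) \<doteq> - \<epsilon> e * \<epsilon> z" by (rule pchar_int_pow[OF E0(1) \<epsilon>(1) E0(3)])
    ultimately have "\<epsilon> e' \<doteq> 0" using \<epsilon>(2) by Groebner_Basis.algebra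
    moreover have "ch e' b \<doteq> \<beta> g b" if b: "b \<in> carrier G" for b
    proof -
      have "ch (z [^] (- \<epsilon> e)) b \<doteq> 0" using ch_zero_iff[OF z_D b] b by simp
      with ch_mult_cong[OF E0D[OF e(1)] z_D b, of "- \<epsilon> e"] e(2)[OF b] show ?thesis
        unfolding e'_def by Groebner_Basis.algebra
    qed
    moreover have "e' \<in> E0" unfolding e'_def by (rule E0m[OF e(1) zk])
    ultimately show ?thesis by blast
  qed
  define \<phi> where "\<phi> g = (SOME e. e \<in> E0 \<and> (\<forall>b\<in>carrier G. ch e b \<doteq> \<beta> g b) \<and> \<epsilon> e \<doteq> 0)" for g
  have "\<phi> g \<in> E0 \<and> (\<forall>b\<in>carrier G. ch (\<phi> g) b \<doteq> \<beta> g b) \<and> \<epsilon> (\<phi> g) \<doteq> 0" if "g \<in> carrier G" for g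
    unfolding \<phi>_def by (rule someI_ex) (use ex[OF that] in blast)
  then have \<phi>: "\<phi> g \<in> E0" "b \<in> carrier G \<Longrightarrow> ch (\<phi> g) b \<doteq> \<beta> g b" "\<epsilon> (\<phi> g) \<doteq> 0" if "g \<in> carrier G" for g b
    using that by blast+
  have uniq: "e = e'" if e: "e \<in> E0" "e' \<in> E0" "\<And>b. b \<in> carrier G \<Longrightarrow> ch e b \<doteq> ch e' b" "\<epsilon> e \<doteq> 0" "\<epsilon> e' \<doteq> 0" for e e'
  proof (rule E_eq[OF E0(1) \<epsilon> E0(3) e(1,2) D_comm[OF E0D[OF e(1)] E0D[OF e(2)]] E0p[OF e(1)] E0p[OF e(2)]])
    show "\<epsilon> e \<doteq> \<epsilon> e'" using e(4,5) by Groebner_Basis.algebra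
    fix b assume b: "b \<in> carrier G"
    have "z [^] ch e b = z [^] ch e' b" using e(3)[OF b] by (simp only: z_cong)
    then show "\<exists>y\<in>carrier G. cj b e = e \<otimes> y \<and> cj b e' = e' \<otimes> y"
      using ch[OF E0D[OF e(1)] b] ch[OF E0D[OF e(2)] b] by auto
  qed
  have \<phi>m: "\<phi> (g \<otimes> h) = \<phi> g \<otimes> \<phi> h" if gh: "g \<in> carrier G" "h \<in> carrier G" for g h
  proof (rule uniq)
    note ghm = m_closed[OF gh]
    show "\<phi> (g \<otimes> h) \<in> E0" "\<phi> g \<otimes> \<phi> h \<in> E0" "\<epsilon> (\<phi> (g \<otimes> h)) \<doteq> 0"
      using \<phi>(1,3)[OF ghm] E0m[OF \<phi>(1)[OF gh(1)] \<phi>(1)[OF gh(2)]] by auto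
    show "\<epsilon> (\<phi> g \<otimes> \<phi> h) \<doteq> 0"
      using pcharD[OF \<epsilon>(1) \<phi>(1)[OF gh(1)] \<phi>(1)[OF gh(2)]] \<phi>(3)[OF gh(1)] \<phi>(3)[OF gh(2)]
      by Groebner_Basis.algebra
    fix b assume b: "b \<in> carrier G"
    show "ch (\<phi> (g \<otimes> h)) b \<doteq> ch (\<phi> g \<otimes> \<phi> h) b"
      using \<phi>(2)[OF ghm b] pcharD[OF q4[OF b] gh] \<phi>(2)[OF gh(1) b] \<phi>(2)[OF gh(2) b]
        ch_mult_cong[OF E0D[OF \<phi>(1)[OF gh(1)]] E0D[OF \<phi>(1)[OF gh(2)]] b]
      by Groebner_Basis.algebra
  qed
  show ?thesis
  proof (rule that[of "\<lambda>g. \<phi> g \<otimes> z [^] \<kappa> g"])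
    show "\<phi> a \<otimes> z [^] \<kappa> a \<in> E0" if "a \<in> carrier G" for a by (rule E0m[OF \<phi>(1)[OF that] zk])
    fix a b assume ab: "a \<in> carrier G" "b \<in> carrier G"
    note pa = E0G[OF \<phi>(1)[OF ab(1)]] E0G[OF \<phi>(1)[OF ab(2)]]
    have "\<kappa> (a \<otimes> b) \<doteq> ch (\<phi> a) b + \<kappa> a + \<kappa> b" using q2[OF ab] \<phi>(2)[OF ab] by Groebner_Basis.algebra
    then have "z [^] \<kappa> (a \<otimes> b) = z [^] ch (\<phi> a) b \<otimes> z [^] \<kappa> a \<otimes> z [^] \<kappa> b"
      by (simp add: int_pow_mult[symmetric] z_cong)
    then have "\<phi> (a \<otimes> b) \<otimes> z [^] \<kappa> (a \<otimes> b) = \<phi> a \<otimes> (\<phi> b \<otimes> (z [^] (ch (\<phi> a) b + \<kappa> a) \<otimes> z [^] \<kappa> b))"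
      using pa by (simp add: \<phi>m[OF ab] m_assoc int_pow_mult)
    also have "\<phi> b \<otimes> (z [^] (ch (\<phi> a) b + \<kappa> a) \<otimes> z [^] \<kappa> b) = z [^] (ch (\<phi> a) b + \<kappa> a) \<otimes> (\<phi> b \<otimes> z [^] \<kappa> b)"
      using pa z_comm[OF pa(2), of "ch (\<phi> a) b + \<kappa> a"] by (simp add: m_assoc[symmetric])
    also have "\<phi> a \<otimes> \<dots> = cj b (\<phi> a \<otimes> z [^] \<kappa> a) \<otimes> (\<phi> b \<otimes> z [^] \<kappa> b)"
      using pa ab ch[OF E0D[OF \<phi>(1)[OF ab(1)]] ab(2)] by (simp add: cj_mult m_assoc int_pow_mult)
    finally show "\<phi> (a \<otimes> b) \<otimes> z [^] \<kappa> (a \<otimes> b) = cj b (\<phi> a \<otimes> z [^] \<kappa> a) \<otimes> (\<phi> b \<otimes> z [^] \<kappa> b)" .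
  next
    fix u assume u: "u \<in> U"
    note uG = U_carrier[OF u]
    have "\<phi> u = \<one>"
    proof (rule uniq[OF \<phi>(1)[OF uG] _ _ \<phi>(3)[OF uG]])
      show "\<one> \<in> E0" by (rule subgroup.one_closed[OF E0(1)])
      show "\<epsilon> \<one> \<doteq> 0" by (rule pchar_one[OF E0(1) \<epsilon>(1)])
      fix b assume b: "b \<in> carrier G"
      have "ch \<one> b \<doteq> 0" by (rule pchar_one[OF D_sub ch_point[OF b]])
      moreover have "\<beta> u b \<doteq> 0" by (rule U_char[OF q4[OF b] u])
      ultimately show "ch (\<phi> u) b \<doteq> ch \<one> b" using \<phi>(2)[OF uG b] by Groebner_Basis.algebra
    qed
    moreover have "z [^] \<kappa> u = z [^] \<eta> u" using q1[OF u] by (simp only: z_cong)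
    ultimately show "\<phi> u \<otimes> z [^] \<kappa> u = z [^] \<eta> u" by simp
  qed
qed

text \<open>The values of the derivation lie in \<open>E0\<close>, a part of \<open>U\<close>, where
  the derivation is z^\<eta>. As \<eta> vanishes on \<open>E0\<close>, it kills its own values and
  is therefore inner.\<close>

lemma quad_element:
  assumes \<eta>: "rchar \<eta>" and J: "subgroup J G" "U \<subseteq> J"
    and JJ: "\<And>a b. a \<in> J \<Longrightarrow> b \<in> J \<Longrightarrow> \<eta> (commutator G a b) \<doteq> 0"
    and E0: "subgroup E0 G" "E0 \<subseteq> E" "z \<in> E0" "\<And>e. e \<in> E0 \<Longrightarrow> \<eta> e \<doteq> 0"
    and real: "\<And>f. pchar (carrier G) f \<Longrightarrow> (\<And>j. j \<in> J \<Longrightarrow> f j \<doteq> 0) \<Longrightarrow>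
      \<exists>e\<in>E0. \<forall>b\<in>carrier G. ch e b \<doteq> f b"
  obtains x where "x \<in> carrier G" "\<And>b. b \<in> carrier G \<Longrightarrow> \<exists>e\<in>E0. cj b x = e \<otimes> x"
    "\<And>u. u \<in> U \<Longrightarrow> cj u x = z [^] \<eta> u \<otimes> x"
proof -
  obtain \<delta> where \<delta>: "\<And>a. a \<in> carrier G \<Longrightarrow> \<delta> a \<in> E0"
    "\<And>a b. a \<in> carrier G \<Longrightarrow> b \<in> carrier G \<Longrightarrow> \<delta> (a \<otimes> b) = cj b (\<delta> a) \<otimes> \<delta> b"
    "\<And>u. u \<in> U \<Longrightarrow> \<delta> u = z [^] \<eta> u"
    using quad_derivation[OF \<eta> J JJ E0(1-3) real] by blast
  have EG: "e \<in> carrier G" "e [^] p = \<one>" "e \<in> U" if "e \<in> E0" for e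
    using subsetD[OF E0(2) that] E_carrier E_pow subsetD[OF N_U D_N[OF E_D]] by auto
  have \<delta>E: "\<delta> e = \<one>" if "e \<in> E0" for e
  proof -
    have "z [^] \<eta> e = z [^] (0::int)" using E0(4)[OF that] by (simp only: z_cong)
    then show ?thesis using \<delta>(3)[OF EG(3)[OF that]] by simp
  qed
  have "\<exists>x\<in>carrier G. \<forall>b\<in>carrier G. cj b x = \<delta> b \<otimes> x"
    by (rule derivation_inner[OF EG(1)[OF \<delta>(1)] \<delta>(2) EG(2)[OF \<delta>(1)] \<delta>E[OF \<delta>(1)]])
  then obtain x where x: "x \<in> carrier G" "\<And>b. b \<in> carrier G \<Longrightarrow> cj b x = \<delta> b \<otimes> x" by blast
  show ?thesis
  proof (rule that[OF x(1)])
    show "\<exists>e\<in>E0. cj b x = e \<otimes> x" if "b \<in> carrier G" for b using x(2)[OF that] \<delta>(1)[OF that] by blast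
    show "cj u x = z [^] \<eta> u \<otimes> x" if "u \<in> U" for u using x(2)[OF U_carrier[OF that]] \<delta>(3)[OF that] by simp
  qed
qed


section \<open>Products of affine elements\<close>

lemma E_cj: "e \<in> E \<Longrightarrow> b \<in> carrier G \<Longrightarrow> cj b (e [^] (k::int)) = e [^] k \<otimes> z [^] (k * ch e b)"
proof -
  assume e: "e \<in> E" and b: "b \<in> carrier G"
  note eG = E_carrier[OF e]
  have "cj b (e [^] k) = (e \<otimes> z [^] ch e b) [^] k" using eG b ch[OF E_D[OF e] b] by (simp add: cj_int_pow)
  also have "\<dots> = e [^] k \<otimes> (z [^] ch e b) [^] k"
    by (rule int_pow_mult_distrib) (use eG z_comm[OF eG] in simp_all)
  finally show ?thesis by (simp add: int_pow_pow mult.commute)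
qed

lemma normal_form_mult:
  assumes "w \<in> carrier G" "a \<in> carrier G" "w \<otimes> a = a \<otimes> w"
  shows "(w [^] (i::int) \<otimes> a [^] (j::int) \<otimes> z [^] (k::int)) \<otimes> (w [^] (i'::int) \<otimes> a [^] (j'::int) \<otimes> z [^] (k'::int))
    = w [^] (i + i') \<otimes> a [^] (j + j') \<otimes> z [^] (k + k')"
proof -
  have "a [^] j \<otimes> w = w \<otimes> a [^] j" by (rule int_pow_commute[OF assms(3)[symmetric] assms(2,1)])
  from int_pow_commute[OF this[symmetric]] assms
  have aw: "w [^] i' \<otimes> a [^] j = a [^] j \<otimes> w [^] i'" by simp
  have "(w [^] i \<otimes> a [^] j \<otimes> z [^] k) \<otimes> (w [^] i' \<otimes> a [^] j' \<otimes> z [^] k')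
    = w [^] i \<otimes> a [^] j \<otimes> (z [^] k \<otimes> (w [^] i' \<otimes> a [^] j')) \<otimes> z [^] k'"
    using assms by (simp add: m_assoc)
  also have "\<dots> = w [^] i \<otimes> (a [^] j \<otimes> w [^] i') \<otimes> (a [^] j' \<otimes> z [^] k \<otimes> z [^] k')"
    using assms z_comm[of "w [^] i' \<otimes> a [^] j'" k] by (simp add: m_assoc)
  also have "\<dots> = w [^] (i + i') \<otimes> a [^] (j + j') \<otimes> z [^] (k + k')"
    using assms by (simp add: aw[symmetric] m_assoc int_pow_mult)
  finally show ?thesis .
qed

text \<open>If \<open>w\<close> and \<open>a\<close> are thought of as affine functions on \<open>G\<close>, then \<open>\<tau> w a\<close> is the derivation
  belonging to their product.\<close>

definition \<tau> :: "'a \<Rightarrow> 'a \<Rightarrow> 'a \<Rightarrow> 'a" where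
  "\<tau> w a b = w [^] ch a b \<otimes> a [^] ch w b \<otimes> z [^] (ch w b * ch a b)"

lemma E_comm: "w \<in> E \<Longrightarrow> a \<in> E \<Longrightarrow> w \<otimes> a = a \<otimes> w"
  by (rule D_comm[OF E_D E_D])

lemma E_pow_cong: "e \<in> E \<Longrightarrow> i \<doteq> j \<Longrightarrow> e [^] i = e [^] j"
  by (rule int_pow_cong[OF E_carrier E_pow])

lemma \<tau>_E: "w \<in> E \<Longrightarrow> a \<in> E \<Longrightarrow> \<tau> w a b \<in> E"
  unfolding \<tau>_def by (intro subgroup.m_closed[OF E_sub] subgroup_int_pow[OF E_sub] z_E')

lemma \<tau>_cong: "w \<in> E \<Longrightarrow> a \<in> E \<Longrightarrow> i \<doteq> ch a b \<Longrightarrow> j \<doteq> ch w b \<Longrightarrow>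
    \<tau> w a b = w [^] i \<otimes> a [^] j \<otimes> z [^] (j * i)"
proof -
  assume a: "w \<in> E" "a \<in> E" and ij: "i \<doteq> ch a b" "j \<doteq> ch w b"
  have "j * i \<doteq> ch w b * ch a b" using ij by Groebner_Basis.algebra
  then show ?thesis unfolding \<tau>_def 
    using E_pow_cong[OF a(1) ij(1)] E_pow_cong[OF a(2) ij(2)] E_pow_cong[OF z_E'] by simp
qed

text \<open>Leibniz rule for (w + \<lambda>)(a + \<mu>) - wa = w\<mu> + a\<lambda> + \<lambda>\<mu>,
  written additively. The mixed terms of the exponent of \<open>z\<close> come from the action of b'
  on the powers of \<open>w\<close> and \<open>a\<close>.\<close>

lemma \<tau>_derivation:
  assumes w: "w \<in> E" and a: "a \<in> E" and b: "b \<in> carrier G" "b' \<in> carrier G"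
  shows "\<tau> w a (b \<otimes> b') = cj b' (\<tau> w a b) \<otimes> \<tau> w a b'"
proof -
  note G = E_carrier[OF w] E_carrier[OF a]
  let ?l = "ch w b" and ?l' = "ch w b'" and ?m = "ch a b" and ?m' = "ch a b'"
  have "cj b' (\<tau> w a b) = (w [^] ?m \<otimes> z [^] (?m * ?l')) \<otimes> (a [^] ?l \<otimes> z [^] (?l * ?m')) \<otimes> z [^] (?l * ?m)"
    unfolding \<tau>_def using G b by (simp add: cj_mult E_cj w a)
  also have "\<dots> = w [^] ?m \<otimes> (z [^] (?m * ?l') \<otimes> a [^] ?l) \<otimes> z [^] (?l * ?m') \<otimes> z [^] (?l * ?m)"
    using G by (simp add: m_assoc)
  also have "\<dots> = w [^] ?m \<otimes> a [^] ?l \<otimes> z [^] (?m * ?l' + ?l * ?m' + ?l * ?m)"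
    using G z_comm[of "a [^] ?l" "?m * ?l'"] by (simp add: m_assoc int_pow_mult)
  finally have "cj b' (\<tau> w a b) \<otimes> \<tau> w a b' =
    w [^] (?m + ?m') \<otimes> a [^] (?l + ?l') \<otimes> z [^] ((?m * ?l' + ?l * ?m' + ?l * ?m) + ?l' * ?m')"
    unfolding \<tau>_def[of w a b'] by (simp only: normal_form_mult[OF G E_comm[OF w a]])
  also have "(?m * ?l' + ?l * ?m' + ?l * ?m) + ?l' * ?m' = (?l + ?l') * (?m + ?m')"
    by (simp add: algebra_simps)
  also have "w [^] (?m + ?m') \<otimes> a [^] (?l + ?l') \<otimes> z [^] ((?l + ?l') * (?m + ?m')) = \<tau> w a (b \<otimes> b')"
    by (rule \<tau>_cong[OF w a cong_sym[OF pcharD[OF ch_pchar[OF E_D[OF a]] b]] 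
          cong_sym[OF pcharD[OF ch_pchar[OF E_D[OF w]] b]], symmetric])
  finally show ?thesis by simp
qed

lemma \<tau>_kill: assumes "w \<in> E" "a \<in> E" "ch w b \<doteq> 0" "ch a b \<doteq> 0" shows "\<tau> w a b = \<one>"
  using \<tau>_cong[OF assms(1,2) cong_sym[OF assms(4)] cong_sym[OF assms(3)]] by simp

lemma E_N: "e \<in> E \<Longrightarrow> e \<in> N" by (rule D_N[OF E_D])
lemma E_U: "e \<in> E \<Longrightarrow> e \<in> U" using E_N N_U by blast

lemma \<tau>_U: "w \<in> E \<Longrightarrow> a \<in> E \<Longrightarrow> u \<in> U \<Longrightarrow> \<tau> w a u = \<one>"
  by (rule \<tau>_kill[OF _ _ ch_U[OF E_D] ch_U[OF E_D]])

definition prod_el :: "'a \<Rightarrow> 'a \<Rightarrow> 'a \<Rightarrow> bool" where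
  "prod_el w a x \<longleftrightarrow> x \<in> carrier G \<and> (\<forall>b\<in>carrier G. cj b x = \<tau> w a b \<otimes> x)"

lemma prod_el_exists: assumes w: "w \<in> E" and a: "a \<in> E" obtains x where "prod_el w a x"
proof -
  have "\<exists>x\<in>carrier G. \<forall>b\<in>carrier G. cj b x = \<tau> w a b \<otimes> x"
    by (rule derivation_inner[OF E_carrier[OF \<tau>_E[OF w a]] \<tau>_derivation[OF w a] E_pow[OF \<tau>_E[OF w a]]
          \<tau>_U[OF w a E_U[OF \<tau>_E[OF w a]]]])
  then show ?thesis using that by (auto simp: prod_el_def)
qed

lemma prod_elD: "prod_el w a x \<Longrightarrow> x \<in> carrier G"
  "prod_el w a x \<Longrightarrow> b \<in> carrier G \<Longrightarrow> cj b x = \<tau> w a b \<otimes> x"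
  by (auto simp: prod_el_def)

lemma prod_el_U: "w \<in> E \<Longrightarrow> a \<in> E \<Longrightarrow> prod_el w a x \<Longrightarrow> u \<in> U \<Longrightarrow> cj u x = x"
  using prod_elD(2)[of w a x u] prod_elD(1)[of w a x] \<tau>_U U_carrier by simp

lemma prod_el_N: "w \<in> E \<Longrightarrow> a \<in> E \<Longrightarrow> prod_el w a x \<Longrightarrow> x \<in> N"
  by (rule N_self[OF prod_elD(1) prod_el_U]) (use N_U in auto)

lemma U_comm_iff: "x \<in> carrier G \<Longrightarrow> u \<in> carrier G \<Longrightarrow> cj u x = x \<Longrightarrow> u \<otimes> x = x \<otimes> u"
  using cj_fix_iff by simp

lemma prod_el_comm: "w \<in> E \<Longrightarrow> a \<in> E \<Longrightarrow> prod_el w a x \<Longrightarrow> u \<in> U \<Longrightarrow> u \<otimes> x = x \<otimes> u"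
  by (rule U_comm_iff[OF prod_elD(1) U_carrier prod_el_U])

text \<open>The commutators of \<open>x\<close> with \<open>G\<close> have \<open>p\<close>-th power
  1 and commute with \<open>x\<close>, so they disappear from the \<open>p\<close>-th power.\<close>

lemma prod_el_pow_central:
  assumes w: "w \<in> E" and a: "a \<in> E" and x: "prod_el w a x" and b: "b \<in> carrier G"
  shows "cj b (x [^] p) = x [^] p"
proof -
  note xG = prod_elD(1)[OF x] and tE = \<tau>_E[OF w a, of b]
  have "cj b (x [^] p) = (\<tau> w a b \<otimes> x) [^] p" using xG b prod_elD(2)[OF x b] by (simp add: cj_int_pow)
  also have "\<dots> = \<tau> w a b [^] p \<otimes> x [^] p"
    by (rule int_pow_mult_distrib[OF prod_el_comm[OF w a x E_U[OF tE]] E_carrier[OF tE] xG])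
  finally show ?thesis using E_pow[OF tE] xG by simp
qed

lemma \<tau>_mult: assumes w: "w \<in> E" and a: "a \<in> E" "a' \<in> E" and b: "b \<in> carrier G"
  shows "\<tau> w (a \<otimes> a') b = \<tau> w a b \<otimes> \<tau> w a' b"
proof -
  note G = E_carrier[OF w] E_carrier[OF a(1)] E_carrier[OF a(2)]
  let ?l = "ch w b" and ?m = "ch a b" and ?m' = "ch a' b"
  have aa: "a \<otimes> a' \<in> E" by (rule subgroup.m_closed[OF E_sub a])
  have "\<tau> w (a \<otimes> a') b = w [^] (?m + ?m') \<otimes> (a \<otimes> a') [^] ?l \<otimes> z [^] (?l * (?m + ?m'))"
    by (rule \<tau>_cong[OF w aa cong_sym[OF ch_mult_cong[OF E_D[OF a(1)] E_D[OF a(2)] b]]]) simp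
  also have "(a \<otimes> a') [^] ?l = a [^] ?l \<otimes> a' [^] ?l" by (rule int_pow_mult_distrib[OF E_comm[OF a] G(2,3)])
  finally have 1: "\<tau> w (a \<otimes> a') b = w [^] (?m + ?m') \<otimes> (a [^] ?l \<otimes> a' [^] ?l) \<otimes> z [^] (?l * (?m + ?m'))" .
  have wa: "a [^] ?l \<otimes> w [^] ?m' = w [^] ?m' \<otimes> a [^] ?l"
    by (rule E_comm) (use w a subgroup_int_pow[OF E_sub] in auto)
  have "\<tau> w a b \<otimes> \<tau> w a' b = w [^] ?m \<otimes> a [^] ?l \<otimes> (z [^] (?l * ?m) \<otimes> (w [^] ?m' \<otimes> a' [^] ?l)) \<otimes> z [^] (?l * ?m')"
    unfolding \<tau>_def using G by (simp add: m_assoc)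
  also have "z [^] (?l * ?m) \<otimes> (w [^] ?m' \<otimes> a' [^] ?l) = (w [^] ?m' \<otimes> a' [^] ?l) \<otimes> z [^] (?l * ?m)"
    by (rule z_comm) (use G in simp)
  also have "w [^] ?m \<otimes> a [^] ?l \<otimes> ((w [^] ?m' \<otimes> a' [^] ?l) \<otimes> z [^] (?l * ?m)) \<otimes> z [^] (?l * ?m')
     = w [^] ?m \<otimes> (a [^] ?l \<otimes> w [^] ?m') \<otimes> a' [^] ?l \<otimes> (z [^] (?l * ?m) \<otimes> z [^] (?l * ?m'))"
    using G by (simp add: m_assoc)
  also have "\<dots> = w [^] (?m + ?m') \<otimes> (a [^] ?l \<otimes> a' [^] ?l) \<otimes> z [^] (?l * (?m + ?m'))"
    unfolding wa using G by (simp add: m_assoc int_pow_mult distrib_left)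
  finally show ?thesis using 1 by simp
qed

lemma prod_el_mult:
  assumes w: "w \<in> E" and a: "a \<in> E" "a' \<in> E" and x: "prod_el w a x" "prod_el w a' x'"
  shows "prod_el w (a \<otimes> a') (x \<otimes> x')"
  unfolding prod_el_def
proof (intro conjI ballI)
  note G = prod_elD(1)[OF x(1)] prod_elD(1)[OF x(2)]
  show "x \<otimes> x' \<in> carrier G" using G by simp
  fix b assume b: "b \<in> carrier G"
  note t = \<tau>_E[OF w a(1), of b] \<tau>_E[OF w a(2), of b]
  note tG = E_carrier[OF t(1)] E_carrier[OF t(2)]
  have "cj b (x \<otimes> x') = \<tau> w a b \<otimes> (x \<otimes> \<tau> w a' b) \<otimes> x'"
    using G b tG prod_elD(2)[OF x(1) b] prod_elD(2)[OF x(2) b] by (simp add: cj_mult m_assoc)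
  also have "x \<otimes> \<tau> w a' b = \<tau> w a' b \<otimes> x" by (rule prod_el_comm[OF w a(1) x(1) E_U[OF t(2)], symmetric])
  finally show "cj b (x \<otimes> x') = \<tau> w (a \<otimes> a') b \<otimes> (x \<otimes> x')"
    unfolding \<tau>_mult[OF w a b] using G tG by (simp add: m_assoc)
qed

lemma one_E: "\<one> \<in> E" by (rule subgroup.one_closed[OF E_sub])

lemma ch_one: "b \<in> carrier G \<Longrightarrow> ch \<one> b \<doteq> 0"
  by (rule pchar_one[OF D_sub ch_point])

lemma ch_z: "b \<in> carrier G \<Longrightarrow> ch (z [^] (k::int)) b \<doteq> 0"
  using ch_zero_iff[OF z_D] by simp

lemma prod_el_one: assumes w: "w \<in> E" shows "prod_el w \<one> \<one>"
proof -
  have "\<tau> w \<one> b = \<one>" if "b \<in> carrier G" for b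
    using \<tau>_cong[OF w one_E cong_sym[OF ch_one[OF that]], of "ch w b"] by simp
  then show ?thesis by (simp add: prod_el_def)
qed

lemma prod_el_inv:
  assumes w: "w \<in> E" and a: "a \<in> E" and x: "prod_el w a x"
  shows "prod_el w (inv a) (inv x)"
  unfolding prod_el_def
proof (intro conjI ballI)
  note xG = prod_elD(1)[OF x]
  show "inv x \<in> carrier G" using xG by simp
  fix b assume b: "b \<in> carrier G"
  have ia: "inv a \<in> E" by (rule subgroup.m_inv_closed[OF E_sub a])
  note t = \<tau>_E[OF w a, of b] \<tau>_E[OF w ia, of b]
  note tG = E_carrier[OF t(1)] E_carrier[OF t(2)]
  have "\<tau> w (a \<otimes> inv a) b = \<one>" 
    using \<tau>_cong[OF w one_E cong_sym[OF ch_one[OF b]], of "ch w b"] E_carrier[OF a] by simp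
  then have "\<tau> w a b \<otimes> \<tau> w (inv a) b = \<one>" using \<tau>_mult[OF w a ia b] by simp
  then have "inv (\<tau> w a b) = \<tau> w (inv a) b" using tG E_comm[OF t] by (intro inv_equality) auto
  moreover have "cj b (inv x) = inv (\<tau> w a b \<otimes> x)" using xG b prod_elD(2)[OF x b] by (simp add: cj_inv)
  moreover have "\<tau> w a b \<otimes> x = x \<otimes> \<tau> w a b" by (rule prod_el_comm[OF w a x E_U[OF t(1)]])
  ultimately show "cj b (inv x) = \<tau> w (inv a) b \<otimes> inv x" using xG tG by (simp add: inv_mult_group)
qed

lemma prod_el_pow:
  assumes w: "w \<in> E" and a: "a \<in> E" and x: "prod_el w a x"
  shows "prod_el w (a [^] (k::int)) (x [^] k)"
proof -
  have n: "prod_el w (a [^] n) (x [^] n)" for n :: nat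
  proof (induction n)
    case 0 then show ?case using prod_el_one[OF w] by simp
  next
    case (Suc n)
    have "a [^] n \<in> E" using subgroup_int_pow[OF E_sub a, of "int n"] by (simp only: int_pow_int)
    from prod_el_mult[OF w this a Suc x] show ?case by simp
  qed
  show ?thesis
  proof (cases k)
    case (nonneg n) then show ?thesis using n[of n] by (simp only: int_pow_int)
  next
    case (neg n)
    have "a [^] Suc n \<in> E" using subgroup_int_pow[OF E_sub a, of "int (Suc n)"] by (simp only: int_pow_int)
    from prod_el_inv[OF w this n] show ?thesis unfolding neg 
      by (simp only: int_pow_neg_int[OF E_carrier[OF a]] int_pow_neg_int[OF prod_elD(1)[OF x]])
  qed
qed

lemma prod_el_central:
  assumes w: "w \<in> E" and a: "a \<in> E" and x: "prod_el w a x"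
    and r: "r \<in> carrier G" "\<And>g. g \<in> carrier G \<Longrightarrow> cj g r = r"
  shows "prod_el w a (x \<otimes> r)"
  using prod_elD[OF x] r E_carrier[OF \<tau>_E[OF w a]] by (simp add: prod_el_def cj_mult m_assoc)

lemma prod_el_sym: assumes w: "w \<in> E" and a: "a \<in> E" shows "prod_el w a x \<longleftrightarrow> prod_el a w x"
proof -
  have "\<tau> w a b = \<tau> a w b" for b
    unfolding \<tau>_def using E_comm[of "w [^] ch a b" "a [^] ch w b"] w a subgroup_int_pow[OF E_sub]
    by (simp add: mult.commute)
  then show ?thesis by (simp add: prod_el_def)
qed

text \<open>Under the dictionary between elements and functions, \<open>z\<close> is the constant
  function 1, the unit of the multiplication.\<close>

lemma prod_el_z: assumes w: "w \<in> E" shows "prod_el w z w"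
  unfolding prod_el_def
proof (intro conjI ballI)
  show "w \<in> carrier G" by (rule E_carrier[OF w])
  fix b assume b: "b \<in> carrier G"
  have cz: "ch z b \<doteq> 0" using ch_z[OF b, of 1] by simp
  have "\<tau> w z b = z [^] ch w b" using \<tau>_cong[OF w z_E' cong_sym[OF cz], of "ch w b"] E_carrier[OF w] by simp
  then show "cj b w = \<tau> w z b \<otimes> w" using ch[OF E_D[OF w] b] z_comm[OF E_carrier[OF w]] by simp
qed

text \<open>Products of elements of \<open>E\<close> have their \<open>p\<close>-th power in \<open>Z(G)\<close>, but need not have order \<open>p\<close>.\<close>

definition E1 :: "'a \<Rightarrow> 'a set" where
  "E1 w = {a \<in> E. \<exists>x. prod_el w a x \<and> x [^] p = \<one>}"

lemma E1_E: "a \<in> E1 w \<Longrightarrow> a \<in> E" by (simp add: E1_def)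

lemma E1_sym: "w \<in> E \<Longrightarrow> a \<in> E1 w \<Longrightarrow> w \<in> E1 a"
  using prod_el_sym by (auto simp: E1_def)

lemma z_E1: "w \<in> E \<Longrightarrow> z \<in> E1 w"
  using prod_el_z z_E' E_pow by (auto simp: E1_def)

lemma E1_sub: assumes w: "w \<in> E" shows "subgroup (E1 w) G"
proof (rule subgroupI)
  show "E1 w \<subseteq> carrier G" using E_carrier E1_E by blast
  show "E1 w \<noteq> {}" using z_E1[OF w] by blast
  show "inv a \<in> E1 w" if a: "a \<in> E1 w" for a
  proof -
    obtain x where x: "prod_el w a x" "x [^] p = \<one>" using a by (auto simp: E1_def)
    have "inv x [^] p = \<one>" using x prod_elD(1)[OF x(1)] by (simp add: int_pow_inv)
    then show ?thesis using prod_el_inv[OF w E1_E[OF a] x(1)] subgroup.m_inv_closed[OF E_sub E1_E[OF a]]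
      unfolding E1_def by blast
  qed
  show "a \<otimes> a' \<in> E1 w" if a: "a \<in> E1 w" "a' \<in> E1 w" for a a'
  proof -
    obtain x x' where x: "prod_el w a x" "x [^] p = \<one>" "prod_el w a' x'" "x' [^] p = \<one>"
      using a unfolding E1_def by blast
    note e = E1_E[OF a(1)] E1_E[OF a(2)]
    have "x' \<in> U" using prod_el_N[OF w e(2) x(3)] N_U by blast
    then have "x \<otimes> x' = x' \<otimes> x" using prod_el_comm[OF w e(1) x(1)] by simp
    then have "(x \<otimes> x') [^] p = \<one>"
      using int_pow_mult_distrib[of x x' p] x prod_elD(1)[OF x(1)] prod_elD(1)[OF x(3)] by simp
    then show ?thesis using prod_el_mult[OF w e x(1,3)] subgroup.m_closed[OF E_sub e]
      unfolding E1_def by blast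
  qed
qed

text \<open>An element with prescribed commutators is unique up to Z(G), and the products with
  \<open>w\<close> commute with each other. Hence sending \<open>a\<close> to the
  \<open>p\<close>-th power of its product with \<open>w\<close> is a homomorphism from
  \<open>E\<close> to Z(G)/Z(G)^p with kernel \<open>E1 w\<close>, and \<open>central_power\<close>
  says that the target is generated by any of its nontrivial elements.\<close>

lemma E1_index:
  assumes w: "w \<in> E" and a: "a \<in> E" and e: "e \<in> E" "e \<notin> E1 w"
  shows "\<exists>i::int. a \<otimes> e [^] i \<in> E1 w"
proof -
  obtain x where x: "prod_el w a x" by (rule prod_el_exists[OF w a])
  obtain y where y: "prod_el w e y" by (rule prod_el_exists[OF w e(1)])
  note G = prod_elD(1)[OF x] prod_elD(1)[OF y]
  \<comment> \<open>If the \<open>p\<close>-th power of a product has a central \<open>p\<close>-th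
    root, dividing by this root gives the same commutators and order \<open>p\<close>.\<close>
  have div: "prod_el w a' (x' \<otimes> inv r) \<and> (x' \<otimes> inv r) [^] p = \<one>"
    if "prod_el w a' x'" "a' \<in> E" "r \<in> carrier G" "\<And>g. g \<in> carrier G \<Longrightarrow> cj g r = r" "r [^] p = x' [^] p" for a' x' r
  proof
    note x'G = prod_elD(1)[OF that(1)]
    show "prod_el w a' (x' \<otimes> inv r)"
      by (rule prod_el_central[OF w that(2,1)]) (use that(3,4) in \<open>simp_all add: cj_inv\<close>)
    have "inv r \<otimes> x' = x' \<otimes> inv r"
      using cj_fix_iff[of x' "inv r"] that(3) that(4)[OF x'G] x'G by (simp add: cj_inv)
    then show "(x' \<otimes> inv r) [^] p = \<one>"
      using int_pow_mult_distrib[of x' "inv r" p] that x'G by (simp add: int_pow_inv)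
  qed
  have "\<not> (\<exists>r\<in>carrier G. (\<forall>g\<in>carrier G. cj g r = r) \<and> r [^] p = y [^] p)"
    using div[OF y e(1)] e unfolding E1_def by blast
  then obtain i r where ir: "r \<in> carrier G" "\<And>g. g \<in> carrier G \<Longrightarrow> cj g r = r" "r [^] p = x [^] p \<otimes> (y [^] p) [^] (i::int)"
    using central_power[of "y [^] p" "x [^] p"] G prod_el_pow_central[OF w a x] prod_el_pow_central[OF w e(1) y]
    by auto
  have ei: "e [^] i \<in> E" by (rule subgroup_int_pow[OF E_sub e(1)])
  note yi = prod_el_pow[OF w e(1) y, of i]
  note xy = prod_el_mult[OF w a ei x yi]
  have "y [^] i \<in> U" using prod_el_N[OF w ei yi] N_U by blast
  then have "x \<otimes> y [^] i = y [^] i \<otimes> x" using prod_el_comm[OF w a x] by simp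
  then have "(x \<otimes> y [^] i) [^] p = x [^] p \<otimes> (y [^] i) [^] p"
    using G by (intro int_pow_mult_distrib) auto
  also have "(y [^] i) [^] p = (y [^] p) [^] i" using G by (simp add: int_pow_pow mult.commute)
  finally have "r [^] p = (x \<otimes> y [^] i) [^] p" using ir(3) by simp
  from div[OF xy subgroup.m_closed[OF E_sub a ei] ir(1,2) this] subgroup.m_closed[OF E_sub a ei]
  show ?thesis unfolding E1_def by blast
qed

lemma two_not_dvd: "\<not> p dvd i \<Longrightarrow> \<not> p dvd 2 * i"
proof
  assume i: "\<not> p dvd i" and "p dvd 2 * i"
  then have "p dvd 2" using prime_dvd_mult_iff[OF prime_p] by blast
  then have "p \<le> 2" by (rule zdvd_imp_le) simp
  moreover have "p \<ge> 2" by (rule prime_ge_2_int[OF prime_p])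
  ultimately show False using odd_p by simp
qed

lemma noncentral_char:
  assumes "e \<in> E" "\<And>k::int. e \<noteq> z [^] k"
  obtains b where "b \<in> carrier G" "\<not> p dvd ch e b"
proof -
  have "\<exists>b\<in>carrier G. cj b e \<noteq> e" using z_gen[OF E_carrier[OF assms(1)] _ E_pow[OF assms(1)]] assms(2) by blast
  then show ?thesis using ch_zero_iff[OF E_D[OF assms(1)]] that by auto
qed

text \<open>Otherwise \<open>\<tau> y y\<close> would be an inner derivation with values outside of \<open>M\<close>, although \<open>N / M\<close>
  is central in \<open>G / M\<close>.\<close>

lemma E_M: "y \<in> E \<Longrightarrow> y \<in> M"
proof (rule ccontr)
  assume y: "y \<in> E" and nM: "y \<notin> M"
  note yG = E_carrier[OF y]
  have "y \<noteq> z [^] (k::int)" for k using nM subgroup_int_pow[OF R_sub z_R] R_M by blast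
  then obtain b where b: "b \<in> carrier G" "\<not> p dvd ch y b" by (rule noncentral_char[OF y])
  obtain x where x: "prod_el y y x" by (rule prod_el_exists[OF y y])
  note xG = prod_elD(1)[OF x]
  have xU: "x \<in> U" using prod_el_N[OF y y x] N_U by blast
  have tE: "\<tau> y y b \<in> E" by (rule \<tau>_E[OF y y])
  have "x \<otimes> commutator G x b = \<tau> y y b \<otimes> x"
    using prod_elD(2)[OF x b(1)] cj_eq_commutator[OF b(1) xG] by simp
  also have "\<dots> = x \<otimes> \<tau> y y b" by (rule prod_el_comm[OF y y x E_U[OF tE]])
  finally have "commutator G x b = \<tau> y y b" using xG b E_carrier[OF tE] by simp
  then have "\<tau> y y b \<in> M" using U_central[OF xU b(1)] R_M by auto
  moreover have "z [^] (ch y b * ch y b) \<in> M" using subgroup_int_pow[OF R_sub z_R] R_M by blast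
  \<comment> \<open>Both factors of the product are \<open>y\<close>, so \<open>y\<close> occurs
    with the exponent \<open>2 * ch y b\<close>; here 2 has to be invertible modulo
    \<open>p\<close>.\<close>
  moreover have "y [^] (2 * ch y b) = \<tau> y y b \<otimes> inv (z [^] (ch y b * ch y b))"
    unfolding \<tau>_def using yG by (simp add: int_pow_mult[symmetric] m_assoc)
  ultimately have "y [^] (2 * ch y b) \<in> M"
    using subgroup.m_closed[OF M_sub] subgroup.m_inv_closed[OF M_sub] by simp
  moreover have "y [^] p \<in> M" using E_pow[OF y] subgroup.one_closed[OF M_sub] by simp
  ultimately have "p dvd 2 * ch y b" using power_outside[OF M_sub yG nM] by blast
  then show False using two_not_dvd[OF b(2)] by blast
qed

end

section \<open>Multiplying by a noncentral affine element\<close>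

text \<open>The double centralizer of a commuting set is abelian, because the set lies in its own
  centralizer. It provides a commutative group in which long products can be rearranged.\<close>

lemma (in group) abelian_hull:
  assumes S: "S \<subseteq> carrier G" "\<And>s t. s \<in> S \<Longrightarrow> t \<in> S \<Longrightarrow> s \<otimes> t = t \<otimes> s"
  obtains A where "subgroup A G" "S \<subseteq> A" "\<And>a b. a \<in> A \<Longrightarrow> b \<in> A \<Longrightarrow> a \<otimes> b = b \<otimes> a"
proof -
  define C where "C = {g \<in> carrier G. \<forall>s\<in>S. g \<otimes> s = s \<otimes> g}"
  define A where "A = {g \<in> carrier G. \<forall>h\<in>C. cj h g = g}"
  have CG: "h \<in> carrier G" if "h \<in> C" for h using that by (simp add: C_def)
  have SC: "S \<subseteq> C" using S by (auto simp: C_def)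
  have com: "g \<otimes> h = h \<otimes> g" if "g \<in> A" "h \<in> C" for g h
    using that CG cj_fix_iff[of h g] by (auto simp: A_def)
  have AC: "A \<subseteq> C" using com SC by (auto simp: C_def A_def)
  have "S \<subseteq> A"
  proof
    fix s assume s: "s \<in> S"
    show "s \<in> A" unfolding A_def
    proof (intro CollectI conjI ballI)
      show "s \<in> carrier G" using s S by blast
      fix h assume h: "h \<in> C"
      then show "cj h s = s" using cj_fix_iff[of h s] s S by (auto simp: C_def)
    qed
  qed
  moreover have "subgroup A G"
    by (rule subgroupI) (use CG in \<open>auto simp: A_def cj_mult cj_inv intro!: exI[of _ \<one>]\<close>)
  ultimately show ?thesis using that com AC by blast
qed

text \<open>The derivation law for the product of \<open>w\<close> and \<open>c\<close>, written
  out. In the application \<open>u\<close>, \<open>v\<close> are the commutators [c,a], [c,b],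
  \<open>s\<close>, \<open>t\<close> are their products with \<open>w\<close>, \<open>i\<close>,
  \<open>j\<close> are the values of \<open>ch w\<close> at a and b, and \<open>k\<close> is the
  value of \<open>ch u\<close> at b.\<close>

lemma (in comm_group) leibniz_identity:
  fixes i j k :: int
  assumes "c \<in> carrier G" "w \<in> carrier G" "z \<in> carrier G" "u \<in> carrier G" "v \<in> carrier G" "s \<in> carrier G" "t \<in> carrier G"
  shows "c [^] (i + j) \<otimes> (s \<otimes> t \<otimes> w [^] k) \<otimes> (u \<otimes> v \<otimes> z [^] k) [^] (i + j) =
    (c \<otimes> v) [^] i \<otimes> ((w [^] k \<otimes> u [^] j \<otimes> z [^] (j * k)) \<otimes> s) \<otimes> (u \<otimes> z [^] k) [^] i
      \<otimes> (c [^] j \<otimes> t \<otimes> v [^] j)"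
proof -
  have e: "k * (i + j) = k * i + j * k" by (simp add: algebra_simps)
  show ?thesis using assms
    by (simp add: int_pow_distrib int_pow_pow e) (simp add: int_pow_mult m_ac)
qed

context p_stage
begin

text \<open>The derivation belonging to the product of \<open>w\<close> and \<open>c\<close> is
  \<open>\<delta> b = c^(\<lambda> b) Q(f b) (f b)^(\<lambda> b)\<close>, where \<open>\<lambda>\<close> is the character of \<open>w\<close>, \<open>f b\<close> is \<open>[c, b]\<close> and
  \<open>Q a\<close> is the product of \<open>w\<close> and \<open>a\<close>. The functional \<open>\<epsilon>\<close> selects the choices of \<open>Q a\<close> such that \<open>Q\<close>
  is a homomorphism.\<close>

lemma product_derivation_element:
  assumes w: "w \<in> E" "\<And>k::int. w \<noteq> z [^] k"
    and c: "c \<in> carrier G" "c [^] p = \<one>" "\<And>b. b \<in> carrier G \<Longrightarrow> inv c \<otimes> cj b c \<in> E1 w"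
      "\<And>m. m \<in> M \<Longrightarrow> cj m c = c"
  obtains x where "x \<in> carrier G" "\<And>b. b \<in> carrier G \<Longrightarrow> cj b c = c \<Longrightarrow> cj b w = w \<Longrightarrow> cj b x = x"
    "\<And>b j. b \<in> carrier G \<Longrightarrow> cj b w = w \<Longrightarrow> cj b c = c \<otimes> z [^] (j::int) \<Longrightarrow> cj b x = w [^] j \<otimes> x"
proof -
  note wG = E_carrier[OF w(1)]
  \<comment> \<open>This is \<Omega>_1(Z(U)), since the centralizer of \<open>U\<close> lies in
    \<open>N\<close> and so in \<open>U\<close>. It contains \<open>E\<close> and all products of
    order \<open>p\<close> with \<open>w\<close>, so a single \<epsilon> can normalize all of
    them.\<close>
  define A' where "A' = {x \<in> carrier G. (\<forall>u\<in>U. cj u x = x) \<and> x [^] p = \<one>}"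
  have A'G: "x \<in> carrier G" if "x \<in> A'" for x using that by (simp add: A'_def)
  have A'U: "x \<in> U" if "x \<in> A'" for x
    by (rule subsetD[OF N_U N_self]) (use that N_U in \<open>auto simp: A'_def\<close>)
  have A'c: "x \<otimes> y = y \<otimes> x" if "x \<in> A'" "y \<in> A'" for x y
  proof -
    have "cj y x = x" using that(1) A'U[OF that(2)] unfolding A'_def by blast
    then show ?thesis using cj_fix_iff[OF A'G[OF that(2)] A'G[OF that(1)]] by simp
  qed
  have A'sub: "subgroup A' G"
  proof (rule subgroupI)
    show "A' \<subseteq> carrier G" using A'G by blast
    show "A' \<noteq> {}" using U_carrier by (auto simp: A'_def intro!: exI[of _ \<one>])
    show "inv a \<in> A'" if "a \<in> A'" for a using that U_carrier by (auto simp: A'_def cj_inv int_pow_inv)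
    show "a \<otimes> b \<in> A'" if "a \<in> A'" "b \<in> A'" for a b
      using that A'c[OF that] U_carrier int_pow_mult_distrib[of a b p] by (auto simp: A'_def cj_mult)
  qed
  have EA': "e \<in> A'" if "e \<in> E" for e
    using that E_carrier E_pow D_U[OF E_D] by (auto simp: A'_def)
  define W where "W = adj {\<one>} w"
  have Wsub: "subgroup W G" "w \<in> W"
    unfolding W_def using adj_subgroup[OF triv_subgroup wG] wG by auto
  have Wpow: "x \<in> W \<Longrightarrow> \<exists>k::int. x = w [^] k" for x unfolding W_def adj_def using wG by auto
  have zW: "z \<notin> W"
  proof
    assume "z \<in> W"
    then obtain k where k: "z = w [^] (k::int)" using Wpow by blast
    have "\<not> p dvd k"
    proof
      assume "p dvd k"
      then have "w [^] k = w [^] (0::int)" by (intro E_pow_cong[OF w(1)]) simp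
      then show False using k z_neq by simp
    qed
    then obtain j where "k * j \<doteq> 1" by (rule prime_inverse)
    then have "w [^] (k * j) = w [^] (1::int)" by (rule E_pow_cong[OF w(1)])
    then have "z [^] j = w" unfolding k using wG by (simp add: int_pow_pow)
    then show False using w(2)[of j] by simp
  qed
  \<comment> \<open>The functional must vanish at \<open>w\<close>, so that the normalized product
    of \<open>w\<close> and \<open>z\<close> is exactly \<open>w\<close> (see \<open>Qz\<close>).
    This is compatible with \<epsilon>(z) = 1 because \<open>w\<close> is not a power of
    \<open>z\<close>.\<close>
  obtain \<epsilon> where \<epsilon>: "pchar A' \<epsilon>" "\<And>x. x \<in> W \<Longrightarrow> \<epsilon> x \<doteq> 0" "\<epsilon> z \<doteq> 1"
  proof (rule separation[OF A'sub Wsub(1)])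
    show "W \<subseteq> A'" using Wpow subgroup_int_pow[OF A'sub EA'[OF w(1)]] by blast
    show "commutator G a b \<in> W" if "a \<in> A'" "b \<in> A'" for a b
      using A'c[OF that] A'G[OF that(1)] A'G[OF that(2)] cj_fix_iff[of b a] subgroup.one_closed[OF Wsub(1)]
      by (simp add: commutator_eq_cj)
    show "y [^] p \<in> W" if "y \<in> A'" for y using that subgroup.one_closed[OF Wsub(1)] by (simp add: A'_def)
  qed (use EA'[OF z_E'] zW in auto)
  note E1E = E1_E[of _ w]
  have PA': "x \<in> A'" if "prod_el w a x" "x [^] p = \<one>" "a \<in> E" for a x
    using prod_el_U[OF w(1) that(3,1)] prod_elD(1)[OF that(1)] that(2) by (simp add: A'_def)
  have uniq: "x = x'" if x: "prod_el w a x" "x [^] p = \<one>" "\<epsilon> x \<doteq> 0" and x': "prod_el w a x'" "x' [^] p = \<one>" "\<epsilon> x' \<doteq> 0"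
    and a: "a \<in> E" for a x x'
  proof -
    note A = PA'[OF x(1,2) a] PA'[OF x'(1,2) a]
    show ?thesis
    proof (rule E_eq[OF A'sub \<epsilon>(1,3) EA'[OF z_E'] A A'c[OF A] x(2) x'(2)])
      show "\<epsilon> x \<doteq> \<epsilon> x'" using x(3) x'(3) by Groebner_Basis.algebra
      fix b assume b: "b \<in> carrier G"
      note t = \<tau>_E[OF w(1) a, of b]
      show "\<exists>y\<in>carrier G. cj b x = x \<otimes> y \<and> cj b x' = x' \<otimes> y"
        using prod_elD(2)[OF x(1) b] prod_elD(2)[OF x'(1) b] E_carrier[OF t]
          prod_el_comm[OF w(1) a x(1) E_U[OF t]] prod_el_comm[OF w(1) a x'(1) E_U[OF t]] by auto
    qed
  qed
  define Q where "Q a = (SOME x. prod_el w a x \<and> x [^] p = \<one> \<and> \<epsilon> x \<doteq> 0)" for a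
  have Q0: "prod_el w a (Q a) \<and> Q a [^] p = \<one> \<and> \<epsilon> (Q a) \<doteq> 0" if a: "a \<in> E1 w" for a
  proof -
    obtain x where x: "prod_el w a x" "x [^] p = \<one>" using a by (auto simp: E1_def)
    note xA = PA'[OF x E1E[OF a]]
    define k where "k = - \<epsilon> x"
    have zk: "z [^] k \<in> A'" by (rule EA'[OF z_E])
    have 1: "prod_el w a (x \<otimes> z [^] k)" by (rule prod_el_central[OF w(1) E1E[OF a] x(1)]) auto
    have 2: "(x \<otimes> z [^] k) [^] p = \<one>" using subgroup.m_closed[OF A'sub xA zk] by (simp add: A'_def)
    have "\<epsilon> (x \<otimes> z [^] k) \<doteq> \<epsilon> x + \<epsilon> (z [^] k)" by (rule pcharD[OF \<epsilon>(1) xA zk])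
    moreover have "\<epsilon> (z [^] k) \<doteq> k * \<epsilon> z" by (rule pchar_int_pow[OF A'sub \<epsilon>(1) EA'[OF z_E']])
    ultimately have "\<epsilon> (x \<otimes> z [^] k) \<doteq> 0" using \<epsilon>(3) unfolding k_def by Groebner_Basis.algebra
    with 1 2 have "prod_el w a (x \<otimes> z [^] k) \<and> (x \<otimes> z [^] k) [^] p = \<one> \<and> \<epsilon> (x \<otimes> z [^] k) \<doteq> 0"
      by blast
    then show ?thesis unfolding Q_def by (rule someI)
  qed
  have Q: "prod_el w a (Q a)" "Q a [^] p = \<one>" "\<epsilon> (Q a) \<doteq> 0" "Q a \<in> A'" if "a \<in> E1 w" for a
    using Q0[OF that] PA'[OF _ _ E1E[OF that]] by auto
  note E1m = subgroup.m_closed[OF E1_sub[OF w(1)]]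
  have Qm: "Q (a \<otimes> b) = Q a \<otimes> Q b" if ab: "a \<in> E1 w" "b \<in> E1 w" for a b
  proof -
    note m = E1m[OF ab]
    note n = subgroup.m_closed[OF A'sub Q(4)[OF ab(1)] Q(4)[OF ab(2)]]
    show ?thesis
    proof (rule uniq[OF Q(1-3)[OF m] _ _ _ E1E[OF m]])
      show "prod_el w (a \<otimes> b) (Q a \<otimes> Q b)"
        by (rule prod_el_mult[OF w(1) E1E[OF ab(1)] E1E[OF ab(2)] Q(1)[OF ab(1)] Q(1)[OF ab(2)]])
      show "(Q a \<otimes> Q b) [^] p = \<one>" using n by (simp add: A'_def)
      show "\<epsilon> (Q a \<otimes> Q b) \<doteq> 0"
        using pcharD[OF \<epsilon>(1) Q(4)[OF ab(1)] Q(4)[OF ab(2)]] Q(3)[OF ab(1)] Q(3)[OF ab(2)]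
        by Groebner_Basis.algebra
    qed
  qed
  have zE1: "z [^] (k::int) \<in> E1 w" for k by (rule subgroup_int_pow[OF E1_sub[OF w(1)] z_E1[OF w(1)]])
  have Qz: "Q (z [^] k) = w [^] k" for k :: int
  proof (rule uniq[OF Q(1-3)[OF zE1] _ _ _ z_E])
    show "prod_el w (z [^] k) (w [^] k)" by (rule prod_el_pow[OF w(1) z_E' prod_el_z[OF w(1)]])
    show "(w [^] k) [^] p = \<one>" by (rule E_pow[OF subgroup_int_pow[OF E_sub w(1)]])
    show "\<epsilon> (w [^] k) \<doteq> 0" by (rule \<epsilon>(2)[OF subgroup_int_pow[OF Wsub]])
  qed
  define f where "f b = inv c \<otimes> cj b c" for b
  have fE1: "f b \<in> E1 w" if "b \<in> carrier G" for b unfolding f_def by (rule c(3)[OF that])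
  have fE: "f b \<in> E" if "b \<in> carrier G" for b by (rule E1E[OF fE1[OF that]])
  have cjc: "cj b c = c \<otimes> f b" if "b \<in> carrier G" for b unfolding f_def using that c(1) by simp
  \<comment> \<open>Because \<open>E\<close> lies in \<open>M\<close>, the element \<open>c\<close>
    commutes with \<open>E\<close>; then the derivation of a product of elements of \<open>E\<close>
    is trivial at \<open>c\<close>, so \<open>c\<close> commutes with all \<open>Q a\<close> as
    well. This puts all values of \<delta> into one abelian subgroup.\<close>
  have cE: "cj c e = e" if "e \<in> E" for e
    using c(4)[OF E_M[OF that]] cj_eq_one_iff[OF E_carrier[OF that] c(1)] by simp
  have chc: "ch e c \<doteq> 0" if "e \<in> E" for e
    using cE[OF that] ch_zero_iff[OF E_D[OF that] c(1)] by simp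
  have cQ: "cj c (Q a) = Q a" if "a \<in> E1 w" for a
    using prod_elD(2)[OF Q(1)[OF that] c(1)] \<tau>_kill[OF w(1) E1E[OF that] chc[OF w(1)] chc[OF E1E[OF that]]] 
      A'G[OF Q(4)[OF that]] by simp
  define S where "S = insert c {x \<in> A'. cj c x = x}"
  obtain A where A: "subgroup A G" "S \<subseteq> A" "\<And>a b. a \<in> A \<Longrightarrow> b \<in> A \<Longrightarrow> a \<otimes> b = b \<otimes> a"
  proof (rule abelian_hull)
    show "S \<subseteq> carrier G" using A'G c by (auto simp: S_def)
    have "x \<otimes> c = c \<otimes> x" if "x \<in> A'" "cj c x = x" for x
      using cj_fix_iff[OF c(1) A'G[OF that(1)]] that(2) by simp
    then show "s \<otimes> t = t \<otimes> s" if "s \<in> S" "t \<in> S" for s t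
      using that A'c unfolding S_def by auto
  qed blast
  interpret H: comm_group "G\<lparr>carrier := A\<rparr>"
    by (rule group.group_comm_groupI[OF subgroup_imp_group[OF A(1)]]) (use A(3) in simp)
  have Hpow: "x [^]\<^bsub>G\<lparr>carrier := A\<rparr>\<^esub> (k::int) = x [^] k" if "x \<in> A" for x k
    using int_pow_consistent[OF A(1) that] by simp
  have cA: "c \<in> A" using A(2) by (auto simp: S_def)
  have EA: "e \<in> A" if "e \<in> E" for e using A(2) EA'[OF that] cE[OF that] by (auto simp: S_def)
  have QA: "Q a \<in> A" if "a \<in> E1 w" for a using A(2) Q(4)[OF that] cQ[OF that] by (auto simp: S_def)
  note Am = subgroup.m_closed[OF A(1)] and Ap = subgroup_int_pow[OF A(1)]
  let ?l = "ch w"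
  define \<delta> where "\<delta> b = c [^] ?l b \<otimes> Q (f b) \<otimes> f b [^] ?l b" for b
  have \<delta>A: "\<delta> b \<in> A" if "b \<in> carrier G" for b
    unfolding \<delta>_def by (intro Am Ap cA QA EA fE fE1 that)
  note AG = subgroup.mem_carrier[OF A(1)]
  have fm: "f (a \<otimes> b) = f a \<otimes> f b \<otimes> z [^] ch (f a) b" if ab: "a \<in> carrier G" "b \<in> carrier G" for a b
  proof -
    note fG = E_carrier[OF fE[OF ab(1)]] E_carrier[OF fE[OF ab(2)]]
    have "cj (a \<otimes> b) c = cj b (c \<otimes> f a)" using cjc[OF ab(1)] cj_cj[OF ab c(1)] by simp
    also have "\<dots> = c \<otimes> (f b \<otimes> f a) \<otimes> z [^] ch (f a) b"
      using ab c(1) fG ch[OF E_D[OF fE[OF ab(1)]] ab(2)] cjc[OF ab(2)] by (simp add: cj_mult m_assoc)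
    also have "f b \<otimes> f a = f a \<otimes> f b" by (rule E_comm[OF fE[OF ab(2)] fE[OF ab(1)]])
    finally show ?thesis unfolding f_def[of "a \<otimes> b"] using c(1) fG by (simp add: m_assoc)
  qed
  have \<delta>m: "\<delta> (a \<otimes> b) = cj b (\<delta> a) \<otimes> \<delta> b" if ab: "a \<in> carrier G" "b \<in> carrier G" for a b
  proof -
    note fG = E_carrier[OF fE[OF ab(1)]] E_carrier[OF fE[OF ab(2)]]
    note fA = EA[OF fE[OF ab(1)]] EA[OF fE[OF ab(2)]] and f1 = fE1[OF ab(1)] fE1[OF ab(2)]
    note QG = AG[OF QA[OF f1(1)]]
    let ?k = "ch (f a) b"
    note memA = cA EA[OF w(1)] EA[OF z_E'] fA QA[OF f1(1)] QA[OF f1(2)]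
    have l: "?l (a \<otimes> b) \<doteq> ?l a + ?l b" by (rule pcharD[OF ch_pchar[OF E_D[OF w(1)]] ab])
    have "Q (f (a \<otimes> b)) = Q (f a) \<otimes> Q (f b) \<otimes> w [^] ?k"
      unfolding fm[OF ab] by (simp only: Qm E1m f1 zE1 Qz)
    moreover have "c [^] ?l (a \<otimes> b) = c [^] (?l a + ?l b)" by (rule int_pow_cong[OF c(1,2) l])
    moreover have "f (a \<otimes> b) [^] ?l (a \<otimes> b) = (f a \<otimes> f b \<otimes> z [^] ?k) [^] (?l a + ?l b)"
      unfolding fm[OF ab, symmetric] by (rule E_pow_cong[OF fE[OF m_closed[OF ab]] l])
    ultimately have 1: "\<delta> (a \<otimes> b) = c [^] (?l a + ?l b) \<otimes> (Q (f a) \<otimes> Q (f b) \<otimes> w [^] ?k)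
        \<otimes> (f a \<otimes> f b \<otimes> z [^] ?k) [^] (?l a + ?l b)"
      unfolding \<delta>_def by simp
    have "cj b (\<delta> a) = (c \<otimes> f b) [^] ?l a \<otimes> (\<tau> w (f a) b \<otimes> Q (f a)) \<otimes> (f a \<otimes> z [^] ?k) [^] ?l a"
      unfolding \<delta>_def using ab c(1) fG QG cjc[OF ab(2)] prod_elD(2)[OF Q(1)[OF f1(1)] ab(2)]
        ch[OF E_D[OF fE[OF ab(1)]] ab(2)] by (simp add: cj_mult cj_int_pow)
    then have 2: "cj b (\<delta> a) \<otimes> \<delta> b = (c \<otimes> f b) [^] ?l a \<otimes>
        ((w [^] ?k \<otimes> f a [^] ?l b \<otimes> z [^] (?l b * ?k)) \<otimes> Q (f a)) \<otimes> (f a \<otimes> z [^] ?k) [^] ?l a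
        \<otimes> (c [^] ?l b \<otimes> Q (f b) \<otimes> f b [^] ?l b)"
      unfolding \<delta>_def[of b] \<tau>_def by simp
    have "c [^] (?l a + ?l b) \<otimes> (Q (f a) \<otimes> Q (f b) \<otimes> w [^] ?k) \<otimes> (f a \<otimes> f b \<otimes> z [^] ?k) [^] (?l a + ?l b)
      = (c \<otimes> f b) [^] ?l a \<otimes>
        ((w [^] ?k \<otimes> f a [^] ?l b \<otimes> z [^] (?l b * ?k)) \<otimes> Q (f a)) \<otimes> (f a \<otimes> z [^] ?k) [^] ?l a
        \<otimes> (c [^] ?l b \<otimes> Q (f b) \<otimes> f b [^] ?l b)"
      using H.leibniz_identity[of c w z "f a" "f b" "Q (f a)" "Q (f b)" "?l a" "?l b" ?k] memA
      by (simp add: Hpow Am Ap)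
    then show ?thesis unfolding 1 2 .
  qed
  \<comment> \<open>If \<open>b\<close> fixes \<open>w\<close> and [c,b] = z^j, then \<lambda>(b) =
    0 and only the middle factor Q(z^j) = w^j is left.\<close>
  have kill: "\<delta> b = w [^] (j::int)" if b: "b \<in> carrier G" "cj b w = w" "cj b c = c \<otimes> z [^] j" for b j
  proof -
    have fz: "f b = z [^] j" unfolding f_def that(3) using c(1) by simp
    have l: "?l b \<doteq> 0" using ch_zero_iff[OF E_D[OF w(1)] b(1)] b(2) by simp
    have "c [^] ?l b = c [^] (0::int)" "f b [^] ?l b = f b [^] (0::int)"
      using int_pow_cong[OF c(1,2) l] E_pow_cong[OF fE[OF b(1)] l] by auto
    then show ?thesis unfolding \<delta>_def fz Qz using wG by simp
  qed
  have "\<exists>x\<in>carrier G. \<forall>b\<in>carrier G. cj b x = \<delta> b \<otimes> x"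
  proof (rule derivation_inner[OF AG[OF \<delta>A] \<delta>m])
    fix a assume a: "a \<in> carrier G"
    note mem = cA QA[OF fE1[OF a]] EA[OF fE[OF a]]
    note memG = mem[THEN AG]
    have p: "((x \<otimes> y) [^] p) = x [^] p \<otimes> y [^] p" if "x \<in> A" "y \<in> A" for x y
      by (rule int_pow_mult_distrib[OF A(3)[OF that] AG[OF that(1)] AG[OF that(2)]])
    have q: "(x [^] ?l a) [^] p = \<one>" if "x \<in> carrier G" "x [^] p = \<one>" for x
    proof -
      have "(x [^] ?l a) [^] p = (x [^] p) [^] ?l a" using that(1) by (simp add: int_pow_pow mult.commute)
      then show ?thesis using that by simp
    qed
    have "\<delta> a [^] p = (c [^] ?l a) [^] p \<otimes> Q (f a) [^] p \<otimes> (f a [^] ?l a) [^] p"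
      unfolding \<delta>_def using mem by (simp add: p Am Ap)
    then show "\<delta> a [^] p = \<one>" using q c(1,2) memG E_pow[OF fE[OF a]] Q(2)[OF fE1[OF a]] by simp
    \<comment> \<open>The value lies in the abelian subgroup \<open>A\<close> together with
      \<open>w\<close> and \<open>c\<close>, so the previous formula applies with j = 0.\<close>
    have "cj (\<delta> a) x = x" if "x \<in> A" for x
      using cj_fix_iff[OF AG[OF \<delta>A[OF a]] AG[OF that]] A(3)[OF that \<delta>A[OF a]] by simp
    then show "\<delta> (\<delta> a) = \<one>" using kill[OF AG[OF \<delta>A[OF a]], of 0] EA[OF w(1)] cA c(1) by simp
  qed
  then obtain x where x: "x \<in> carrier G" "\<And>b. b \<in> carrier G \<Longrightarrow> cj b x = \<delta> b \<otimes> x" by blast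
  show ?thesis
  proof (rule that[OF x(1)])
    show "cj b x = x" if "b \<in> carrier G" "cj b c = c" "cj b w = w" for b
      using x kill[OF that(1,3), of 0] that c(1) by simp
    show "cj b x = w [^] j \<otimes> x" if "b \<in> carrier G" "cj b w = w" "cj b c = c \<otimes> z [^] j" for b and j :: int
      using x(2)[OF that(1)] kill[OF that] by simp
  qed
qed


section \<open>Commutators in <z> and \<open>p\<close>-th powers\<close>

lemma flip: assumes "x \<in> carrier G" "y \<in> carrier G" "cj x y = z [^] (i::int) \<otimes> y"
  shows "cj y x = z [^] (- i) \<otimes> x"
proof -
  have "y \<otimes> x = x \<otimes> (z [^] i \<otimes> y)" using cj_commute[OF assms(1,2)] assms(3) by simp
  also have "\<dots> = z [^] i \<otimes> (x \<otimes> y)" using z_comm[OF assms(1)] assms by (simp add: m_assoc[symmetric])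
  finally have 1: "y \<otimes> x = z [^] i \<otimes> (x \<otimes> y)" .
  have "y \<otimes> (z [^] (- i) \<otimes> x) = z [^] (- i) \<otimes> (y \<otimes> x)"
    using z_comm[OF assms(2), of "- i"] assms by (simp add: m_assoc[symmetric])
  also have "\<dots> = x \<otimes> y" unfolding 1 using assms by (simp add: int_pow_neg)
  also have "\<dots> = y \<otimes> cj y x" by (rule cj_commute[OF assms(2,1)])
  finally show ?thesis using assms by simp
qed

lemma conj_pow:
  assumes G: "v \<in> carrier G" "h \<in> carrier G" "e \<in> carrier G"
    and c: "cj v h = e \<otimes> h" and ve: "v \<otimes> e = e \<otimes> v"
  shows "cj (v [^] (i::int)) h = e [^] i \<otimes> h"
proof -
  have hv: "h \<otimes> v = v \<otimes> e \<otimes> h" using cj_commute[OF G(1,2)] c G by (simp add: m_assoc)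
  have "cj (inv h) v = v \<otimes> e" unfolding cj_def using G hv by (simp add: m_assoc)
  then have "cj (inv h) (v [^] i) = (v \<otimes> e) [^] i"
    using cj_int_pow[OF inv_closed[OF G(2)] G(1)] by (simp only:)
  also have "\<dots> = v [^] i \<otimes> e [^] i" by (rule int_pow_mult_distrib[OF ve G(1,3)])
  finally have "cj (inv h) (v [^] i) = v [^] i \<otimes> e [^] i" .
  then have "h \<otimes> v [^] i \<otimes> inv h = v [^] i \<otimes> e [^] i" unfolding cj_def using G by simp
  then have "h \<otimes> v [^] i = v [^] i \<otimes> e [^] i \<otimes> h" using G by (metis inv_solve_right int_pow_closed inv_closed inv_inv m_closed)
  then show ?thesis unfolding cj_def using G by (simp add: m_assoc)
qed

lemma class2_pow:
  assumes G: "h \<in> carrier G" "q \<in> carrier G" and c: "cj h q = z [^] (a::int) \<otimes> q"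
  shows "(h \<otimes> q) [^] (n::nat) = h [^] n \<otimes> q [^] n \<otimes> z [^] (a * int (n choose 2))"
proof (induction n)
  case 0 show ?case using G by (simp add: numeral_2_eq_2)
next
  case (Suc n)
  have "cj h (q [^] int n) = (z [^] a \<otimes> q) [^] int n" using G c by (simp only: cj_int_pow)
  also have "\<dots> = z [^] (a * int n) \<otimes> q [^] n"
    using int_pow_mult_distrib[OF z_comm[OF G(2), of a], of "int n"] G
    by (simp only: int_pow_pow[OF z_closed] int_pow_int[of G q n] int_pow_closed[OF z_closed])
  finally have "q [^] n \<otimes> h = h \<otimes> (z [^] (a * int n) \<otimes> q [^] n)" 
    using cj_commute[OF G(1), of "q [^] n"] G by (simp only: int_pow_int[of G q n] nat_pow_closed)
  also have "z [^] (a * int n) \<otimes> q [^] n = q [^] n \<otimes> z [^] (a * int n)" by (rule z_comm) (use G in simp)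
  finally have 1: "q [^] n \<otimes> h = h \<otimes> q [^] n \<otimes> z [^] (a * int n)" using G by (simp add: m_assoc)
  have "(h \<otimes> q) [^] Suc n = h [^] n \<otimes> q [^] n \<otimes> (z [^] (a * int (n choose 2)) \<otimes> (h \<otimes> q))"
    using Suc G by (simp add: m_assoc)
  also have "z [^] (a * int (n choose 2)) \<otimes> (h \<otimes> q) = (h \<otimes> q) \<otimes> z [^] (a * int (n choose 2))"
    by (rule z_comm) (use G in simp)
  also have "h [^] n \<otimes> q [^] n \<otimes> \<dots> = h [^] n \<otimes> (q [^] n \<otimes> h) \<otimes> q \<otimes> z [^] (a * int (n choose 2))"
    using G by (simp add: m_assoc)
  also have "\<dots> = h [^] Suc n \<otimes> q [^] n \<otimes> (z [^] (a * int n) \<otimes> q) \<otimes> z [^] (a * int (n choose 2))"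
    unfolding 1 using G by (simp add: m_assoc)
  also have "z [^] (a * int n) \<otimes> q = q \<otimes> z [^] (a * int n)" by (rule z_comm[OF G(2)])
  also have "h [^] Suc n \<otimes> q [^] n \<otimes> (q \<otimes> z [^] (a * int n)) \<otimes> z [^] (a * int (n choose 2))
    = h [^] Suc n \<otimes> q [^] Suc n \<otimes> (z [^] (a * int n + a * int (n choose 2)))"
    using G by (simp add: m_assoc int_pow_mult)
  also have "a * int n + a * int (n choose 2) = a * int (Suc n choose 2)"
    by (simp add: numeral_2_eq_2 distrib_left)
  finally show ?case .
qed

text \<open>The correction term is z^(a (p choose 2)), and an odd \<open>p\<close> divides (p choose
  2).\<close>

lemma class2_p_pow:
  assumes G: "h \<in> carrier G" "q \<in> carrier G" and c: "cj h q = z [^] (a::int) \<otimes> q"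
  shows "(h \<otimes> q) [^] p = h [^] p \<otimes> q [^] p"
proof -
  define n where "n = nat p"
  have p: "p = int n" using prime_gt_0_int[OF prime_p] by (simp add: n_def)
  have "odd n" using odd_p p by simp
  then obtain m where m: "n = 2 * m + 1" by (rule oddE)
  have "n choose 2 = n * m" using m by (simp add: choose_two)
  then have "a * int (n choose 2) = p * (a * int m)" using p by simp
  then have "z [^] (a * int (n choose 2)) = (z [^] p) [^] (a * int m)"
    by (simp only: int_pow_pow[OF z_closed])
  then have "z [^] (a * int (n choose 2)) = \<one>" by (simp only: z_pow int_pow_one)
  then have "(h \<otimes> q) [^] n = h [^] n \<otimes> q [^] n" using class2_pow[OF assms, of n] G by simp
  then show ?thesis unfolding p by (simp only: int_pow_int)
qed

lemma pow_p_central: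
  assumes x: "x \<in> carrier G" and e: "\<And>b. b \<in> carrier G \<Longrightarrow> \<exists>e\<in>E. cj b x = e \<otimes> x \<and> e \<otimes> x = x \<otimes> e"
    and b: "b \<in> carrier G"
  shows "cj b (x [^] p) = x [^] p"
proof -
  obtain e where e: "e \<in> E" "cj b x = e \<otimes> x" "e \<otimes> x = x \<otimes> e" using e[OF b] by blast
  have "cj b (x [^] p) = (e \<otimes> x) [^] p" using b x e by (simp add: cj_int_pow)
  also have "\<dots> = e [^] p \<otimes> x [^] p" by (rule int_pow_mult_distrib[OF e(3) E_carrier[OF e(1)] x])
  finally show ?thesis using E_pow[OF e(1)] x by simp
qed

section \<open>Centralizers of subgroups of \<open>E\<close>, and subgroups on which the commutator
  forms vanish\<close>

definition cz :: "'a set \<Rightarrow> 'a set" where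
  "cz V = {g \<in> carrier G. \<forall>e\<in>V. cj g e = e}"

lemma cz_carrier: "g \<in> cz V \<Longrightarrow> g \<in> carrier G" by (simp add: cz_def)
lemma czD: "g \<in> cz V \<Longrightarrow> e \<in> V \<Longrightarrow> cj g e = e" by (simp add: cz_def)

lemma cj_inv_fix: "g \<in> carrier G \<Longrightarrow> x \<in> carrier G \<Longrightarrow> cj g x = x \<Longrightarrow> cj (inv g) x = x"
  using cj_cj[of g "inv g" x] by simp

lemma cz_sub: "V \<subseteq> carrier G \<Longrightarrow> subgroup (cz V) G"
proof (rule subgroupI)
  assume V: "V \<subseteq> carrier G"
  show "cz V \<subseteq> carrier G" by (auto simp: cz_def)
  show "cz V \<noteq> {}" using V by (auto simp: cz_def subset_iff intro!: exI[of _ \<one>])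
  show "inv a \<in> cz V" if "a \<in> cz V" for a
    using that V by (auto simp: cz_def subset_iff intro!: cj_inv_fix)
  show "a \<otimes> b \<in> cz V" if "a \<in> cz V" "b \<in> cz V" for a b
    using that V by (auto simp: cz_def subset_iff cj_cj[symmetric])
qed

lemma U_cz: "V \<subseteq> D \<Longrightarrow> U \<subseteq> cz V"
  using D_U U_carrier by (auto simp: cz_def)

lemma E_subset: "E \<subseteq> carrier G" using E_carrier by blast
lemma E1_subset: "E1 w \<subseteq> E" using E1_E by blast

definition central :: "'a \<Rightarrow> bool" where
  "central r \<longleftrightarrow> r \<in> carrier G \<and> (\<forall>g\<in>carrier G. cj g r = r)"

lemma centralD: "central r \<Longrightarrow> r \<in> carrier G" "central r \<Longrightarrow> g \<in> carrier G \<Longrightarrow> cj g r = r"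
  by (auto simp: central_def)

lemma central_comm: "central r \<Longrightarrow> g \<in> carrier G \<Longrightarrow> r \<otimes> g = g \<otimes> r"
  using cj_fix_iff[of g r] by (auto simp: central_def)

lemma central_cj: "central r \<Longrightarrow> g \<in> carrier G \<Longrightarrow> cj r g = g"
  using cj_eq_one_iff[of r g] by (auto simp: central_def)

lemma central_inv: "central r \<Longrightarrow> central (inv r)"
  by (auto simp: central_def cj_inv)

lemma central_in_D: "central r \<Longrightarrow> r \<in> D"
  by (rule central_D) (auto simp: central_def)

lemma ch_central: "central r \<Longrightarrow> b \<in> carrier G \<Longrightarrow> ch r b \<doteq> 0"
  using ch_zero_iff[OF central_in_D] by (auto simp: central_def)

lemma central_power': 
  assumes "central u" "central v" "\<And>r. central r \<Longrightarrow> r [^] p \<noteq> u"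
  shows "\<exists>i::int. \<exists>r. central r \<and> r [^] p = v \<otimes> u [^] i"
  using central_power[of u v] assms unfolding central_def by blast

text \<open>The group V Z(G) has the same centralizer as \<open>V\<close> and equals its double
  centralizer in \<open>D\<close>. An element of \<open>D\<close> whose character vanishes on this
  centralizer thus lies in V Z(G), and its central factor does not change the character.\<close>

lemma realize_cz:
  assumes V: "subgroup V G" "V \<subseteq> E" and f: "pchar (carrier G) f" "\<And>j. j \<in> cz V \<Longrightarrow> f j \<doteq> 0"
  shows "\<exists>e\<in>V. \<forall>b\<in>carrier G. ch e b \<doteq> f b"
proof -
  have VD: "v \<in> D" and VG: "v \<in> carrier G" if "v \<in> V" for v using that V E_D D_carrier by auto
  obtain d where d: "d \<in> D" "\<And>b. b \<in> carrier G \<Longrightarrow> ch d b \<doteq> f b" using D_realize[OF f(1)] by blast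
  define D0 where "D0 = {v \<otimes> r | v r. v \<in> V \<and> central r}"
  have D0I: "v \<otimes> r \<in> D0" if "v \<in> V" "central r" for v r using that by (auto simp: D0_def)
  have one: "central \<one>" by (simp add: central_def)
  have V1: "v \<in> D0" if "v \<in> V" for v using D0I[OF that one] VG[OF that] by simp
  have Z1: "r \<in> D0" if "central r" for r using D0I[OF subgroup.one_closed[OF V(1)] that] centralD[OF that] by simp
  have D0s: "subgroup D0 G"
  proof (rule subgroupI)
    show "D0 \<subseteq> carrier G" using VG centralD by (auto simp: D0_def)
    show "D0 \<noteq> {}" using Z1[OF one] by blast
    show "inv a \<in> D0" if aD: "a \<in> D0" for a
    proof -
      obtain v r where a: "a = v \<otimes> r" "v \<in> V" "central r" using aD by (auto simp: D0_def)
      have "inv a = inv v \<otimes> inv r" unfolding a(1) using VG[OF a(2)] centralD[OF a(3)] 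
          central_comm[OF central_inv[OF a(3)], of "inv v"] by (simp add: inv_mult_group)
      then show ?thesis using D0I[OF subgroup.m_inv_closed[OF V(1) a(2)] central_inv[OF a(3)]] by simp
    qed
    show "a \<otimes> b \<in> D0" if aD: "a \<in> D0" "b \<in> D0" for a b
    proof -
      obtain v r where a: "a = v \<otimes> r" "v \<in> V" "central r" using aD(1) by (auto simp: D0_def)
      obtain v' r' where b: "b = v' \<otimes> r'" "v' \<in> V" "central r'" using aD(2) by (auto simp: D0_def)
      note G = VG[OF a(2)] VG[OF b(2)] centralD(1)[OF a(3)] centralD(1)[OF b(3)]
      have "a \<otimes> b = v \<otimes> (r \<otimes> v') \<otimes> r'" unfolding a(1) b(1) using G by (simp add: m_assoc)
      also have "\<dots> = (v \<otimes> v') \<otimes> (r \<otimes> r')" unfolding central_comm[OF a(3) G(2)] using G by (simp add: m_assoc)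
      finally have 1: "a \<otimes> b = (v \<otimes> v') \<otimes> (r \<otimes> r')" .
      have "central (r \<otimes> r')" using a(3) b(3) by (auto simp: central_def cj_mult)
      then show ?thesis unfolding 1 by (rule D0I[OF subgroup.m_closed[OF V(1) a(2) b(2)]])
    qed
  qed
  have D0D: "D0 \<subseteq> D" using VD central_in_D D_mult by (auto simp: D0_def)
  have D0Z: "x \<in> D0" if "x \<in> carrier G" "\<And>g. g \<in> carrier G \<Longrightarrow> cj g x = x" for x
    by (rule Z1) (use that in \<open>auto simp: central_def\<close>)
  have D0c: "cj g d = d" if g: "g \<in> carrier G" "\<And>e. e \<in> D0 \<Longrightarrow> cj g e = e" for g
  proof -
    have "g \<in> cz V" using g V1 by (auto simp: cz_def)
    then have "ch d g \<doteq> 0" using d(2)[OF g(1)] f(2)[of g] by Groebner_Basis.algebra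
    then show ?thesis using ch_zero_iff[OF d(1) g(1)] by simp
  qed
  have "d \<in> D0" by (rule D_double_centralizer[OF D0s D0D D0Z d(1) D0c])
  then obtain v r where vr: "d = v \<otimes> r" "v \<in> V" "central r" by (auto simp: D0_def)
  have "ch v b \<doteq> f b" if b: "b \<in> carrier G" for b
    using d(2)[OF b] ch_mult_cong[OF VD[OF vr(2)] central_in_D[OF vr(3)] b] ch_central[OF vr(3) b]
    unfolding vr(1) by Groebner_Basis.algebra
  then show ?thesis using vr(2) by blast
qed

text \<open>With \<open>J\<close> the centralizer of \<open>V\<close> the realization condition of
  \<open>quad_element\<close> is automatic; what remains to be checked is that the form vanishes on
  this centralizer.\<close>

lemma quad_element_cz:
  assumes \<eta>: "rchar \<eta>" and V: "subgroup V G" "V \<subseteq> E" "z \<in> V" "\<And>e. e \<in> E \<Longrightarrow> \<eta> e \<doteq> 0"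
    and JJ: "\<And>a b. a \<in> cz V \<Longrightarrow> b \<in> cz V \<Longrightarrow> \<eta> (commutator G a b) \<doteq> 0"
  obtains x where "x \<in> carrier G" "\<And>b. b \<in> carrier G \<Longrightarrow> \<exists>e\<in>V. cj b x = e \<otimes> x"
    "\<And>u. u \<in> U \<Longrightarrow> cj u x = z [^] \<eta> u \<otimes> x"
proof (rule quad_element[OF \<eta> cz_sub U_cz JJ V(1,2,3)])
  show "V \<subseteq> carrier G" "V \<subseteq> D" using V(2) E_carrier E_D by auto
  show "\<eta> e \<doteq> 0" if "e \<in> V" for e using V(2,4) that by blast
  show "\<exists>e\<in>V. \<forall>b\<in>carrier G. ch e b \<doteq> f b" if "pchar (carrier G) f" "\<And>j. j \<in> cz V \<Longrightarrow> f j \<doteq> 0" for f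
    by (rule realize_cz[OF V(1,2) that])
qed (use that in blast)+

text \<open>The character \<open>ch d\<close> embeds J/C_J(d) into the integers modulo
  \<open>p\<close>.\<close>

lemma cyclic_over_centralizer:
  assumes J: "subgroup J G" and d: "d \<in> D"
  obtains v0 where "v0 \<in> J" "\<And>v. v \<in> J \<Longrightarrow> \<exists>i::int. \<exists>u\<in>J. cj u d = d \<and> v = v0 [^] i \<otimes> u"
proof (cases "\<exists>v\<in>J. \<not> p dvd ch d v")
  case False
  show ?thesis
  proof (rule that[of \<one>])
    show "\<one> \<in> J" by (rule subgroup.one_closed[OF J])
    fix v assume v: "v \<in> J"
    note vG = subgroup.mem_carrier[OF J v]
    have "ch d v \<doteq> 0" using False v by simp
    then have "cj v d = d" using ch_zero_iff[OF d vG] by simp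
    then show "\<exists>i::int. \<exists>u\<in>J. cj u d = d \<and> v = \<one> [^] i \<otimes> u" using v vG by (intro exI[of _ 0]) auto
  qed
next
  case True
  then obtain v0 where v0: "v0 \<in> J" "\<not> p dvd ch d v0" by blast
  then obtain j where j: "ch d v0 * j \<doteq> 1" using prime_inverse by blast
  note v0G = subgroup.mem_carrier[OF J v0(1)]
  show ?thesis
  proof (rule that[OF v0(1)])
    fix v assume v: "v \<in> J"
    note vG = subgroup.mem_carrier[OF J v]
    define i where "i = j * ch d v"
    have u: "v0 [^] (- i) \<otimes> v \<in> J" by (rule subgroup.m_closed[OF J subgroup_int_pow[OF J v0(1)] v])
    have "ch d (v0 [^] (- i) \<otimes> v) \<doteq> ch d (v0 [^] (- i)) + ch d v"
      by (rule pcharD[OF ch_pchar[OF d]]) (use v0G vG in auto)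
    moreover have "ch d (v0 [^] (- i)) \<doteq> - i * ch d v0" by (rule pchar_int_pow[OF carrier_sub ch_pchar[OF d] v0G])
    ultimately have "ch d (v0 [^] (- i) \<otimes> v) \<doteq> 0" using j unfolding i_def by Groebner_Basis.algebra
    then have "cj (v0 [^] (- i) \<otimes> v) d = d" using ch_zero_iff[OF d subgroup.mem_carrier[OF J u]] by simp
    moreover have "v = v0 [^] i \<otimes> (v0 [^] (- i) \<otimes> v)" using v0G vG by (simp add: int_pow_neg)
    ultimately show "\<exists>i::int. \<exists>u\<in>J. cj u d = d \<and> v = v0 [^] i \<otimes> u" using u by blast
  qed
qed

lemma om_self: "rchar \<eta> \<Longrightarrow> a \<in> carrier G \<Longrightarrow> \<eta> (commutator G a a) \<doteq> 0"
proof -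
  assume "rchar \<eta>" "a \<in> carrier G"
  moreover from this have "commutator G a a = \<one>" by (simp add: commutator_def m_assoc)
  ultimately show ?thesis using pchar_one[OF U_sub] by (simp add: rchar_def)
qed

lemma om_flip: assumes "rchar \<eta>" "a \<in> carrier G" "b \<in> carrier G"
  shows "\<eta> (commutator G b a) \<doteq> - \<eta> (commutator G a b)"
proof -
  have "commutator G b a = inv (commutator G a b)" using assms by (simp add: commutator_def inv_mult_group m_assoc)
  then show ?thesis using pchar_inv[OF U_sub _ U_comm[OF assms(2,3)]] assms(1) by (simp add: rchar_def)
qed

text \<open>An alternating form survives a cyclic extension: if it vanishes on a set and between
  this set and \<open>v\<close>, then adding powers of \<open>v\<close> keeps it zero. So it
  suffices to show that certain quotients of centralizers are cyclic.\<close>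

lemma om_cyc:
  assumes \<eta>: "rchar \<eta>" and G: "v \<in> carrier G" "u \<in> carrier G" "u' \<in> carrier G"
    and o: "\<eta> (commutator G u v) \<doteq> 0" "\<eta> (commutator G u' v) \<doteq> 0" "\<eta> (commutator G u u') \<doteq> 0"
  shows "\<eta> (commutator G (v [^] (i::int) \<otimes> u) (v [^] (j::int) \<otimes> u')) \<doteq> 0"
proof -
  have l: "\<eta> (commutator G (v [^] i \<otimes> u) g) \<doteq> i * \<eta> (commutator G v g) + \<eta> (commutator G u g)" if g: "g \<in> carrier G" for g
    using pcharD[OF om_left[OF \<eta> g], of "v [^] i" u] pchar_int_pow[OF carrier_sub om_left[OF \<eta> g] G(1), of i] G
    by simp Groebner_Basis.algebra
  have r: "\<eta> (commutator G g (v [^] j \<otimes> u')) \<doteq> j * \<eta> (commutator G g v) + \<eta> (commutator G g u')" if g: "g \<in> carrier G" for g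
    using pcharD[OF om_right[OF \<eta> g], of "v [^] j" u'] pchar_int_pow[OF carrier_sub om_right[OF \<eta> g] G(1), of j] G
    by simp Groebner_Basis.algebra
  have vG: "v [^] j \<otimes> u' \<in> carrier G" using G by simp
  show ?thesis
    using l[OF vG] r[OF G(1)] r[OF G(2)] o om_self[OF \<eta> G(1)] om_flip[OF \<eta> G(3,1)]
    by Groebner_Basis.algebra
qed

lemma rchar_exists:
  assumes V: "subgroup V G" "R \<subseteq> V" "V \<subseteq> U" and x: "x \<in> U" "x \<notin> V"
  obtains \<eta> where "rchar \<eta>" "\<And>v. v \<in> V \<Longrightarrow> \<eta> v \<doteq> 0" "\<eta> x \<doteq> 1"
proof -
  have c: "commutator G a b \<in> V" if "a \<in> U" "b \<in> U" for a b using U_central[OF that(1) U_carrier[OF that(2)]] V(2) by blast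
  have q: "y [^] p \<in> V" if "y \<in> U" for y using R_pow[OF U_carrier[OF that]] V(2) by blast
  obtain f where f: "pchar U f" "\<And>x. x \<in> V \<Longrightarrow> f x \<doteq> 0" "f x \<doteq> 1"
    using separation[OF U_sub V(1,3) c q x] by blast
  have "rchar f" using f(1) f(2)[OF subsetD[OF V(2)]] by (simp add: rchar_def)
  then show ?thesis using that f(2,3) by blast
qed

text \<open>On a space of dimension at most 2 an alternating form is determined by one value. If the
  form is zero, \<theta> kills all commutators and \<open>R\<close>, which generate
  \<open>U\<close>.\<close>

lemma rchar_zero_if_two_generated:
  assumes \<theta>: "rchar \<theta>" and G: "b \<in> carrier G" "v \<in> carrier G"
    and gen: "\<And>g. g \<in> carrier G \<Longrightarrow> \<exists>(i::int) (j::int). \<exists>u\<in>U. g = b [^] i \<otimes> (v [^] j \<otimes> u)"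
    and vb: "\<theta> (commutator G v b) \<doteq> 0" and u: "u \<in> U"
  shows "\<theta> u \<doteq> 0"
proof (rule U_gen[OF _ _ _ u])
  show "pchar U \<theta>" using \<theta> by (simp add: rchar_def)
  show "\<theta> r \<doteq> 0" if "r \<in> R" for r using \<theta> that by (simp only: rchar_def)
  have lin: "f g \<doteq> 0" if f: "pchar (carrier G) f" "f b \<doteq> 0" "f v \<doteq> 0" and g: "g \<in> carrier G" for f g
  proof -
    obtain i j :: int and u where e: "g = b [^] i \<otimes> (v [^] j \<otimes> u)" "u \<in> U" using gen[OF g] by blast
    note uG = U_carrier[OF e(2)]
    have "f g \<doteq> f (b [^] i) + f (v [^] j \<otimes> u)" unfolding e(1) by (rule pcharD[OF f(1)]) (use G uG in auto)
    moreover have "f (v [^] j \<otimes> u) \<doteq> f (v [^] j) + f u" by (rule pcharD[OF f(1)]) (use G uG in auto)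
    moreover note pchar_int_pow[OF carrier_sub f(1) G(1), of i] pchar_int_pow[OF carrier_sub f(1) G(2), of j] U_char[OF f(1) e(2)]
    ultimately show ?thesis using f(2,3) by Groebner_Basis.algebra
  qed
  have bv: "\<theta> (commutator G b v) \<doteq> 0" using om_flip[OF \<theta> G(2,1)] vb by Groebner_Basis.algebra
  fix g h assume gh: "g \<in> carrier G" "h \<in> carrier G"
  have "\<theta> (commutator G g b) \<doteq> 0"
    by (rule lin[OF om_left[OF \<theta> G(1)] om_self[OF \<theta> G(1)] vb gh(1)])
  moreover have "\<theta> (commutator G g v) \<doteq> 0"
    by (rule lin[OF om_left[OF \<theta> G(2)] bv om_self[OF \<theta> G(2)] gh(1)])
  ultimately show "\<theta> (commutator G g h) \<doteq> 0" by (rule lin[OF om_right[OF \<theta> gh(1)] _ _ gh(2)])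
qed

lemma noncentral_pow_neq: assumes w: "w \<in> E" "\<And>k::int. w \<noteq> z [^] k" and j: "\<not> p dvd j" shows "w [^] j \<noteq> z [^] (i::int)"
proof
  assume eq: "w [^] j = z [^] i"
  obtain k where k: "j * k \<doteq> 1" by (rule prime_inverse[OF j])
  have "w [^] (j * k) = w [^] (1::int)" by (rule E_pow_cong[OF w(1) k])
  then have "w = (w [^] j) [^] k" using E_carrier[OF w(1)] by (simp add: int_pow_pow)
  then show False using w(2)[of "i * k"] unfolding eq by (simp add: int_pow_pow)
qed

text \<open>All \<open>p\<close>-th powers of elements of \<open>D\<close> are central. If the
  \<open>p\<close>-th power of \<open>d\<close> has a central \<open>p\<close>-th root r, then d
  r^(-1) lies in \<open>E\<close>; since Z(G)/Z(G)^p has order \<open>p\<close>, one further element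
  \<open>s\<close> accounts for all the others.\<close>

lemma split_D:
  obtains s where "s \<in> D" "s = \<one> \<or> (\<forall>r. central r \<longrightarrow> r [^] p \<noteq> s [^] p)"
    "\<And>d. d \<in> D \<Longrightarrow> \<exists>(i::int) e r. e \<in> E \<and> central r \<and> d = s [^] i \<otimes> (e \<otimes> r)"
proof -
  have pc: "central (d [^] p)" if d: "d \<in> D" for d
  proof -
    note dG = D_carrier[OF d]
    have "cj b (d [^] p) = d [^] p" if b: "b \<in> carrier G" for b
      by (rule pow_p_central[OF dG _ b]) (use ch[OF d] z_E z_comm[OF dG] in metis)
    then show ?thesis using dG by (simp add: central_def)
  qed
  have main: "\<exists>(i::int) e r. e \<in> E \<and> central r \<and> d = s [^] i \<otimes> (e \<otimes> r)"
    if s: "s \<in> D" and d: "d \<in> D" and r: "central r" "r [^] p = d [^] p \<otimes> (s [^] p) [^] (i::int)" for s d r i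
  proof -
    note G = D_carrier[OF s] D_carrier[OF d] centralD(1)[OF r(1)]
    have si: "s [^] i \<in> D" by (rule D_pow[OF s])
    define e where "e = d \<otimes> s [^] i \<otimes> inv r"
    have ds: "d \<otimes> s [^] i \<in> D" by (rule D_mult[OF d si])
    have eD: "e \<in> D" unfolding e_def by (rule D_mult[OF ds central_in_D[OF central_inv[OF r(1)]]])
    have "e [^] p = (d \<otimes> s [^] i) [^] p \<otimes> (inv r) [^] p"
      unfolding e_def using G central_comm[OF central_inv[OF r(1)], of "d \<otimes> s [^] i"]
      by (intro int_pow_mult_distrib) auto
    also have "(d \<otimes> s [^] i) [^] p = d [^] p \<otimes> (s [^] i) [^] p"
      by (rule int_pow_mult_distrib[OF D_comm[OF d si]]) (use G in auto)
    also have "(s [^] i) [^] p = (s [^] p) [^] i" using G by (simp add: int_pow_pow mult.commute)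
    finally have "e [^] p = \<one>" using r(2) G by (simp add: int_pow_inv)
    then have "e \<in> E" using eD by (simp add: E_def)
    moreover have "d = s [^] (- i) \<otimes> (e \<otimes> r)"
      unfolding e_def using G D_comm[OF d si] by (simp add: m_assoc int_pow_neg)
    ultimately show ?thesis using r(1) by blast
  qed
  show ?thesis
  proof (cases "\<exists>s\<in>D. \<forall>r. central r \<longrightarrow> r [^] p \<noteq> s [^] p")
    case True
    then obtain s where s: "s \<in> D" "\<And>r. central r \<Longrightarrow> r [^] p \<noteq> s [^] p" by blast
    show ?thesis
    proof (rule that[OF s(1)])
      fix d assume d: "d \<in> D"
      obtain i r where "central r" "r [^] p = d [^] p \<otimes> (s [^] p) [^] (i::int)"
        using central_power'[OF pc[OF s(1)] pc[OF d] s(2)] by blast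
      then show "\<exists>(i::int) e r. e \<in> E \<and> central r \<and> d = s [^] i \<otimes> (e \<otimes> r)" by (rule main[OF s(1) d])
    qed (use s(2) in blast)
  next
    case False
    have oD: "\<one> \<in> D" by (rule subgroup.one_closed[OF D_sub])
    show ?thesis
    proof (rule that[OF oD])
      fix d assume d: "d \<in> D"
      obtain r where "central r" "r [^] p = d [^] p" using False d by blast
      then show "\<exists>(i::int) e r. e \<in> E \<and> central r \<and> d = \<one> [^] i \<otimes> (e \<otimes> r)"
        using main[OF oD d, of r 0] D_carrier[OF d] by simp
    qed simp
  qed
qed


section \<open>The choice of the elements\<close>

lemma z_pow_one: "i \<doteq> 0 \<Longrightarrow> z [^] i = \<one>"
  using z_cong[of i 0] by simp

lemma pow_fix: assumes "x \<in> carrier G" "y \<in> carrier G" "cj y x = x" shows "cj (y [^] (k::int)) x = x"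
proof -
  have "cj x y = y" using cj_eq_one_iff[OF assms(2,1)] assms(3) by simp
  then have "cj x (y [^] k) = y [^] k" using assms by (simp add: cj_int_pow)
  then show ?thesis using cj_eq_one_iff[of x "y [^] k"] assms by simp
qed

lemma N_fix:
  assumes y: "y \<in> N" "y \<notin> M" and x: "x \<in> carrier G" "cj y x = x" "\<And>m. m \<in> M \<Longrightarrow> cj m x = x" and n: "n \<in> N"
  shows "cj n x = x"
proof -
  obtain k m where n: "n = y [^] (k::int) \<otimes> m" "m \<in> M" using N_M[OF y n] by blast
  have "cj n x = cj m (cj (y [^] k) x)" unfolding n(1) using N_carrier[OF y(1)] M_carrier[OF n(2)] x(1) by (simp add: cj_cj)
  then show ?thesis using pow_fix[OF x(1) N_carrier[OF y(1)] x(2)] x(3)[OF n(2)] by simp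
qed

text \<open>The case \<open>s = \<one>\<close> is exactly D = E Z(G); otherwise \<open>s\<close> has
  a \<open>p\<close>-th power that can repair the order of other elements.\<close>

definition splits :: "'a \<Rightarrow> bool" where
  "splits s \<longleftrightarrow> s \<in> D \<and> (s = \<one> \<or> (\<forall>r. central r \<longrightarrow> r [^] p \<noteq> s [^] p)) \<and>
    (\<forall>d\<in>D. \<exists>(i::int) e r. e \<in> E \<and> central r \<and> d = s [^] i \<otimes> (e \<otimes> r))"

lemma splits_exists: obtains s where "splits s"
  by (rule split_D) (use that in \<open>auto simp: splits_def\<close>)

lemma splits_U: assumes s: "splits s" and u: "u \<in> carrier G" "cj u s = s" "\<And>e. e \<in> E \<Longrightarrow> cj u e = e"
  shows "u \<in> U"
proof (rule C_D[OF u(1)])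
  fix d assume "d \<in> D"
  then obtain i e r where d: "d = s [^] (i::int) \<otimes> (e \<otimes> r)" "e \<in> E" "central r" using s unfolding splits_def by blast
  have sG: "s \<in> carrier G" using s D_carrier by (auto simp: splits_def)
  note G = sG E_carrier[OF d(2)] centralD(1)[OF d(3)]
  show "cj u d = d" unfolding d(1) using G u(1) u(2) u(3)[OF d(2)] centralD(2)[OF d(3) u(1)]
    by (simp add: cj_mult cj_int_pow)
qed

text \<open>An element that centralizes both \<open>E\<close> and \<open>s\<close> centralizes
  \<open>D\<close>, hence lies in \<open>U\<close>; so \<open>ch s\<close> embeds C_G(E)/U into the
  integers modulo \<open>p\<close>.\<close>

lemma cz_E_cyclic:
  assumes s: "splits s"
  obtains v0 where "v0 \<in> cz E" "\<And>v. v \<in> cz E \<Longrightarrow> \<exists>i::int. \<exists>u\<in>U. v = v0 [^] i \<otimes> u"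
proof -
  have sD: "s \<in> D" using s by (simp add: splits_def)
  obtain v0 where v0: "v0 \<in> cz E" "\<And>v. v \<in> cz E \<Longrightarrow> \<exists>i::int. \<exists>u\<in>cz E. cj u s = s \<and> v = v0 [^] i \<otimes> u"
    using cyclic_over_centralizer[OF cz_sub[OF E_subset] sD] by blast
  have "u \<in> U" if "u \<in> cz E" "cj u s = s" for u
    by (rule splits_U[OF s cz_carrier[OF that(1)] that(2) czD[OF that(1)]])
  then show ?thesis using that v0 by meson
qed

lemma om_cz_E:
  assumes \<eta>: "rchar \<eta>" and ab: "a \<in> cz E" "b \<in> cz E" shows "\<eta> (commutator G a b) \<doteq> 0"
proof -
  obtain s where s: "splits s" by (rule splits_exists)
  obtain v0 where v0: "v0 \<in> cz E" "\<And>v. v \<in> cz E \<Longrightarrow> \<exists>i::int. \<exists>u\<in>U. v = v0 [^] i \<otimes> u"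
    using cz_E_cyclic[OF s] by blast
  obtain i u where a: "a = v0 [^] (i::int) \<otimes> u" "u \<in> U" using v0(2)[OF ab(1)] by blast
  obtain j u' where b: "b = v0 [^] (j::int) \<otimes> u'" "u' \<in> U" using v0(2)[OF ab(2)] by blast
  note vG = cz_carrier[OF v0(1)]
  show ?thesis unfolding a(1) b(1)
    by (rule om_cyc[OF \<eta> vG U_carrier[OF a(2)] U_carrier[OF b(2)]
        om_U(1)[OF \<eta> vG a(2)] om_U(1)[OF \<eta> vG b(2)] om_U(1)[OF \<eta> U_carrier[OF b(2)] a(2)]])
qed

lemma quad_element_E:
  assumes \<eta>: "rchar \<eta>" "\<And>e. e \<in> E \<Longrightarrow> \<eta> e \<doteq> 0"
  shows "\<exists>x\<in>carrier G. (\<forall>b\<in>carrier G. \<exists>e\<in>E. cj b x = e \<otimes> x) \<and> (\<forall>u\<in>U. cj u x = z [^] \<eta> u \<otimes> x)"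
  by (rule quad_element_cz[OF \<eta>(1) E_sub order_refl z_E' \<eta>(2) om_cz_E[OF \<eta>(1)]]) auto

lemma not_fixed: assumes "x \<in> carrier G" "k \<doteq> 1" "cj u x = z [^] k \<otimes> x" shows "cj u x \<noteq> x"
proof
  assume "cj u x = x"
  then have "z [^] k = \<one>" using assms(1,3) r_cancel_one[OF assms(1) int_pow_closed[OF z_closed], of k] by simp
  then have "z [^] k = z [^] (0::int)" by simp
  then have "k \<doteq> 0" by (simp only: z_cong)
  with assms(2) have "p dvd 1" by Groebner_Basis.algebra
  then show False using prime_p by auto
qed

text \<open>Suppose Z(N) lies in \<open>M\<close>. Then \<open>c\<close> centralizes
  \<open>D\<close>, so \<open>c\<close> is in \<open>U\<close>; it is not in \<open>N\<close>, since
  there it would be in Z(N). A character of U/N that is nonzero at \<open>c\<close> yields an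
  element of Z(N) that \<open>c\<close> moves, although that element lies in
  \<open>M\<close>.\<close>

lemma center_N_not_M:
  assumes c: "c \<in> carrier G" "\<And>m. m \<in> M \<Longrightarrow> cj m c = c" "c \<notin> M"
  obtains y where "y \<in> N" "y \<notin> M" "\<And>n. n \<in> N \<Longrightarrow> cj n y = y"
proof (rule ccontr)
  note T = that
  assume nt: "\<not> thesis"
  have H: "y \<in> M" if "y \<in> N" "\<And>n. n \<in> N \<Longrightarrow> cj n y = y" for y
    using T[OF that(1) _ that(2)] nt by blast
  have DM: "d \<in> M" if "d \<in> D" for d
    by (rule H[OF D_N[OF that] D_U[OF that]]) (use N_U in blast)
  have cU: "c \<in> U"
  proof (rule C_D[OF c(1)])
    show "cj c d = d" if "d \<in> D" for d
      using c(2)[OF DM[OF that]] cj_eq_one_iff[OF c(1) D_carrier[OF that]] by simp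
  qed
  have cN: "c \<notin> N"
  proof
    assume cN: "c \<in> N"
    have cc: "cj c c = c" using c(1) by (simp add: cj_def)
    have "c \<in> M" by (rule H[OF cN N_fix[OF cN c(3,1) cc c(2)]])
    then show False using c(3) by simp
  qed
  obtain \<eta> where \<eta>: "rchar \<eta>" "\<And>v. v \<in> N \<Longrightarrow> \<eta> v \<doteq> 0" "\<eta> c \<doteq> 1"
    using rchar_exists[OF N_sub _ N_U cU cN] R_M M_N by blast
  obtain x where x: "x \<in> carrier G" "\<And>u. u \<in> U \<Longrightarrow> cj u x = z [^] \<eta> u \<otimes> x"
    using quad_element_E[OF \<eta>(1) \<eta>(2)[OF E_N]] by blast
  have xN: "cj n x = x" if "n \<in> N" for n
    using x(2)[of n] z_pow_one[OF \<eta>(2)[OF that]] that N_U x(1) by auto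
  have "x \<in> M" by (rule H[OF N_self[OF x(1) xN] xN])
  then have "cj c x = x" using c(2) cj_eq_one_iff[OF c(1) x(1)] by simp
  then show False using not_fixed[OF x(1) \<eta>(3) x(2)[OF cU]] by simp
qed

text \<open>The choice of \<open>w\<close>. If it were impossible then \<open>G\<close> would be generated by \<open>U\<close> and two elements,
  hence all commutator forms would be proportional to each other.\<close>

lemma exists_w:
  assumes s: "splits s" and \<eta>: "rchar \<eta>" "\<And>m. m \<in> M \<Longrightarrow> \<eta> m \<doteq> 0" "n0 \<in> N" "\<eta> n0 \<doteq> 1"
    and h: "h \<in> carrier G" "\<And>b. b \<in> carrier G \<Longrightarrow> \<exists>e\<in>E. cj b h = e \<otimes> h" "\<And>u. u \<in> U \<Longrightarrow> cj u h = z [^] \<eta> u \<otimes> h" "h \<notin> N"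
    and v0: "v0 \<in> cz E" "\<And>v. v \<in> cz E \<Longrightarrow> \<exists>i::int. \<exists>u\<in>U. v = v0 [^] i \<otimes> u"
    and u0: "u0 \<in> E" "cj v0 h = u0 \<otimes> h"
  obtains w where "w \<in> E1 u0" "\<And>k::int. w \<noteq> z [^] k"
proof (rule ccontr)
  note T = that
  assume nt: "\<not> thesis"
  have H: "\<exists>k::int. a = z [^] k" if "a \<in> E1 u0" for a
    using T[OF that] nt by blast
  have n0U: "n0 \<in> U" using \<eta>(3) N_U by blast
  have not01: "\<not> p dvd 1" using prime_p by auto
  have sD: "s \<in> D" using s by (simp add: splits_def)
  \<comment> \<open>If \<open>E\<close> is generated by \<open>e\<close> and \<open>z\<close>, then
    C_G(e) = C_G(E), and both G/C_G(e) and C_G(e)/U are cyclic.\<close>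
  have gen: "\<exists>b\<in>carrier G. \<exists>v\<in>carrier G. \<forall>g\<in>carrier G. \<exists>(i::int) (j::int). \<exists>u\<in>U. g = b [^] i \<otimes> (v [^] j \<otimes> u)"
    if e: "e \<in> E" "\<And>a. a \<in> E \<Longrightarrow> \<exists>(i::int) (k::int). a = e [^] i \<otimes> z [^] k" for e
  proof -
    obtain b where b: "b \<in> carrier G" "\<And>v. v \<in> carrier G \<Longrightarrow> \<exists>i::int. \<exists>u\<in>carrier G. cj u e = e \<and> v = b [^] i \<otimes> u"
      using cyclic_over_centralizer[OF carrier_sub E_D[OF e(1)]] by blast
    have J: "subgroup (cz {e}) G" by (rule cz_sub) (use E_carrier[OF e(1)] in simp)
    obtain v where v: "v \<in> cz {e}" "\<And>x. x \<in> cz {e} \<Longrightarrow> \<exists>j::int. \<exists>u\<in>cz {e}. cj u s = s \<and> x = v [^] j \<otimes> u"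
      using cyclic_over_centralizer[OF J sD] by blast
    have U: "u \<in> U" if u: "u \<in> cz {e}" "cj u s = s" for u
    proof (rule splits_U[OF s cz_carrier[OF u(1)] u(2)])
      fix a assume "a \<in> E"
      then obtain i k where a: "a = e [^] (i::int) \<otimes> z [^] (k::int)" using e(2) by blast
      show "cj u a = a" unfolding a using E_carrier[OF e(1)] cz_carrier[OF u(1)] czD[OF u(1), of e]
        by (simp add: cj_mult cj_int_pow z_central)
    qed
    have "\<exists>(i::int) (j::int). \<exists>u\<in>U. g = b [^] i \<otimes> (v [^] j \<otimes> u)" if g: "g \<in> carrier G" for g
    proof -
      obtain i x where x: "x \<in> carrier G" "cj x e = e" "g = b [^] (i::int) \<otimes> x" using b(2)[OF g] by blast
      have "x \<in> cz {e}" using x by (simp add: cz_def)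
      then obtain j u where "u \<in> cz {e}" "cj u s = s" "x = v [^] (j::int) \<otimes> u" using v(2) by blast
      then show ?thesis using U x(3) by blast
    qed
    then show ?thesis using b(1) cz_carrier[OF v(1)] by blast
  qed
  show False
  proof (cases "\<forall>a\<in>E. \<exists>k::int. a = z [^] k")
    case True
    obtain v where v: "v \<in> carrier G" "\<And>x. x \<in> carrier G \<Longrightarrow> \<exists>j::int. \<exists>u\<in>carrier G. cj u s = s \<and> x = v [^] j \<otimes> u"
      using cyclic_over_centralizer[OF carrier_sub sD] by blast
    have gv: "\<exists>(i::int) (j::int). \<exists>u\<in>U. g = \<one> [^] i \<otimes> (v [^] j \<otimes> u)" if g: "g \<in> carrier G" for g
    proof -
      obtain j u where u: "u \<in> carrier G" "cj u s = s" "g = v [^] (j::int) \<otimes> u" using v(2)[OF g] by blast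
      have "cj u e = e" if e: "e \<in> E" for e
      proof -
        obtain k where k: "e = z [^] (k::int)" using True e by blast
        show ?thesis unfolding k by (rule z_pow_central[OF u(1)])
      qed
      then have "u \<in> U" by (rule splits_U[OF s u(1,2)])
      moreover have "g = \<one> [^] (0::int) \<otimes> (v [^] j \<otimes> u)" using g u(3) by simp
      ultimately show ?thesis by blast
    qed
    have "commutator G v \<one> = \<one>" using v(1) by (simp add: commutator_def)
    then have c0: "\<eta> (commutator G v \<one>) \<doteq> 0" using pchar_one[OF U_sub] \<eta>(1) by (simp add: rchar_def)
    have "\<eta> n0 \<doteq> 0" by (rule rchar_zero_if_two_generated[OF \<eta>(1) one_closed v(1) _ c0 n0U]) (rule gv)
    with \<eta>(4) have "p dvd 1" by Groebner_Basis.algebra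
    then show False using not01 by simp
  next
    case False
    then obtain e0 where e0: "e0 \<in> E" "\<And>k::int. e0 \<noteq> z [^] k" by blast
    have e0n: "e0 \<notin> E1 u0" using H e0(2) by blast
    \<comment> \<open>Products with a power of \<open>z\<close> have order dividing
      \<open>p\<close>, so for \<open>u0\<close> in <z> even \<open>e0\<close> would be in
      \<open>E1 u0\<close>.\<close>
    have u0n: "u0 \<noteq> z [^] k" for k :: int
    proof
      assume "u0 = z [^] k"
      then have "u0 \<in> E1 e0" using subgroup_int_pow[OF E1_sub[OF e0(1)] z_E1[OF e0(1)]] by simp
      then have "e0 \<in> E1 u0" by (rule E1_sym[OF e0(1)])
      then show False using e0n by simp
    qed
    \<comment> \<open>Otherwise \<open>h\<close>, which centralizes the subgroup \<open>E\<close> of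
      \<open>M\<close>, is v0^i u with i prime to \<open>p\<close>. Evaluating the derivation of
      \<open>h\<close> at \<open>h\<close> itself then makes a noncentral power of \<open>u0\<close>
      a power of \<open>z\<close>.\<close>
    have hU: "h \<in> U"
    proof (rule ccontr)
      assume hU: "h \<notin> U"
      have "h \<in> cz E" unfolding cz_def
      proof (intro CollectI conjI ballI)
        fix e assume e: "e \<in> E"
        have "cj e h = h" using h(3)[OF E_U[OF e]] z_pow_one[OF \<eta>(2)[OF E_M[OF e]]] h(1) by simp
        then show "cj h e = e" using cj_eq_one_iff[OF h(1) E_carrier[OF e]] by simp
      qed (rule h(1))
      then obtain i u where iu: "h = v0 [^] (i::int) \<otimes> u" "u \<in> U" using v0(2) by blast
      note vG = cz_carrier[OF v0(1)] and uG = U_carrier[OF iu(2)] and u0G = E_carrier[OF u0(1)]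
      have ni: "\<not> p dvd i"
      proof
        assume "p dvd i"
        then obtain m where "i = p * m" by blast
        then have "v0 [^] i = (v0 [^] m) [^] p" using vG by (simp add: int_pow_pow mult.commute)
        then have "v0 [^] i \<in> U" using R_pow[of "v0 [^] m"] R_U vG by simp
        then show False using hU subgroup.m_closed[OF U_sub _ iu(2)] unfolding iu(1) by simp
      qed
      have "v0 \<otimes> u0 = u0 \<otimes> v0" using czD[OF v0(1) u0(1)] cj_fix_iff[OF vG u0G] by simp
      then have 1: "cj (v0 [^] i) h = u0 [^] i \<otimes> h" by (rule conj_pow[OF vG h(1) u0G u0(2)])
      have "h = cj h h" using h(1) by (simp add: cj_def)
      also have "\<dots> = cj u (cj (v0 [^] i) h)" using cj_cj[of "v0 [^] i" u h] vG uG h(1) iu(1) by simp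
      also have "\<dots> = cj u (u0 [^] i) \<otimes> cj u h" unfolding 1 using u0G uG h(1) by (simp add: cj_mult)
      also have "cj u (u0 [^] i) = u0 [^] i" by (rule D_U[OF D_pow[OF E_D[OF u0(1)]] iu(2)])
      finally have "h = u0 [^] i \<otimes> z [^] \<eta> u \<otimes> h" using h(3)[OF iu(2)] u0G h(1) by (simp add: m_assoc)
      then have "u0 [^] i \<otimes> z [^] \<eta> u = \<one>"
        using r_cancel_one'[of h "u0 [^] i \<otimes> z [^] \<eta> u"] u0G h(1) by simp
      then have "u0 [^] i = inv (z [^] \<eta> u)" using inv_equality[of "u0 [^] i" "z [^] \<eta> u"] u0G by simp
      then have "u0 [^] i = z [^] (- \<eta> u)" by (simp add: int_pow_neg)
      then show False using noncentral_pow_neq[OF u0(1) u0n ni] by simp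
    qed
    have "\<exists>(i::int) (k::int). a = e0 [^] i \<otimes> z [^] k" if a: "a \<in> E" for a
    proof -
      obtain i where "a \<otimes> e0 [^] (i::int) \<in> E1 u0" using E1_index[OF u0(1) a e0(1) e0n] by blast
      then obtain k where k: "a \<otimes> e0 [^] i = z [^] (k::int)" using H by blast
      note G = E_carrier[OF a] E_carrier[OF e0(1)]
      have "a = a \<otimes> e0 [^] i \<otimes> e0 [^] (- i)" using G by (simp add: m_assoc int_pow_neg)
      also have "\<dots> = e0 [^] (- i) \<otimes> z [^] k" unfolding k by (rule z_comm) (use G in simp)
      finally show ?thesis by blast
    qed
    then obtain b v where bv: "b \<in> carrier G" "v \<in> carrier G"
      "\<And>g. g \<in> carrier G \<Longrightarrow> \<exists>(i::int) (j::int). \<exists>u\<in>U. g = b [^] i \<otimes> (v [^] j \<otimes> u)"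
      using gen[OF e0(1)] by blast
    obtain \<eta>1 where \<eta>1: "rchar \<eta>1" "\<And>v. v \<in> N \<Longrightarrow> \<eta>1 v \<doteq> 0" "\<eta>1 h \<doteq> 1"
      using rchar_exists[OF N_sub _ N_U hU h(4)] R_M M_N by blast
    let ?c = "commutator G v b"
    have nc: "\<not> p dvd \<eta> ?c"
    proof
      assume "p dvd \<eta> ?c"
      then have c0: "\<eta> ?c \<doteq> 0" by simp
      have "\<eta> n0 \<doteq> 0" by (rule rchar_zero_if_two_generated[OF \<eta>(1) bv(1,2) _ c0 n0U]) (rule bv(3))
      with \<eta>(4) have "p dvd 1" by Groebner_Basis.algebra
      then show False using not01 by simp
    qed
    then obtain j where j: "\<eta> ?c * j \<doteq> 1" by (rule prime_inverse)
    \<comment> \<open>The factor of proportionality: \<theta> vanishes at the commutator of the two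
      generators, hence on \<open>U\<close>.\<close>
    define k where "k = \<eta>1 ?c * j"
    define \<theta> where "\<theta> x = \<eta>1 x - k * \<eta> x" for x
    have r\<theta>: "rchar \<theta>" unfolding rchar_def
    proof (intro conjI ballI)
      show "pchar U \<theta>" unfolding pchar_def
      proof (intro ballI)
        fix a b assume ab: "a \<in> U" "b \<in> U"
        have "\<eta> (a \<otimes> b) \<doteq> \<eta> a + \<eta> b" by (rule pcharD[OF _ ab]) (use \<eta>(1) in \<open>simp add: rchar_def\<close>)
        moreover have "\<eta>1 (a \<otimes> b) \<doteq> \<eta>1 a + \<eta>1 b" by (rule pcharD[OF _ ab]) (use \<eta>1(1) in \<open>simp add: rchar_def\<close>)
        ultimately show "\<theta> (a \<otimes> b) \<doteq> \<theta> a + \<theta> b" unfolding \<theta>_def by Groebner_Basis.algebra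
      qed
      fix r assume r: "r \<in> R"
      have "\<eta> r \<doteq> 0" "\<eta>1 r \<doteq> 0" using \<eta>(1) \<eta>1(1) r unfolding rchar_def by blast+
      then show "\<theta> r \<doteq> 0" unfolding \<theta>_def by Groebner_Basis.algebra
    qed
    have \<theta>c: "\<theta> ?c \<doteq> 0" using j unfolding \<theta>_def k_def by Groebner_Basis.algebra
    have \<theta>0: "\<theta> u \<doteq> 0" if "u \<in> U" for u
      by (rule rchar_zero_if_two_generated[OF r\<theta> bv(1,2) _ \<theta>c that]) (rule bv(3))
    \<comment> \<open>As \<open>h\<close> commutes with itself, \<eta>(h) = 0, while \<eta>1(h) = 1;
      this contradicts the proportionality.\<close>
    have "cj h h = h" using h(1) by (simp add: cj_def)
    then have "z [^] \<eta> h \<otimes> h = h" using h(3)[OF hU] by simp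
    then have "z [^] \<eta> h = z [^] (0::int)" using r_cancel_one[of h "z [^] \<eta> h"] h(1) by simp
    then have "\<eta> h \<doteq> 0" by (simp only: z_cong)
    then have "p dvd 1"
      using \<theta>0[OF n0U] \<theta>0[OF hU] \<eta>(4) \<eta>1(3) \<eta>1(2)[OF \<eta>(3)] unfolding \<theta>_def by Groebner_Basis.algebra
    then show False using not01 by simp
  qed
qed


section \<open>Contradictions from the product of \<open>w\<close> and \<open>c\<close>\<close>

definition special :: "'a \<Rightarrow> bool" where
  "special y \<longleftrightarrow> y \<in> N \<and> y \<notin> M \<and> (\<forall>n\<in>N. cj n y = y) \<and>
    (\<forall>k\<in>carrier G. (\<forall>m\<in>M. cj m k = k) \<longrightarrow> (\<exists>i::int. cj k y = z [^] i \<otimes> y))"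

lemma specialD: assumes "special y"
  shows "y \<in> N" "y \<notin> M" "n \<in> N \<Longrightarrow> cj n y = y" "y \<in> carrier G"
    "k \<in> carrier G \<Longrightarrow> (\<And>m. m \<in> M \<Longrightarrow> cj m k = k) \<Longrightarrow> \<exists>i::int. cj k y = z [^] i \<otimes> y"
  using assms N_carrier unfolding special_def by blast+

lemma cj_z_pow_mult:
  assumes "k \<in> carrier G" "y \<in> carrier G" "cj k y = z [^] (i::int) \<otimes> y"
  shows "cj k (y [^] (j::int)) = z [^] (i * j) \<otimes> y [^] j"
proof -
  have "cj k (y [^] j) = (z [^] i \<otimes> y) [^] j" using assms by (simp only: cj_int_pow)
  also have "\<dots> = (z [^] i) [^] j \<otimes> y [^] j"
    by (rule int_pow_mult_distrib[OF z_comm[OF assms(2)]]) (use assms in simp_all)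
  finally show ?thesis by (simp only: int_pow_pow[OF z_closed])
qed

text \<open>\<open>N\<close> is generated by \<open>y\<close> and \<open>M\<close>, and
  \<open>k\<close> commutes with \<open>M\<close>, so only the power of \<open>y\<close> contained
  in \<open>x\<close> contributes to the commutator.\<close>

lemma special_all:
  assumes y: "special y" and x: "x \<in> N" "\<And>n. n \<in> N \<Longrightarrow> cj n x = x"
    and k: "k \<in> carrier G" "\<And>m. m \<in> M \<Longrightarrow> cj m k = k"
  shows "\<exists>i::int. cj k x = z [^] i \<otimes> x"
proof -
  obtain i where i: "cj k y = z [^] (i::int) \<otimes> y" using specialD(5)[OF y k] by blast
  obtain j m where jm: "x = y [^] (j::int) \<otimes> m" "m \<in> M" using N_M[OF specialD(1,2)[OF y] x(1)] by blast
  note G = specialD(4)[OF y] M_carrier[OF jm(2)]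
  have "cj k m = m" using k(2)[OF jm(2)] cj_eq_one_iff[OF k(1) G(2)] by simp
  then have "cj k x = z [^] (i * j) \<otimes> x"
    unfolding jm(1) using cj_z_pow_mult[OF k(1) G(1) i, of j] G k(1) by (simp add: cj_mult m_assoc)
  then show ?thesis by blast
qed

lemma E_fix_M: "m \<in> M \<Longrightarrow> e \<in> E \<Longrightarrow> cj m e = e"
  by (rule D_U[OF E_D M_U])

lemma noncentral_pow_contra:
  assumes w: "w \<in> E" "\<And>k::int. w \<noteq> z [^] k" and j: "\<not> p dvd j" and x: "x \<in> carrier G" "w [^] j \<otimes> x = z [^] (i::int) \<otimes> x"
  shows False
proof -
  have "w [^] j = z [^] i" using x E_carrier[OF w(1)] by simp
  then show False using noncentral_pow_neq[OF w j] by simp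
qed

text \<open>The element \<open>x\<close> that induces the product centralizes \<open>M\<close>, so
  its commutator with \<open>y\<close> is in <z>; the product formula makes it a noncentral power of
  \<open>w\<close>.\<close>

lemma no_element_moved_by_special:
  assumes y: "special y" and w: "w \<in> E" "\<And>k::int. w \<noteq> z [^] k"
    and c: "c \<in> carrier G" "c [^] p = \<one>" "\<And>b. b \<in> carrier G \<Longrightarrow> inv c \<otimes> cj b c \<in> E1 w"
      "\<And>m. m \<in> M \<Longrightarrow> cj m c = c"
    and j: "\<not> p dvd j" "cj y c = c \<otimes> z [^] j"
  shows False
proof (rule product_derivation_element[OF w c])
  fix x assume x: "x \<in> carrier G" "\<And>b. b \<in> carrier G \<Longrightarrow> cj b c = c \<Longrightarrow> cj b w = w \<Longrightarrow> cj b x = x"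
    "\<And>b j. b \<in> carrier G \<Longrightarrow> cj b w = w \<Longrightarrow> cj b c = c \<otimes> z [^] (j::int) \<Longrightarrow> cj b x = w [^] j \<otimes> x"
  note yG = specialD(4)[OF y]
  have "cj m x = x" if "m \<in> M" for m by (rule x(2)[OF M_carrier[OF that] c(4)[OF that] E_fix_M[OF that w(1)]])
  then obtain i where "cj x y = z [^] (i::int) \<otimes> y" using specialD(5)[OF y x(1)] by blast
  then have 1: "cj y x = z [^] (- i) \<otimes> x" by (rule flip[OF x(1) yG])
  have yw: "cj y w = w" by (rule D_U[OF E_D[OF w(1)]]) (use specialD(1)[OF y] N_U in blast)
  have "cj y x = w [^] j \<otimes> x" by (rule x(3)[OF yG yw j(2)])
  then show False using noncentral_pow_contra[OF w j(1) x(1), of "- i"] 1 by simp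
qed

text \<open>The same contradiction with the roles exchanged: here \<open>c\<close> and hence
  \<open>x\<close> are in Z(N), and the element of the centralizer of \<open>M\<close> does the
  moving.\<close>

lemma no_central_element_of_N_moved:
  assumes y: "special y" and w: "w \<in> E" "\<And>k::int. w \<noteq> z [^] k"
    and c: "c \<in> carrier G" "c [^] p = \<one>" "\<And>b. b \<in> carrier G \<Longrightarrow> inv c \<otimes> cj b c \<in> E1 w"
      "\<And>n. n \<in> N \<Longrightarrow> cj n c = c"
    and h: "h \<in> carrier G" "\<And>m. m \<in> M \<Longrightarrow> cj m h = h"
    and j: "\<not> p dvd j" "cj h c = c \<otimes> z [^] j"
  shows False
proof (rule product_derivation_element[OF w c(1-3)])
  show "cj m c = c" if "m \<in> M" for m using c(4) M_N that by blast
  fix x assume x: "x \<in> carrier G" "\<And>b. b \<in> carrier G \<Longrightarrow> cj b c = c \<Longrightarrow> cj b w = w \<Longrightarrow> cj b x = x"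
    "\<And>b j. b \<in> carrier G \<Longrightarrow> cj b w = w \<Longrightarrow> cj b c = c \<otimes> z [^] (j::int) \<Longrightarrow> cj b x = w [^] j \<otimes> x"
  have xN: "cj n x = x" if "n \<in> N" for n
    by (rule x(2)[OF N_carrier[OF that] c(4)[OF that] D_U[OF E_D[OF w(1)]]]) (use that N_U in blast)
  obtain i where 1: "cj h x = z [^] (i::int) \<otimes> x" using special_all[OF y N_self[OF x(1) xN] xN h] by blast
  have hw: "cj h w = w" using h(2)[OF E_M[OF w(1)]] cj_eq_one_iff[OF h(1) E_carrier[OF w(1)]] by simp
  have "cj h x = w [^] j \<otimes> x" by (rule x(3)[OF h(1) hw j(2)])
  then show False using noncentral_pow_contra[OF w j(1) x(1), of i] 1 by simp
qed

lemma pow_p_central':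
  assumes V: "V \<subseteq> E" and x: "x \<in> carrier G" "\<And>b. b \<in> carrier G \<Longrightarrow> \<exists>e\<in>V. cj b x = e \<otimes> x" "\<And>m. m \<in> M \<Longrightarrow> cj m x = x"
  shows "central (x [^] p)"
  unfolding central_def
proof (intro conjI ballI)
  show "x [^] p \<in> carrier G" using x(1) by simp
  fix g assume g: "g \<in> carrier G"
  show "cj g (x [^] p) = x [^] p"
  proof (rule pow_p_central[OF x(1) _ g])
    fix b assume "b \<in> carrier G"
    then obtain e where e: "e \<in> V" "cj b x = e \<otimes> x" using x(2) by blast
    have eE: "e \<in> E" using e(1) V by blast
    have "e \<otimes> x = x \<otimes> e" using x(3)[OF E_M[OF eE]] cj_fix_iff[OF E_carrier[OF eE] x(1)] by simp
    then show "\<exists>e\<in>E. cj b x = e \<otimes> x \<and> e \<otimes> x = x \<otimes> e" using eE e(2) by blast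
  qed
qed

lemma left_to_right:
  assumes c: "c \<in> carrier G" "\<And>m. m \<in> M \<Longrightarrow> cj m c = c" and e: "e \<in> E"
  shows "inv c \<otimes> (e \<otimes> c) = e"
proof -
  note eG = E_carrier[OF e]
  have "e \<otimes> c = c \<otimes> e" using c(2)[OF E_M[OF e]] cj_fix_iff[OF eG c(1)] by simp
  then show ?thesis using c(1) eG by simp
qed

text \<open>Here \<open>h\<close> itself need not have order \<open>p\<close>; a multiple of \<open>h\<close> by a power of \<open>q\<close> and a central element has.\<close>

lemma no_order_correction:
  assumes y: "special y" and w: "w \<in> E" "\<And>k::int. w \<noteq> z [^] k"
    and h: "h \<in> carrier G" "\<And>m. m \<in> M \<Longrightarrow> cj m h = h" "\<And>b. b \<in> carrier G \<Longrightarrow> \<exists>e\<in>E1 w. cj b h = e \<otimes> h"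
      "cj y h = z [^] a \<otimes> h" "\<not> p dvd a"
    and q: "q \<in> N" "\<And>n. n \<in> N \<Longrightarrow> cj n q = q" "\<And>b. b \<in> carrier G \<Longrightarrow> \<exists>e\<in>E1 w. cj b q = e \<otimes> q"
      "\<And>r. central r \<Longrightarrow> r [^] p \<noteq> q [^] p"
  shows False
proof -
  note yG = specialD(4)[OF y] and qG = N_carrier[OF q(1)]
  have qM: "cj m q = q" if "m \<in> M" for m using q(2) M_N that by blast
  obtain i r where r: "central r" "r [^] p = h [^] p \<otimes> (q [^] p) [^] (i::int)"
    using central_power'[OF pow_p_central'[OF E1_subset qG q(3) qM] pow_p_central'[OF E1_subset h(1,3,2)] q(4)] by blast
  note rG = centralD(1)[OF r(1)]
  define c where "c = h \<otimes> q [^] i \<otimes> inv r"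
  have cG: "c \<in> carrier G" using h(1) qG rG by (simp add: c_def)
  have cM: "cj m c = c" if m: "m \<in> M" for m
    unfolding c_def using h(1,2) qG rG qM centralD(2)[OF r(1)] m M_carrier[OF m]
    by (simp add: cj_mult cj_int_pow cj_inv)
  \<comment> \<open>\<open>h\<close> and \<open>q\<close> need not commute, but their commutator is
    in <z>, so \<open>p\<close>-th powers of their products still split.\<close>
  obtain k where "cj h q = z [^] (k::int) \<otimes> q" using special_all[OF y q(1,2) h(1,2)] by blast
  then have "cj h (q [^] i) = z [^] (k * i) \<otimes> q [^] i" by (rule cj_z_pow_mult[OF h(1) qG])
  then have 1: "(h \<otimes> q [^] i) [^] p = h [^] p \<otimes> (q [^] i) [^] p" by (rule class2_p_pow[OF h(1) int_pow_closed[OF qG]])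
  have "(q [^] i) [^] p = (q [^] p) [^] i" using qG by (simp add: int_pow_pow mult.commute)
  then have 2: "(h \<otimes> q [^] i) [^] p = r [^] p" using 1 r(2) by simp
  have "c [^] p = (h \<otimes> q [^] i) [^] p \<otimes> (inv r) [^] p"
    unfolding c_def using h(1) qG rG central_comm[OF central_inv[OF r(1)], of "h \<otimes> q [^] i"]
    by (intro int_pow_mult_distrib) auto
  then have cp: "c [^] p = \<one>" unfolding 2 using rG by (simp add: int_pow_inv)
  have cf: "inv c \<otimes> cj b c \<in> E1 w" if b: "b \<in> carrier G" for b
  proof -
    obtain e where e: "e \<in> E1 w" "cj b h = e \<otimes> h" using h(3)[OF b] by blast
    obtain e' where e': "e' \<in> E1 w" "cj b q = e' \<otimes> q" using q(3)[OF b] by blast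
    note E = E1_E[OF e(1)] E1_E[OF e'(1)]
    note EG = E_carrier[OF E(1)] E_carrier[OF E(2)]
    have ei: "e' [^] i \<in> E1 w" by (rule subgroup_int_pow[OF E1_sub[OF w(1)] e'(1)])
    have "e' \<otimes> q = q \<otimes> e'" using qM[OF E_M[OF E(2)]] cj_fix_iff[OF EG(2) qG] by simp
    then have "cj b (q [^] i) = e' [^] i \<otimes> q [^] i"
      unfolding cj_int_pow[OF b qG] e'(2) by (rule int_pow_mult_distrib[OF _ EG(2) qG])
    then have "cj b c = e \<otimes> (h \<otimes> e' [^] i) \<otimes> q [^] i \<otimes> inv r"
      unfolding c_def using b h(1) qG rG EG e(2) centralD(2)[OF r(1) b] by (simp add: cj_mult cj_inv m_assoc)
    also have "h \<otimes> e' [^] i = e' [^] i \<otimes> h"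
      using h(2)[OF E_M[OF E1_E[OF ei]]] cj_fix_iff[of "e' [^] i" h] h(1) EG by simp
    finally have "cj b c = (e \<otimes> e' [^] i) \<otimes> c" unfolding c_def using h(1) qG rG EG by (simp add: m_assoc)
    moreover have ee: "e \<otimes> e' [^] i \<in> E1 w" by (rule subgroup.m_closed[OF E1_sub[OF w(1)] e(1) ei])
    ultimately show ?thesis using left_to_right[OF cG cM E1_E[OF ee]] by simp
  qed
  have "cj y c = z [^] a \<otimes> c" 
    unfolding c_def using yG h(1,4) qG rG q(2)[OF specialD(1)[OF y]] centralD(2)[OF r(1) yG]
    by (simp add: cj_mult cj_inv cj_int_pow m_assoc)
  then have yc: "cj y c = c \<otimes> z [^] a" using z_comm[OF cG] by simp
  show False by (rule no_element_moved_by_special[OF y w cG cp cf cM h(5) yc])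
qed

lemma E1_generator:
  assumes w: "w \<in> E" obtains e where "e \<in> E" "\<And>a. a \<in> E \<Longrightarrow> \<exists>i::int. a \<otimes> e [^] i \<in> E1 w"
proof (cases "E \<subseteq> E1 w")
  case True
  show ?thesis
  proof (rule that[OF one_E])
    fix a assume "a \<in> E"
    then show "\<exists>i::int. a \<otimes> \<one> [^] i \<in> E1 w" using True E_carrier by auto
  qed
next
  case False
  then obtain e where "e \<in> E" "e \<notin> E1 w" by blast
  then show ?thesis using that E1_index[OF w] by blast
qed

text \<open>\<open>E\<close> is generated by \<open>E1 w\<close> and one element, so the centralizer
  of \<open>E1 w\<close> is cyclic modulo C_G(E); the assumption makes C_G(E) orthogonal to
  it.\<close>

lemma om_cz_E1:
  assumes w: "w \<in> E" and \<eta>: "rchar \<eta>"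
    and o: "\<And>u t. u \<in> cz E \<Longrightarrow> t \<in> cz (E1 w) \<Longrightarrow> \<eta> (commutator G u t) \<doteq> 0"
    and ab: "a \<in> cz (E1 w)" "b \<in> cz (E1 w)"
  shows "\<eta> (commutator G a b) \<doteq> 0"
proof -
  obtain e where e: "e \<in> E" "\<And>a. a \<in> E \<Longrightarrow> \<exists>i::int. a \<otimes> e [^] i \<in> E1 w" by (rule E1_generator[OF w]) blast
  note eG = E_carrier[OF e(1)]
  have J: "subgroup (cz (E1 w)) G" by (rule cz_sub) (use E1_subset E_carrier in blast)
  obtain t where t: "t \<in> cz (E1 w)"
    "\<And>v. v \<in> cz (E1 w) \<Longrightarrow> \<exists>i::int. \<exists>u\<in>cz (E1 w). cj u e = e \<and> v = t [^] i \<otimes> u"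
    using cyclic_over_centralizer[OF J E_D[OF e(1)]] by blast
  have cE: "u \<in> cz E" if u: "u \<in> cz (E1 w)" "cj u e = e" for u
    unfolding cz_def
  proof (intro CollectI conjI ballI)
    show uG: "u \<in> carrier G" by (rule cz_carrier[OF u(1)])
    fix a assume a: "a \<in> E"
    obtain i where i: "a \<otimes> e [^] (i::int) \<in> E1 w" using e(2)[OF a] by blast
    note aG = E_carrier[OF a]
    have "a \<otimes> e [^] i = cj u (a \<otimes> e [^] i)" using czD[OF u(1) i] by simp
    also have "\<dots> = cj u a \<otimes> e [^] i" using uG aG eG pow_fix u(2) by (simp add: cj_mult cj_int_pow)
    finally show "cj u a = a" using uG aG eG by simp
  qed
  note tG = cz_carrier[OF t(1)]
  obtain i u where a: "u \<in> cz (E1 w)" "cj u e = e" "a = t [^] (i::int) \<otimes> u" using t(2)[OF ab(1)] by blast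
  obtain j u' where b: "u' \<in> cz (E1 w)" "cj u' e = e" "b = t [^] (j::int) \<otimes> u'" using t(2)[OF ab(2)] by blast
  show ?thesis unfolding a(3) b(3)
    by (rule om_cyc[OF \<eta> tG cz_carrier[OF a(1)] cz_carrier[OF b(1)] o[OF cE[OF a(1,2)] t(1)] 
          o[OF cE[OF b(1,2)] t(1)] o[OF cE[OF a(1,2)] b(1)]])
qed

text \<open>The identity expressing \<open>\<eta> [v, t]\<close> by the values of the derivation \<open>g \<mapsto> [h, g]\<close> at \<open>v\<close> and \<open>t\<close>.\<close>

lemma commutator_form_polar:
  assumes h: "h \<in> carrier G" "\<And>b. b \<in> carrier G \<Longrightarrow> \<exists>e\<in>E. cj b h = e \<otimes> h" "\<And>u. u \<in> U \<Longrightarrow> cj u h = z [^] \<eta> u \<otimes> h"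
    and v: "v \<in> cz E" and u0: "u0 \<in> E" "cj v h = u0 \<otimes> h" and t: "t \<in> carrier G" "cj t u0 = u0"
  shows "\<eta> (commutator G v t) \<doteq> 0"
proof -
  let ?c = "commutator G v t"
  note vG = cz_carrier[OF v]
  obtain e where e: "e \<in> E" "cj t h = e \<otimes> h" using h(2)[OF t(1)] by blast
  note G = vG t(1) h(1) E_carrier[OF u0(1)] E_carrier[OF e(1)]
  have cU: "?c \<in> U" by (rule U_comm[OF vG t(1)])
  note cG = U_carrier[OF cU]
  have 1: "cj (v \<otimes> t) h = u0 \<otimes> (e \<otimes> h)" using G u0(2) e(2) t(2) by (simp add: cj_cj[symmetric] cj_mult)
  have "v \<otimes> t = t \<otimes> v \<otimes> ?c" using G by (simp add: commutator_def m_assoc)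
  then have "cj (v \<otimes> t) h = cj ?c (cj v (cj t h))" using G cG by (simp add: cj_cj m_assoc)
  also have "cj v (cj t h) = e \<otimes> (u0 \<otimes> h)" unfolding e(2) using G czD[OF v e(1)] u0(2) by (simp add: cj_mult)
  also have "cj ?c (e \<otimes> (u0 \<otimes> h)) = e \<otimes> (u0 \<otimes> (z [^] \<eta> ?c \<otimes> h))"
    using G cG h(3)[OF cU] D_U[OF E_D[OF e(1)] cU] D_U[OF E_D[OF u0(1)] cU] by (simp add: cj_mult)
  finally have "(u0 \<otimes> e) \<otimes> h = (e \<otimes> u0) \<otimes> (z [^] \<eta> ?c \<otimes> h)" unfolding 1 using G by (simp add: m_assoc)
  then have "h = z [^] \<eta> ?c \<otimes> h" unfolding E_comm[OF u0(1) e(1)] using G by simp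
  then have "z [^] \<eta> ?c = z [^] (0::int)" using h(1) r_cancel_one'[of h "z [^] \<eta> ?c"] by simp
  then show ?thesis by (simp only: z_cong)
qed

text \<open>The character \<eta> is used twice. The first element \<open>h0\<close>, with
  commutators in \<open>E\<close>, serves to find \<open>u0\<close> and then \<open>w\<close> with
  \<open>u0\<close> in \<open>E1 w\<close>; this makes the form vanish on the centralizer of
  \<open>E1 w\<close>, so that \<eta> also has an \<open>h\<close> with commutators in
  \<open>E1 w\<close>.\<close>

lemma centralizer_M_outside_M:
  assumes c0: "c0 \<in> carrier G" "\<And>m. m \<in> M \<Longrightarrow> cj m c0 = c0" "c0 \<notin> M"
  shows False
proof -
  obtain s where s: "splits s" by (rule splits_exists)
  have sD: "s \<in> D" using s by (simp add: splits_def)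
  obtain v0 where v0: "v0 \<in> cz E" "\<And>v. v \<in> cz E \<Longrightarrow> \<exists>i::int. \<exists>u\<in>U. v = v0 [^] i \<otimes> u"
    using cz_E_cyclic[OF s] by blast
  obtain y1 where y1: "y1 \<in> N" "y1 \<notin> M" "\<And>n. n \<in> N \<Longrightarrow> cj n y1 = y1"
    using center_N_not_M[OF c0] by blast
  obtain n0 where n0: "n0 \<in> N" "n0 \<notin> M" using M_proper by blast
  have n0U: "n0 \<in> U" using n0 N_U by blast
  have MU: "M \<subseteq> U" using M_N N_U by blast
  obtain \<eta> where \<eta>: "rchar \<eta>" "\<And>v. v \<in> M \<Longrightarrow> \<eta> v \<doteq> 0" "\<eta> n0 \<doteq> 1"
    using rchar_exists[OF M_sub R_M MU n0U n0(2)] by blast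
  have inCM: "cj m x = x" if "x \<in> carrier G" "\<And>u. u \<in> U \<Longrightarrow> cj u x = z [^] \<eta> u \<otimes> x" "m \<in> M" for x m
    using that(2)[OF M_U[OF that(3)]] z_pow_one[OF \<eta>(2)[OF that(3)]] that(1) by simp
  \<comment> \<open>An element of \<open>N\<close> commutes with \<open>y1\<close>; if it also
    commutes with \<open>M\<close>, it commutes with all of \<open>N\<close>, but \<open>n0\<close>
    moves \<open>x\<close>.\<close>
  have notN: "x \<notin> N" if x: "x \<in> carrier G" "\<And>u. u \<in> U \<Longrightarrow> cj u x = z [^] \<eta> u \<otimes> x" for x
  proof
    assume xN: "x \<in> N"
    have "cj y1 x = x" using y1(3)[OF xN] cj_eq_one_iff[OF N_carrier[OF y1(1)] x(1)] by simp
    then have "cj n0 x = x" by (rule N_fix[OF y1(1,2) x(1) _ inCM[OF x] n0(1)])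
    then show False using not_fixed[OF x(1) \<eta>(3) x(2)[OF n0U]] by simp
  qed
  have \<eta>y: "\<not> p dvd \<eta> y" if y: "y \<in> N" "y \<notin> M" for y
  proof
    assume py: "p dvd \<eta> y"
    obtain k m where km: "n0 = y [^] (k::int) \<otimes> m" "m \<in> M" using N_M[OF y n0(1)] by blast
    have pU: "pchar U \<eta>" using \<eta>(1) by (simp add: rchar_def)
    have yU: "y \<in> U" using y(1) N_U by blast
    have "\<eta> n0 \<doteq> \<eta> (y [^] k) + \<eta> m" unfolding km(1)
      by (rule pcharD[OF pU subgroup_int_pow[OF U_sub yU] M_U[OF km(2)]])
    moreover have "\<eta> (y [^] k) \<doteq> k * \<eta> y" by (rule pchar_int_pow[OF U_sub pU yU])
    ultimately have "p dvd 1" using \<eta>(2)[OF km(2)] \<eta>(3) py by Groebner_Basis.algebra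
    then show False using prime_p by auto
  qed
  obtain h0 where h0: "h0 \<in> carrier G" "\<And>b. b \<in> carrier G \<Longrightarrow> \<exists>e\<in>E. cj b h0 = e \<otimes> h0"
    "\<And>u. u \<in> U \<Longrightarrow> cj u h0 = z [^] \<eta> u \<otimes> h0"
    using quad_element_E[OF \<eta>(1) \<eta>(2)[OF E_M]] by blast
  \<comment> \<open>A central element outside \<open>M\<close> would generate \<open>N\<close>
    together with \<open>M\<close>, and then \<open>N\<close> would centralize
    \<open>h0\<close>.\<close>
  have ZM: "r \<in> M" if r: "central r" for r
  proof (rule ccontr)
    assume nr: "r \<notin> M"
    have "cj n0 h0 = h0" by (rule N_fix[OF D_N[OF central_in_D[OF r]] nr h0(1) central_cj[OF r h0(1)] inCM[OF h0(1,3)] n0(1)])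
    then show False using not_fixed[OF h0(1) \<eta>(3) h0(3)[OF n0U]] by simp
  qed
  obtain u0 where u0: "u0 \<in> E" "cj v0 h0 = u0 \<otimes> h0" using h0(2)[OF cz_carrier[OF v0(1)]] by blast
  obtain w where w1: "w \<in> E1 u0" and w2: "\<And>k::int. w \<noteq> z [^] k"
    using exists_w[OF s \<eta>(1,2) n0(1) \<eta>(3) h0 notN[OF h0(1,3)] v0 u0] by blast
  have w: "w \<in> E" by (rule E1_E[OF w1])
  have u0w: "u0 \<in> E1 w" by (rule E1_sym[OF u0(1) w1])
  \<comment> \<open>C_G(E) is generated by \<open>v0\<close> and \<open>U\<close>, and
    \<open>t\<close> fixes \<open>u0\<close> because \<open>u0\<close> is in \<open>E1 w\<close>; so
    \<open>commutator_form_polar\<close> applies to \<open>v0\<close>.\<close>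
  have om: "\<eta> (commutator G u t) \<doteq> 0" if u: "u \<in> cz E" and t: "t \<in> cz (E1 w)" for u t
  proof -
    obtain i u' where iu: "u = v0 [^] (i::int) \<otimes> u'" "u' \<in> U" using v0(2)[OF u] by blast
    note vG = cz_carrier[OF v0(1)] and tG = cz_carrier[OF t]
    have "\<eta> (commutator G u t) \<doteq> \<eta> (commutator G (v0 [^] i) t) + \<eta> (commutator G u' t)"
      unfolding iu(1) by (rule pcharD[OF om_left[OF \<eta>(1) tG]]) (use vG U_carrier[OF iu(2)] in auto)
    moreover have "\<eta> (commutator G (v0 [^] i) t) \<doteq> i * \<eta> (commutator G v0 t)"
      by (rule pchar_int_pow[OF carrier_sub om_left[OF \<eta>(1) tG] vG])
    moreover have "\<eta> (commutator G u' t) \<doteq> 0" by (rule om_U(1)[OF \<eta>(1) tG iu(2)])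
    moreover have "\<eta> (commutator G v0 t) \<doteq> 0"
      by (rule commutator_form_polar[OF h0 v0(1) u0 tG czD[OF t u0w]])
    ultimately show ?thesis by Groebner_Basis.algebra
  qed
  have EE1: "E1 w \<subseteq> E" by (rule E1_subset)
  have "\<exists>h\<in>carrier G. (\<forall>b\<in>carrier G. \<exists>e\<in>E1 w. cj b h = e \<otimes> h) \<and> (\<forall>u\<in>U. cj u h = z [^] \<eta> u \<otimes> h)"
    by (rule quad_element_cz[OF \<eta>(1) E1_sub[OF w] EE1 z_E1[OF w] \<eta>(2)[OF E_M] om_cz_E1[OF w \<eta>(1) om]]) auto
  then obtain h where h: "h \<in> carrier G" "\<And>b. b \<in> carrier G \<Longrightarrow> \<exists>e\<in>E1 w. cj b h = e \<otimes> h"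
    "\<And>u. u \<in> U \<Longrightarrow> cj u h = z [^] \<eta> u \<otimes> h" by blast
  note hM = inCM[OF h(1,3)] and hN = notN[OF h(1,3)]
  have "\<exists>y. special y \<and> (s = \<one> \<longrightarrow> (\<forall>b\<in>carrier G. \<exists>e\<in>E1 w. cj b y = e \<otimes> y))"
  proof (cases "D \<subseteq> M")
    case False
    then obtain y where y: "y \<in> D" "y \<notin> M" by blast
    note yG = D_carrier[OF y(1)] and yN = D_N[OF y(1)]
    have "special y" unfolding special_def
    proof (intro conjI ballI impI)
      show "y \<in> N" "y \<notin> M" by (fact yN, fact y(2))
      show "cj n y = y" if "n \<in> N" for n by (rule D_U[OF y(1)]) (use that N_U in blast)
      show "\<exists>i::int. cj k y = z [^] i \<otimes> y" if "k \<in> carrier G" for k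
        using ch[OF y(1) that] z_comm[OF yG] by auto
    qed
    \<comment> \<open>Both \<open>E\<close> and Z(G) lie in \<open>M\<close>, hence so would
      \<open>D\<close> if \<open>s\<close> were trivial.\<close>
    moreover have "s \<noteq> \<one>"
    proof
      assume "s = \<one>"
      then obtain e r where "e \<in> E" "central r" "y = e \<otimes> r" using s y(1) E_carrier centralD(1) unfolding splits_def by fastforce
      then show False using y(2) E_M ZM subgroup.m_closed[OF M_sub] by blast
    qed
    ultimately show ?thesis by blast
  next
    case True
    \<comment> \<open>This is the gain of the case that \<open>D\<close> lies in \<open>M\<close>:
      the centralizer of \<open>M\<close> is inside \<open>U\<close>, where the commutators with
      \<open>y\<close> are powers of \<open>z\<close>.\<close>
    have CU: "k \<in> U" if k: "k \<in> carrier G" "\<And>m. m \<in> M \<Longrightarrow> cj m k = k" for k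
    proof (rule C_D[OF k(1)])
      fix d assume "d \<in> D"
      then have "d \<in> M" "d \<in> carrier G" using True D_carrier by auto
      then show "cj k d = d" using k cj_eq_one_iff[of k d] by auto
    qed
    have hU: "h \<in> U" by (rule CU[OF h(1) hM])
    obtain \<eta>1 where \<eta>1: "rchar \<eta>1" "\<And>v. v \<in> N \<Longrightarrow> \<eta>1 v \<doteq> 0" "\<eta>1 h \<doteq> 1"
      using rchar_exists[OF N_sub _ N_U hU hN] R_M M_N by blast
    have sp: "special y" if y: "y \<in> carrier G" "\<And>u. u \<in> U \<Longrightarrow> cj u y = z [^] \<eta>1 u \<otimes> y" for y
    proof -
      have yN: "cj n y = y" if "n \<in> N" for n
        using y(2)[OF subsetD[OF N_U that]] z_pow_one[OF \<eta>1(2)[OF that]] y(1) by simp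
      show ?thesis unfolding special_def
      proof (intro conjI ballI impI)
        show "y \<in> N" by (rule N_self[OF y(1) yN])
        show "y \<notin> M"
        proof
          assume "y \<in> M"
          then have "cj h y = y" using hM cj_eq_one_iff[OF h(1) y(1)] by simp
          then show False using not_fixed[OF y(1) \<eta>1(3) y(2)[OF hU]] by simp
        qed
        show "cj n y = y" if "n \<in> N" for n by (rule yN[OF that])
        show "\<exists>i::int. cj k y = z [^] i \<otimes> y" if "k \<in> carrier G" "\<forall>m\<in>M. cj m k = k" for k
          using y(2)[OF CU[of k]] that by blast
      qed
    qed
    show ?thesis
    proof (cases "s = \<one>")
      case False
      then show ?thesis using quad_element_E[OF \<eta>1(1) \<eta>1(2)[OF E_N]] sp by blast
    next
      case s1: True
      \<comment> \<open>For trivial \<open>s\<close> even C_G(E) lies in \<open>U\<close>, the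
        radical of every form, so commutators in \<open>E1 w\<close> can be achieved for
        \<open>y\<close> too.\<close>
      have czE: "u \<in> U" if "u \<in> cz E" for u
        by (rule splits_U[OF s cz_carrier[OF that] _ czD[OF that]]) (use s1 cz_carrier[OF that] in simp)
      have om1: "\<eta>1 (commutator G u t) \<doteq> 0" if "u \<in> cz E" "t \<in> cz (E1 w)" for u t
        by (rule om_U(1)[OF \<eta>1(1) cz_carrier[OF that(2)] czE[OF that(1)]])
      have "\<exists>y\<in>carrier G. (\<forall>b\<in>carrier G. \<exists>e\<in>E1 w. cj b y = e \<otimes> y) \<and> (\<forall>u\<in>U. cj u y = z [^] \<eta>1 u \<otimes> y)"
        by (rule quad_element_cz[OF \<eta>1(1) E1_sub[OF w] EE1 z_E1[OF w] \<eta>1(2)[OF E_N] om_cz_E1[OF w \<eta>1(1) om1]]) auto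
      then show ?thesis using sp by blast
    qed
  qed
  then obtain y where y: "special y" "s = \<one> \<Longrightarrow> (\<forall>b\<in>carrier G. \<exists>e\<in>E1 w. cj b y = e \<otimes> y)" by blast
  note yd = specialD(1,2)[OF y(1)] and yG = specialD(4)[OF y(1)]
  have yU: "y \<in> U" using yd(1) N_U by blast
  note yh = h(3)[OF yU] and ny = \<eta>y[OF yd]
  show False
  proof (cases "s = \<one>")
    case False
    then have sc: "r [^] p \<noteq> s [^] p" if "central r" for r using s that unfolding splits_def by blast
    \<comment> \<open>\<open>s\<close> has commutators in <z>, a part of \<open>E1 w\<close>, so it
      may serve to repair the order of \<open>h\<close>.\<close>
    have sE: "\<exists>e\<in>E1 w. cj b s = e \<otimes> s" if b: "b \<in> carrier G" for b
    proof
      show "cj b s = z [^] ch s b \<otimes> s" using ch[OF sD b] z_comm[OF D_carrier[OF sD]] by simp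
      show "z [^] ch s b \<in> E1 w" by (rule subgroup_int_pow[OF E1_sub[OF w] z_E1[OF w]])
    qed
    show False
      by (rule no_order_correction[OF y(1) w w2 h(1) hM h(2) yh ny D_N[OF sD] D_U[OF sD subsetD[OF N_U]] sE sc])
  next
    case True
    \<comment> \<open>Now \<open>y\<close> has commutators in \<open>E1 w\<close>. Either its
      \<open>p\<close>-th power repairs the order of \<open>h\<close>, or \<open>y\<close> has order
      \<open>p\<close> up to a central factor and itself becomes \<open>c\<close>, moved by
      \<open>h\<close>.\<close>
    note yE = bspec[OF y(2)[OF True]]
    show False
    proof (cases "\<exists>r. central r \<and> r [^] p = y [^] p")
      case False
      then have yr: "r [^] p \<noteq> y [^] p" if "central r" for r using that by blast
      show False by (rule no_order_correction[OF y(1) w w2 h(1) hM h(2) yh ny yd(1) specialD(3)[OF y(1)] yE yr])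
    next
      case True
      then obtain r where r: "central r" "r [^] p = y [^] p" by blast
      note rG = centralD(1)[OF r(1)]
      define c where "c = y \<otimes> inv r"
      have cG: "c \<in> carrier G" using yG rG by (simp add: c_def)
      have "c [^] p = y [^] p \<otimes> (inv r) [^] p"
        unfolding c_def using yG rG central_comm[OF central_inv[OF r(1)], of y] by (intro int_pow_mult_distrib) auto
      then have cp: "c [^] p = \<one>" using r(2)[symmetric] rG by (simp add: int_pow_inv)
      have cN: "cj n c = c" if n: "n \<in> N" for n
        unfolding c_def using specialD(3)[OF y(1) n] yG rG centralD(2)[OF r(1)] N_carrier[OF n] by (simp add: cj_mult cj_inv)
      have cM: "cj m c = c" if "m \<in> M" for m using cN M_N that by blast
      have cf: "inv c \<otimes> cj b c \<in> E1 w" if b: "b \<in> carrier G" for b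
      proof -
        obtain e where e: "e \<in> E1 w" "cj b y = e \<otimes> y" using yE[OF b] by blast
        have "cj b c = e \<otimes> c" unfolding c_def using b yG rG e(2) centralD(2)[OF r(1) b] E_carrier[OF E1_E[OF e(1)]]
          by (simp add: cj_mult cj_inv m_assoc)
        then show ?thesis using left_to_right[OF cG cM E1_E[OF e(1)]] e(1) by simp
      qed
      have "cj h y = z [^] (- \<eta> y) \<otimes> y" by (rule flip[OF yG h(1) yh])
      then have "cj h c = z [^] (- \<eta> y) \<otimes> c" unfolding c_def using h(1) yG rG centralD(2)[OF r(1) h(1)]
        by (simp add: cj_mult cj_inv m_assoc)
      then have hc: "cj h c = c \<otimes> z [^] (- \<eta> y)" using z_comm[OF cG] by simp
      have "\<not> p dvd - \<eta> y" using ny by simp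
      from no_central_element_of_N_moved[OF y(1) w w2 cG cp cf cN h(1) hM this hc] show False .
    qed
  qed
qed

end

section \<open>The theorem\<close>

lemma (in group) nontrivial_center:
  fixes q :: nat
  assumes fin: "finite (carrier G)" and q: "Factorial_Ring.prime q" and card: "card (carrier G) = q ^ n"
    and nt: "carrier G \<noteq> {\<one>}"
  obtains x where "x \<in> carrier G" "x \<noteq> \<one>" "\<And>g. g \<in> carrier G \<Longrightarrow> cj g x = x"
proof (rule ccontr)
  note T = that
  assume no: "\<not> thesis"
  have H: "x = \<one>" if x: "x \<in> carrier G" "\<And>g. g \<in> carrier G \<Longrightarrow> cj g x = x" for x
    using T[OF x(1) _ x(2)] no by blast
  let ?\<phi> = "\<lambda>g. \<lambda>h\<in>carrier G. g \<otimes> h \<otimes> inv g"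
  let ?O = "orbits G (carrier G) ?\<phi>"
  interpret A: group_action G "carrier G" ?\<phi> by (rule action_by_conjugation)
  have orb1: "orbit G ?\<phi> \<one> = {\<one>}" by (auto simp: orbit_def intro!: exI[of _ \<one>])
  have fixed: "x = \<one>" if x: "x \<in> carrier G" "orbit G ?\<phi> x = {x}" for x
  proof (rule H[OF x(1)])
    fix g assume g: "g \<in> carrier G"
    have "?\<phi> (inv g) x \<in> orbit G ?\<phi> x" using g inv_closed unfolding orbit_def by blast
    then show "cj g x = x" using x g by (simp add: cj_def)
  qed
  have fO: "finite ?O"
  proof -
    have "?O \<subseteq> orbit G ?\<phi> ` carrier G" by (auto simp: orbits_def)
    then show ?thesis using fin finite_surj by blast
  qed
  have dv: "q dvd card X'" if "X' \<in> ?O - {{\<one>}}" for X'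
  proof -
    obtain x where x: "x \<in> carrier G" "X' = orbit G ?\<phi> x" using \<open>X' \<in> ?O - {{\<one>}}\<close> by (auto simp: orbits_def)
    have "card X' dvd q ^ n"
      by (rule dvdI[OF A.orbit_stabilizer_theorem[OF x(1), unfolded order_def card x(2)[symmetric], symmetric]])
    then obtain k where k: "card X' = q ^ k" using divides_primepow_nat[OF q] by blast
    have "k \<noteq> 0"
    proof
      assume "k = 0"
      then obtain y where y: "X' = {y}" using k card_1_singletonE by auto
      have "x \<in> X'" unfolding x(2) by (rule A.orbit_refl[OF x(1)])
      then have "X' = {x}" using y by blast
      then have "x = \<one>" by (intro fixed[OF x(1)]) (simp only: x(2))
      then show False using \<open>X' \<in> ?O - {{\<one>}}\<close> x(2) orb1 by simp
    qed
    then show ?thesis using k by (simp add: dvd_power)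
  qed
  have "card (carrier G) = (\<Sum>X'\<in>?O. card X')"
    using A.disjoint_sum[OF fin, of "\<lambda>_. 1::nat"] by simp
  also have "\<dots> = card {\<one>} + (\<Sum>X'\<in>?O - {{\<one>}}. card X')"
  proof (rule sum.remove[OF fO])
    show "{\<one>} \<in> ?O" unfolding orbits_def using orb1[symmetric] one_closed by blast
  qed
  finally have e1: "q ^ n = 1 + (\<Sum>X'\<in>?O - {{\<one>}}. card X')" using card by simp
  have e2: "q dvd (\<Sum>X'\<in>?O - {{\<one>}}. card X')" by (rule dvd_sum) (rule dv)
  have "q dvd q ^ n"
  proof -
    have "n \<noteq> 0"
    proof
      assume "n = 0"
      then obtain y where "carrier G = {y}" using card card_1_singletonE by auto
      then show False using nt one_closed by auto
    qed
    then show ?thesis by (simp add: dvd_power)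
  qed
  then have "q dvd 1 + (\<Sum>X'\<in>?O - {{\<one>}}. card X')" by (simp only: e1)
  then have "q dvd 1" using dvd_add_left_iff[OF e2] by blast
  then show False using q by auto
qed

text \<open>Everything is read off from exponents of \<zeta>. An element that is not a central
  \<open>p\<close>-th power has an exponent prime to \<open>p\<close>, and the inverse of this
  exponent modulo \<open>p\<close> gives the required \<open>i\<close>.\<close>

lemma (in fin_p_group) cyclic_center_facts:
  assumes \<zeta>: "\<zeta> \<in> carrier G" "\<And>g. g \<in> carrier G \<Longrightarrow> cj g \<zeta> = \<zeta>"
    and cyc: "\<And>x. x \<in> carrier G \<Longrightarrow> (\<And>g. g \<in> carrier G \<Longrightarrow> cj g x = x) \<Longrightarrow> \<exists>k::int. x = \<zeta> [^] k"
    and ord: "int (ord \<zeta>) = p * m"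
  defines "z \<equiv> \<zeta> [^] m"
  shows "z [^] p = \<one>" "z \<noteq> \<one>"
    "x \<in> carrier G \<Longrightarrow> (\<And>g. g \<in> carrier G \<Longrightarrow> cj g x = x) \<Longrightarrow> x [^] p = \<one> \<Longrightarrow> \<exists>k::int. x = z [^] k"
    "u \<in> carrier G \<Longrightarrow> v \<in> carrier G \<Longrightarrow> (\<And>g. g \<in> carrier G \<Longrightarrow> cj g u = u) \<Longrightarrow> (\<And>g. g \<in> carrier G \<Longrightarrow> cj g v = v) \<Longrightarrow>
        \<not> (\<exists>r\<in>carrier G. (\<forall>g\<in>carrier G. cj g r = r) \<and> r [^] p = u) \<Longrightarrow>
        \<exists>i::int. \<exists>r\<in>carrier G. (\<forall>g\<in>carrier G. cj g r = r) \<and> r [^] p = v \<otimes> u [^] i"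
proof -
  have p0: "p > 0" by (rule prime_gt_0_int[OF prime_p])
  have cpow: "cj g (\<zeta> [^] (k::int)) = \<zeta> [^] k" if "g \<in> carrier G" for g k
    using \<zeta> that by (simp add: cj_int_pow)
  show "z [^] p = \<one>" unfolding z_def using \<zeta>(1) ord by (simp add: int_pow_pow int_pow_eq_id mult.commute)
  have m0: "m > 0"
  proof -
    have "int (ord \<zeta>) > 0" using ord_ge_1[OF fin \<zeta>(1)] by simp
    then show ?thesis using ord p0 by (simp add: zero_less_mult_iff)
  qed
  show "z \<noteq> \<one>"
  proof
    assume "z = \<one>"
    then have "p * m dvd m" unfolding z_def using \<zeta>(1) ord by (simp add: int_pow_eq_id)
    then have "p * m \<le> m" using m0 by (rule zdvd_imp_le)
    moreover have "p \<ge> 2" by (rule prime_ge_2_int[OF prime_p])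
    ultimately show False using m0 by (simp add: mult_le_cancel_right1)
  qed
  show "\<exists>k::int. x = z [^] k" if x: "x \<in> carrier G" "\<And>g. g \<in> carrier G \<Longrightarrow> cj g x = x" "x [^] p = \<one>"
  proof -
    obtain k where k: "x = \<zeta> [^] (k::int)" using cyc[OF x(1,2)] by blast
    have "p * m dvd k * p" using x(3) unfolding k using \<zeta>(1) ord by (simp add: int_pow_pow int_pow_eq_id)
    then have "m dvd k" using p0 by (simp add: mult.commute)
    then obtain l where "k = m * l" by blast
    then have "x = z [^] l" unfolding k z_def using \<zeta>(1) by (simp add: int_pow_pow)
    then show ?thesis by blast
  qed
  show "\<exists>i::int. \<exists>r\<in>carrier G. (\<forall>g\<in>carrier G. cj g r = r) \<and> r [^] p = v \<otimes> u [^] i"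
    if u: "u \<in> carrier G" "v \<in> carrier G" "\<And>g. g \<in> carrier G \<Longrightarrow> cj g u = u" "\<And>g. g \<in> carrier G \<Longrightarrow> cj g v = v"
      and no: "\<not> (\<exists>r\<in>carrier G. (\<forall>g\<in>carrier G. cj g r = r) \<and> r [^] p = u)"
  proof -
    obtain a where a: "u = \<zeta> [^] (a::int)" using cyc[OF u(1,3)] by blast
    obtain b where b: "v = \<zeta> [^] (b::int)" using cyc[OF u(2,4)] by blast
    have "\<not> p dvd a"
    proof
      assume "p dvd a"
      then obtain l where "a = p * l" by blast
      then have "(\<zeta> [^] l) [^] p = u" unfolding a using \<zeta>(1) by (simp add: int_pow_pow mult.commute)
      then show False using no cpow[of _ l] \<zeta>(1) by blast
    qed
    then obtain j where j: "a * j \<doteq> 1" by (rule prime_inverse)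
    define i where "i = - b * j"
    have "b + a * i \<doteq> 0" using j unfolding i_def by Groebner_Basis.algebra
    then obtain l where l: "b + a * i = p * l" by auto
    have "v \<otimes> u [^] i = \<zeta> [^] (p * l)" unfolding a b l[symmetric] using \<zeta>(1) by (simp add: int_pow_pow int_pow_mult)
    also have "\<dots> = (\<zeta> [^] l) [^] p" using \<zeta>(1) by (simp add: int_pow_pow mult.commute)
    finally have "(\<zeta> [^] l) [^] p = v \<otimes> u [^] i" by simp
    then show ?thesis using cpow[of _ l] \<zeta>(1) by blast
  qed
qed

lemma (in group) card_subgroup_dvd:
  assumes "finite (carrier G)" "subgroup H G" "subgroup K G" "H \<subseteq> K"
  shows "card H dvd card K"
proof -
  have "subgroup H (G\<lparr>carrier := K\<rparr>)" using assms subgroup_incl by blast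
  from group.lagrange[OF subgroup_imp_group[OF assms(3)] this] have "card K = card (rcosets\<^bsub>G\<lparr>carrier := K\<rparr>\<^esub> H) * card H"
    by (simp add: order_def)
  then show ?thesis by simp
qed

text \<open>A point outside \<open>V\<close> is separated from \<open>V\<close> by a character
  modulo \<open>p\<close>, and the kernel of a nonzero character is a maximal subgroup.\<close>

lemma (in fin_p_group) frattini_subset:
  assumes V: "subgroup V G" "\<And>a b. a \<in> carrier G \<Longrightarrow> b \<in> carrier G \<Longrightarrow> commutator G a b \<in> V"
    "\<And>y. y \<in> carrier G \<Longrightarrow> y [^] p \<in> V"
  shows "frattini G \<subseteq> V"
proof (rule ccontr)
  assume "\<not> frattini G \<subseteq> V"
  then obtain g where g: "g \<in> frattini G" "g \<notin> V" by blast
  have gG: "g \<in> carrier G" using g(1) by (simp add: frattini_def)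
  have one: "\<not> p dvd 1" using prime_p by auto
  obtain f where f: "pchar (carrier G) f" "\<And>x. x \<in> V \<Longrightarrow> f x \<doteq> 0" "f g \<doteq> 1"
    using separation[OF subgroup_self V(1) subgroup.subset[OF V(1)] V(2,3) gG g(2)] by blast
  let ?K = "{y \<in> carrier G. f y \<doteq> 0}"
  have gK: "g \<notin> ?K"
  proof
    assume "g \<in> ?K"
    then have "f g \<doteq> 0" by blast
    with f(3) have "p dvd 1" by Groebner_Basis.algebra
    then show False using one by simp
  qed
  have "maximal_subgroup G ?K" unfolding maximal_subgroup_def
  proof (intro conjI allI impI)
    show "subgroup ?K G" by (rule pchar_kernel[OF subgroup_self f(1)])
    show "?K \<noteq> carrier G" using gK gG by blast
    fix H assume H: "subgroup H G \<and> ?K \<subseteq> H"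
    show "H = ?K \<or> H = carrier G"
    proof (rule disjCI)
      assume "H \<noteq> carrier G"
      have HG: "H \<subseteq> carrier G" using H subgroup.subset by blast
      have "f h \<doteq> 0" if h: "h \<in> H" for h
      proof (rule ccontr)
        assume "\<not> f h \<doteq> 0"
        then have "\<not> p dvd f h" by simp
        then obtain j where j: "f h * j \<doteq> 1" by (rule prime_inverse)
        have hG: "h \<in> carrier G" using h HG by blast
        have "carrier G \<subseteq> H"
        proof
          fix x assume x: "x \<in> carrier G"
          define k where "k = - j * f x"
          have hk: "h [^] k \<in> H" using H h subgroup_int_pow by blast
          have "f (x \<otimes> h [^] k) \<doteq> f x + f (h [^] k)" by (rule pcharD[OF f(1) x]) (use hG in simp)
          moreover have "f (h [^] k) \<doteq> k * f h" by (rule pchar_int_pow[OF subgroup_self f(1) hG])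
          ultimately have "f (x \<otimes> h [^] k) \<doteq> 0" using j unfolding k_def by Groebner_Basis.algebra
          then have xh: "x \<otimes> h [^] k \<in> H" using H x hG by auto
          have "x = (x \<otimes> h [^] k) \<otimes> inv (h [^] k)" using x hG by (simp add: m_assoc)
          then show "x \<in> H" using subgroup.m_closed[OF _ xh subgroup.m_inv_closed[OF _ hk]] H by metis
        qed
        then show False using \<open>H \<noteq> carrier G\<close> HG by blast
      qed
      then show "H = ?K" using H HG by blast
    qed
  qed
  then have "g \<in> ?K" using g(1) unfolding frattini_def by blast
  then show False using gK by simp
qed

text \<open>Since \<delta> kills its own values, right multiplication of g by powers of \<delta>(g)
  does not change \<delta>(g), so each iteration adds the same factor.\<close>

lemma (in group) derivation_pow:
  assumes d: "\<And>a. a \<in> carrier G \<Longrightarrow> \<delta> a \<in> carrier G"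
    "\<And>a b. a \<in> carrier G \<Longrightarrow> b \<in> carrier G \<Longrightarrow> \<delta> (a \<otimes> b) = cj b (\<delta> a) \<otimes> \<delta> b"
    "\<And>a. a \<in> carrier G \<Longrightarrow> \<delta> (\<delta> a) = \<one>"
    and g: "g \<in> carrier G"
  shows "((\<lambda>g. g \<otimes> \<delta> g) ^^ n) g = g \<otimes> \<delta> g [^] (n::nat)"
proof (induction n)
  case 0 show ?case using g by simp
next
  case (Suc n)
  note dG = d(1)[OF g]
  have pG: "\<delta> g [^] k \<in> carrier G" for k :: nat using dG by simp
  have "\<delta> \<one> = \<delta> \<one> \<otimes> \<delta> \<one>" using d(1)[of \<one>] d(2)[of \<one> \<one>] by simp
  then have d1: "\<delta> \<one> = \<one>" using d(1)[of \<one>] by simp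
  have dk: "\<delta> (\<delta> g [^] k) = \<one>" for k :: nat
  proof (induction k)
    case 0 show ?case using d1 by simp
  next
    case (Suc k) then show ?case using d(2)[OF pG dG] d(3)[OF g] dG by simp
  qed
  have "\<delta> g [^] n \<otimes> \<delta> g = \<delta> g \<otimes> \<delta> g [^] n" by (rule group_commutes_pow[OF refl dG dG])
  then have "cj (\<delta> g [^] n) (\<delta> g) = \<delta> g" using cj_fix_iff[OF pG dG] by simp
  then have "\<delta> (g \<otimes> \<delta> g [^] n) = \<delta> g" using d(2)[OF g pG] dk dG by simp
  then show ?case using Suc g dG by (simp add: m_assoc)
qed

lemma (in group) order_p_automorphism:
  assumes fin: "finite (carrier G)" and q: "q > (0::nat)"
    and d: "\<And>a. a \<in> carrier G \<Longrightarrow> \<delta> a \<in> carrier G"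
    "\<And>a b. a \<in> carrier G \<Longrightarrow> b \<in> carrier G \<Longrightarrow> \<delta> (a \<otimes> b) = cj b (\<delta> a) \<otimes> \<delta> b"
    "\<And>a. a \<in> carrier G \<Longrightarrow> \<delta> a [^] q = \<one>" "\<And>a. a \<in> carrier G \<Longrightarrow> \<delta> (\<delta> a) = \<one>"
  defines "\<phi> \<equiv> \<lambda>g. g \<otimes> \<delta> g"
  shows "\<phi> \<in> iso G G" "\<And>g. g \<in> carrier G \<Longrightarrow> (\<phi> ^^ q) g = g"
proof -
  show id: "(\<phi> ^^ q) g = g" if g: "g \<in> carrier G" for g
    unfolding \<phi>_def using derivation_pow[of \<delta> g q] d g by simp
  have cl: "\<phi> g \<in> carrier G" if "g \<in> carrier G" for g unfolding \<phi>_def using d(1) that by simp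
  have "\<phi> (a \<otimes> b) = \<phi> a \<otimes> \<phi> b" if ab: "a \<in> carrier G" "b \<in> carrier G" for a b
    unfolding \<phi>_def d(2)[OF ab] cj_def using d(1)[OF ab(1)] d(1)[OF ab(2)] ab by (simp add: m_assoc)
  then have hom: "\<phi> \<in> hom G G" using cl by (auto simp: hom_def)
  have "inj_on \<phi> (carrier G)"
  proof (rule inj_onI)
    fix a b assume ab: "a \<in> carrier G" "b \<in> carrier G" "\<phi> a = \<phi> b"
    obtain m where m: "q = Suc m" using q gr0_implies_Suc by blast
    have "(\<phi> ^^ q) a = (\<phi> ^^ q) b" unfolding m funpow_Suc_right by (simp add: ab(3))
    then show "a = b" using id ab by simp
  qed
  moreover from this have "\<phi> ` carrier G = carrier G" using cl fin by (intro endo_inj_surj) auto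
  ultimately show "\<phi> \<in> iso G G" using hom by (simp add: iso_def bij_betw_def)
qed

theorem theorem4p5:
  fixes G :: "('a, 'b) monoid_scheme" and p :: nat and T :: nat and P :: "nat \<Rightarrow> 'a set" and i :: nat
  assumes grp: "group G"
    and fin: "finite (carrier G)"
    and prime: "Factorial_Ring.prime p" and odd: "odd p"
    and pgroup: "\<exists>n. card (carrier G) = p ^ n"
    and nonab: "\<not> comm_group G"
    and cyc_center: "\<exists>z \<in> center_of G (carrier G). center_of G (carrier G) = generate G {z}"
    and omega_center: "Omega1 G p (center_of G (carrier G))
                         \<subseteq> generate G (lower_central G 3 \<union> power_subgroup G p)"
    and T_pos: "T \<ge> 1"
    and index: "card (frattini G) = p ^ T * card (generate G (lower_central G 3 \<union> power_subgroup G p))"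
    and P_T: "P T = generate G (lower_central G 3 \<union> power_subgroup G p)"
    and P_0: "P 0 = frattini G"
    and P_normal: "\<And>j. j \<le> T \<Longrightarrow> P j \<lhd> G"
    and P_chain: "\<And>j. j < T \<Longrightarrow> P (Suc j) \<subseteq> P j"
    and P_index: "\<And>j. j < T \<Longrightarrow> card (P j) = p * card (P (Suc j))"
    and i_lt: "i < T"
    and selfcent: "centralizer_of G (P i) \<subseteq> P i"
    and der_inner: "\<forall>\<delta> \<in> derivations G (P i) (Omega1 G p (center_of G (P i))).
                      is_inner G (\<lambda>g. g \<otimes>\<^bsub>G\<^esub> \<delta> g)"
    and not_selfcent: "\<not> centralizer_of G (P (Suc i)) \<subseteq> P (Suc i)"
  shows "\<exists>\<phi>. \<phi> \<in> iso G G \<and> \<not> is_inner G \<phi>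
           \<and> (\<forall>g \<in> carrier G. (\<phi> ^^ p) g = g) \<and> (\<exists>g \<in> carrier G. \<phi> g \<noteq> g)"
proof (rule ccontr)
  assume no: "\<not> ?thesis"
  interpret group G by (rule grp)
  interpret pg: fin_p_group G "int p"
    by unfold_locales (use fin prime odd in auto)
  let ?Z = "center_of G (carrier G)" and ?N = "P i" and ?M = "P (Suc i)" and ?R = "P T"
  have p0: "p > 0" by (rule prime_gt_0_nat[OF prime])
  have Z: "x \<in> ?Z \<longleftrightarrow> x \<in> carrier G \<and> (\<forall>g\<in>carrier G. cj g x = x)" for x
    using cj_fix_iff unfolding center_of_def by auto
  obtain n where n: "card (carrier G) = p ^ n" using pgroup by blast
  obtain \<zeta> where \<zeta>: "\<zeta> \<in> ?Z" "?Z = generate G {\<zeta>}" using cyc_center by blast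
  have \<zeta>G: "\<zeta> \<in> carrier G" and \<zeta>c: "\<And>g. g \<in> carrier G \<Longrightarrow> cj g \<zeta> = \<zeta>" using \<zeta>(1) Z by auto
  have cyc: "\<exists>k::int. x = \<zeta> [^]\<^bsub>G\<^esub> k" if "x \<in> carrier G" "\<And>g. g \<in> carrier G \<Longrightarrow> cj g x = x" for x
  proof -
    have "x \<in> generate G {\<zeta>}" using that Z \<zeta>(2) by blast
    then show ?thesis unfolding generate_pow[OF \<zeta>G] by blast
  qed
  have "carrier G \<noteq> {\<one>\<^bsub>G\<^esub>}"
  proof
    assume t: "carrier G = {\<one>\<^bsub>G\<^esub>}"
    have "comm_group G" by (rule group_comm_groupI) (use t in auto)
    then show False using nonab by simp
  qed
  then obtain x0 where x0: "x0 \<in> carrier G" "x0 \<noteq> \<one>\<^bsub>G\<^esub>" "\<And>g. g \<in> carrier G \<Longrightarrow> cj g x0 = x0"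
    by (rule nontrivial_center[OF fin prime n]) blast
  have "\<zeta> \<noteq> \<one>\<^bsub>G\<^esub>"
  proof
    assume "\<zeta> = \<one>\<^bsub>G\<^esub>"
    then show False using cyc[OF x0(1,3)] x0(2) by simp
  qed
  then have o1: "ord \<zeta> \<noteq> 1" using ord_eq_1[OF \<zeta>G] by simp
  have "ord \<zeta> dvd p ^ n" using ord_dvd_group_order[OF \<zeta>G] n by (simp add: order_def)
  then obtain l where l: "ord \<zeta> = p ^ l" using divides_primepow_nat[OF prime] by blast
  then obtain l' where "l = Suc l'" using o1 by (cases l) auto
  then have om: "int (ord \<zeta>) = int p * int (p ^ l')" using l by simp
  define z where "z = \<zeta> [^]\<^bsub>G\<^esub> int (p ^ l')"
  note facts = pg.cyclic_center_facts[OF \<zeta>G \<zeta>c cyc om]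
  have zp: "z [^]\<^bsub>G\<^esub> int p = \<one>\<^bsub>G\<^esub>" unfolding z_def by (rule facts(1))
  have z1: "z \<noteq> \<one>\<^bsub>G\<^esub>" unfolding z_def by (rule facts(2))
  have zgen: "\<exists>k::int. x = z [^]\<^bsub>G\<^esub> k"
    if "x \<in> carrier G" "\<And>g. g \<in> carrier G \<Longrightarrow> cj g x = x" "x [^]\<^bsub>G\<^esub> int p = \<one>\<^bsub>G\<^esub>" for x
    unfolding z_def by (rule facts(3)[OF _ _ _ that])
  have cpow: "\<exists>k::int. \<exists>r\<in>carrier G. (\<forall>g\<in>carrier G. cj g r = r) \<and> r [^]\<^bsub>G\<^esub> int p = v \<otimes>\<^bsub>G\<^esub> u [^]\<^bsub>G\<^esub> k"
    if "u \<in> carrier G" "v \<in> carrier G" "\<And>g. g \<in> carrier G \<Longrightarrow> cj g u = u" "\<And>g. g \<in> carrier G \<Longrightarrow> cj g v = v"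
      "\<not> (\<exists>r\<in>carrier G. (\<forall>g\<in>carrier G. cj g r = r) \<and> r [^]\<^bsub>G\<^esub> int p = u)" for u v
    by (rule facts(4)[OF _ _ _ that])
  have zG: "z \<in> carrier G" using \<zeta>G by (simp add: z_def)
  have zc: "cj g z = z" if "g \<in> carrier G" for g using \<zeta>G \<zeta>c that by (simp add: z_def cj_int_pow)
  have Rsub: "subgroup ?R G" and Rn: "?R \<lhd> G" using P_normal[of T] normal_imp_subgroup by auto
  have chain: "P (j + k) \<subseteq> P j" if "j + k \<le> T" for j k
    using that
  proof (induction k)
    case (Suc k)
    then have "P (Suc (j + k)) \<subseteq> P (j + k)" by (intro P_chain) simp
    then show ?case using Suc by auto
  qed simp
  have RM: "?R \<subseteq> ?M" using chain[of "Suc i" "T - Suc i"] i_lt by simp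
  have MN: "?M \<subseteq> ?N" by (rule P_chain[OF i_lt])
  have NF: "?N \<subseteq> frattini G" using chain[of 0 i] i_lt P_0 by simp
  have Msub: "subgroup ?M G" and Nsub: "subgroup ?N G" 
    using normal_imp_subgroup[OF P_normal[of "Suc i"]] normal_imp_subgroup[OF P_normal[of i]] i_lt by simp_all
  have zR: "z \<in> ?R"
  proof -
    have "z \<in> ?Z" using zG zc Z by blast
    moreover have "z [^]\<^bsub>G\<^esub> p = \<one>\<^bsub>G\<^esub>" using zp by (simp only: int_pow_int)
    ultimately have "z \<in> {x \<in> ?Z. x [^]\<^bsub>G\<^esub> p = \<one>\<^bsub>G\<^esub>}" by simp
    then have "z \<in> Omega1 G p ?Z" unfolding Omega1_def by (rule generate.incl)
    then show ?thesis using omega_center P_T by blast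
  qed
  let ?C = "{commutator G a b | a b. a \<in> carrier G \<and> b \<in> carrier G}"
  have CG: "?C \<subseteq> carrier G" by auto
  have gens: "?C \<union> ?R \<subseteq> carrier G" using CG subgroup.subset[OF Rsub] by blast
  define U where "U = generate G (?C \<union> ?R)"
  have Usub: "subgroup U G" unfolding U_def by (rule generate_is_subgroup[OF gens])
  have Uc: "commutator G a b \<in> U" if "a \<in> carrier G" "b \<in> carrier G" for a b
    unfolding U_def by (rule generate.incl) (use that in blast)
  have RU: "?R \<subseteq> U" unfolding U_def by (auto intro: generate.incl)
  have \<gamma>: "lower_central G 2 = generate G ?C" "lower_central G 3 = comm_subgroup G (lower_central G 2) (carrier G)"
    by (simp_all add: numeral_2_eq_2 numeral_3_eq_3 comm_subgroup_def)
  have \<gamma>2: "lower_central G 2 \<subseteq> carrier G" unfolding \<gamma>(1) by (rule generate_incl[OF CG])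
  have R\<gamma>: "lower_central G 3 \<subseteq> ?R" unfolding P_T by (auto intro: generate.incl)
  have Rp: "g [^]\<^bsub>G\<^esub> int p \<in> ?R" if "g \<in> carrier G" for g
  proof -
    have "g [^]\<^bsub>G\<^esub> p \<in> power_subgroup G p" unfolding power_subgroup_def by (rule generate.incl) (use that in blast)
    then show ?thesis unfolding P_T int_pow_int by (auto intro: generate.incl)
  qed
  have Rcj: "cj g r \<in> ?R" if "r \<in> ?R" "g \<in> carrier G" for r g
    unfolding cj_def by (rule normal.inv_op_closed1[OF Rn that(2,1)])
  \<comment> \<open>U/R is central in G/R because \<open>R\<close> contains \<gamma>_3(G); the
    elements with all commutators in \<open>R\<close> form a subgroup.\<close>
  have Ucen: "commutator G u g \<in> ?R" if "u \<in> U" "g \<in> carrier G" for u g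
  proof -
    let ?B = "{u \<in> carrier G. \<forall>g\<in>carrier G. commutator G u g \<in> ?R}"
    have "subgroup ?B G"
    proof (rule subgroupI)
      have "\<one>\<^bsub>G\<^esub> \<in> ?B" using subgroup.one_closed[OF Rsub] by (simp add: commutator_def)
      then show "?B \<noteq> {}" by blast
      fix a b assume a: "a \<in> ?B" and b: "b \<in> ?B"
      have "commutator G (a \<otimes>\<^bsub>G\<^esub> b) h \<in> ?R" if h: "h \<in> carrier G" for h
        using a b h commutator_mult_left[of a b h] Rcj subgroup.m_closed[OF Rsub] by simp
      then show "a \<otimes>\<^bsub>G\<^esub> b \<in> ?B" using a b by simp
      have "commutator G (inv\<^bsub>G\<^esub> a) h \<in> ?R" if h: "h \<in> carrier G" for h
      proof -
        have aG: "a \<in> carrier G" and ah: "commutator G a h \<in> ?R" using a h by auto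
        have "commutator G (inv\<^bsub>G\<^esub> a) h = inv\<^bsub>G\<^esub> (cj (inv\<^bsub>G\<^esub> a) (commutator G a h))"
          using aG h by (simp add: commutator_def cj_def inv_mult_group m_assoc)
        then show ?thesis using Rcj[OF ah inv_closed[OF aG]] subgroup.m_inv_closed[OF Rsub] by simp
      qed
      then show "inv\<^bsub>G\<^esub> a \<in> ?B" using a by simp
    qed auto
    moreover have "?C \<union> ?R \<subseteq> ?B"
    proof
      fix u assume u: "u \<in> ?C \<union> ?R"
      then have uG: "u \<in> carrier G" using gens by blast
      have "commutator G u h \<in> ?R" if h: "h \<in> carrier G" for h
      proof (cases "u \<in> ?R")
        case True
        have "inv\<^bsub>G\<^esub> u \<otimes>\<^bsub>G\<^esub> cj h u \<in> ?R"
          by (rule subgroup.m_closed[OF Rsub subgroup.m_inv_closed[OF Rsub True] Rcj[OF True h]])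
        then show ?thesis using commutator_eq_cj[OF h uG] by simp
      next
        case False
        then have "u \<in> lower_central G 2" unfolding \<gamma>(1) using u by (intro generate.incl) blast
        then have "commutator G u h \<in> lower_central G 3"
          unfolding \<gamma>(2) comm_subgroup_def using h by (intro generate.incl) blast
        then show ?thesis using R\<gamma> by blast
      qed
      then show "u \<in> ?B" using uG by simp
    qed
    ultimately have "U \<subseteq> ?B" unfolding U_def by (rule generate_subgroup_incl[rotated])
    then show ?thesis using that by blast
  qed
  have Uchar: "int p dvd f u - 0" if f: "pg.pchar (carrier G) f" and u: "u \<in> U" for f u
  proof -
    let ?K = "{y \<in> carrier G. int p dvd f y - 0}"
    have K: "subgroup ?K G" by (rule pg.pchar_kernel[OF subgroup_self f])
    have CK: "commutator G a b \<in> ?K" if "a \<in> carrier G" "b \<in> carrier G" for a b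
      using pg.pchar_commutator[OF subgroup_self f that] that by simp
    have "lower_central G 3 \<subseteq> ?K" unfolding \<gamma>(2) comm_subgroup_def
      by (rule generate_subgroup_incl[OF _ K]) (use CK \<gamma>2 in blast)
    moreover have "power_subgroup G p \<subseteq> ?K" unfolding power_subgroup_def
    proof (rule generate_subgroup_incl[OF _ K], clarify)
      fix g assume g: "g \<in> carrier G"
      have "int p dvd f (g [^]\<^bsub>G\<^esub> p) - int p * f g" by (rule pg.pchar_nat_pow[OF subgroup_self f g])
      then have "int p dvd (f (g [^]\<^bsub>G\<^esub> p) - int p * f g) + int p * f g" by (rule dvd_add) simp
      then have "int p dvd f (g [^]\<^bsub>G\<^esub> p) - 0" by simp
      then show "g [^]\<^bsub>G\<^esub> p \<in> carrier G \<and> int p dvd f (g [^]\<^bsub>G\<^esub> p) - 0" using g by simp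
    qed
    ultimately have "?R \<subseteq> ?K" unfolding P_T by (intro generate_subgroup_incl[OF _ K]) blast
    then have "U \<subseteq> ?K" unfolding U_def by (intro generate_subgroup_incl[OF _ K]) (use CK in blast)
    then show ?thesis using u by blast
  qed
  have Ugen: "int p dvd f u - 0" if f: "pg.pchar U f" and r: "\<And>r. r \<in> ?R \<Longrightarrow> int p dvd f r - 0"
      and c: "\<And>a b. a \<in> carrier G \<Longrightarrow> b \<in> carrier G \<Longrightarrow> int p dvd f (commutator G a b) - 0"
      and u: "u \<in> U" for f u
  proof -
    let ?K = "{y \<in> U. int p dvd f y - 0}"
    have K: "subgroup ?K G" by (rule pg.pchar_kernel[OF Usub f])
    have "?C \<union> ?R \<subseteq> ?K" using r c RU Uc by blast
    then have "U \<subseteq> ?K" unfolding U_def by (rule generate_subgroup_incl[OF _ K[unfolded U_def]])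
    then show ?thesis using u by blast
  qed
  have NU: "?N \<subseteq> U" using NF pg.frattini_subset[OF Usub Uc] Rp RU by blast
  have cN: "card ?N = p * card ?M" by (rule P_index[OF i_lt])
  have finN: "finite ?N" using fin subgroup.subset[OF Nsub] finite_subset by blast
  have cM: "card ?M > 0" using subgroup.one_closed[OF Msub] finN MN card_gt_0_iff finite_subset by blast
  have Mprop: "\<exists>y\<in>?N. y \<notin> ?M"
  proof (rule ccontr)
    assume "\<not> (\<exists>y\<in>?N. y \<notin> ?M)"
    then have "?N = ?M" using MN by blast
    then have "p = 1" using cN cM by simp
    then show False using prime by simp
  qed
  have NM: "\<exists>k::int. \<exists>m\<in>?M. x = y [^]\<^bsub>G\<^esub> k \<otimes>\<^bsub>G\<^esub> m" if y: "y \<in> ?N" "y \<notin> ?M" and x: "x \<in> ?N" for x y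
  proof -
    have yG: "y \<in> carrier G" using y(1) subgroup.mem_carrier[OF Nsub] by blast
    have Mn: "?M \<lhd> G" using P_normal i_lt by simp
    have "cj (y [^]\<^bsub>G\<^esub> k) m \<in> ?M" if "m \<in> ?M" for m and k :: int
      unfolding cj_def by (rule normal.inv_op_closed1[OF Mn _ that]) (use yG in simp)
    \<comment> \<open>The index of \<open>M\<close> in \<open>N\<close> is the prime
      \<open>p\<close>, so \<open>y\<close> and \<open>M\<close> generate all of
      \<open>N\<close>.\<close>
    note A = pg.adj_subgroup[OF Msub yG this]
    have AN: "pg.adj ?M y \<subseteq> ?N" by (rule pg.adj_least[OF Nsub MN y(1)])
    obtain a where a: "card (pg.adj ?M y) = card ?M * a" using card_subgroup_dvd[OF fin Msub A(1,2)] by blast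
    have "card ?M * a dvd card ?M * p"
      using card_subgroup_dvd[OF fin A(1) Nsub AN] unfolding a cN by (simp only: mult.commute)
    then have "a dvd p" using cM by simp
    moreover have "a \<noteq> 1"
    proof
      assume "a = 1"
      then have "?M = pg.adj ?M y" using a A(2) finite_subset[OF AN finN] by (intro card_subset_eq) auto
      then show False using A(3) y(2) by blast
    qed
    ultimately have "a = p" using prime by (meson prime_nat_iff)
    then have "pg.adj ?M y = ?N" using a cN AN finN by (intro card_subset_eq) (auto simp: mult.commute)
    then show ?thesis using x unfolding pg.adj_def by blast
  qed
  have Nself: "c \<in> ?N" if "c \<in> carrier G" "\<And>y. y \<in> ?N \<Longrightarrow> cj y c = c" for c
  proof -
    have "c \<in> centralizer_of G ?N"
      unfolding centralizer_of_def using that cj_fix_iff subgroup.mem_carrier[OF Nsub] by simp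
    then show ?thesis using selfcent by blast
  qed
  have der: "\<exists>x\<in>carrier G. \<forall>b\<in>carrier G. cj b x = \<delta> b \<otimes>\<^bsub>G\<^esub> x"
    if d: "\<And>a. a \<in> carrier G \<Longrightarrow> \<delta> a \<in> carrier G"
      "\<And>a b. a \<in> carrier G \<Longrightarrow> b \<in> carrier G \<Longrightarrow> \<delta> (a \<otimes>\<^bsub>G\<^esub> b) = cj b (\<delta> a) \<otimes>\<^bsub>G\<^esub> \<delta> b"
      "\<And>a. a \<in> carrier G \<Longrightarrow> \<delta> a [^]\<^bsub>G\<^esub> int p = \<one>\<^bsub>G\<^esub>" "\<And>a. a \<in> carrier G \<Longrightarrow> \<delta> (\<delta> a) = \<one>\<^bsub>G\<^esub>" for \<delta>
  proof -
    let ?\<phi> = "\<lambda>g. g \<otimes>\<^bsub>G\<^esub> \<delta> g"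
    note aut = order_p_automorphism[OF fin p0 d(1,2) d(3)[unfolded int_pow_int] d(4)]
    have "is_inner G ?\<phi>"
    proof (rule ccontr)
      assume ni: "\<not> is_inner G ?\<phi>"
      \<comment> \<open>The identity map is inner, so a non-inner map here has order exactly
        \<open>p\<close>.\<close>
      have "\<exists>g\<in>carrier G. ?\<phi> g \<noteq> g"
      proof (rule ccontr)
        assume "\<not> (\<exists>g\<in>carrier G. ?\<phi> g \<noteq> g)"
        then have "is_inner G ?\<phi>" unfolding is_inner_def by (intro bexI[of _ "\<one>\<^bsub>G\<^esub>"]) auto
        then show False using ni by simp
      qed
      then show False using no ni aut by blast
    qed
    then obtain h where h: "h \<in> carrier G" "\<And>g. g \<in> carrier G \<Longrightarrow> g \<otimes>\<^bsub>G\<^esub> \<delta> g = inv\<^bsub>G\<^esub> h \<otimes>\<^bsub>G\<^esub> g \<otimes>\<^bsub>G\<^esub> h"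
      unfolding is_inner_def by blast
    \<comment> \<open>Solving g \<delta>(g) = h^(-1) g h for \<delta>(g) shows that the inverse of
      the conjugating element is the \<open>x\<close> wanted.\<close>
    show ?thesis
    proof (rule bexI[of _ "inv\<^bsub>G\<^esub> h"], rule ballI)
      fix b assume b: "b \<in> carrier G"
      have "\<delta> b = inv\<^bsub>G\<^esub> b \<otimes>\<^bsub>G\<^esub> (b \<otimes>\<^bsub>G\<^esub> \<delta> b)" using b d(1) by simp
      then have "\<delta> b = inv\<^bsub>G\<^esub> b \<otimes>\<^bsub>G\<^esub> (inv\<^bsub>G\<^esub> h \<otimes>\<^bsub>G\<^esub> b \<otimes>\<^bsub>G\<^esub> h)" unfolding h(2)[OF b] .
      then show "cj b (inv\<^bsub>G\<^esub> h) = \<delta> b \<otimes>\<^bsub>G\<^esub> inv\<^bsub>G\<^esub> h" using b h(1) by (simp add: cj_def m_assoc)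
    qed (use h in simp)
  qed
  interpret st: p_stage G "int p" z ?R U ?M ?N
    by (rule p_stage.intro[OF pg.fin_p_group_axioms], rule p_stage_axioms.intro)
      (fact zG z1 zp zc zgen cpow Rsub Msub Nsub Usub RM MN NU zR Uc Ucen Rp Uchar Ugen NM Mprop Nself der)+
  obtain c where "c \<in> centralizer_of G ?M" "c \<notin> ?M" using not_selfcent by blast
  then show False using st.centralizer_M_outside_M[of c] cj_fix_iff subgroup.mem_carrier[OF Msub]
    unfolding centralizer_of_def by auto
qed

end
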